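(* For every integer $d\ge 1$, with $I=[0,1]$, the set $\mathrm{CPE}(I^d)$ is a complete coanalytic subset of $\mathrm{TDS}(I^d)$.
   Context: For a compact metrizable space $X$, $\mathrm{TDS}(X)$ is the Polish space of all continuous maps $T:X\to X$ with the topology of the sup metric (uniform convergence). A topological dynamical system (TDS) is a pair $(X,T)$ with $X$ compact metrizable and $T:X\to X$ continuous. $(X_2,T_2)$ is a factor of $(X_1,T_1)$ if there is a continuous surjection $\phi:X_1\to X_2$ with $\phi\circ T_1=T_2\circ\phi$. $(X,T)$ has completely positive entropy (CPE) if every non-trivial factor (i.e. factor whose space is not a single point) has positive topological entropy. $\mathrm{CPE}(X)=\{T\in \mathrm{TDS}(X): (X,T)\text{ has CPE}\}$. A subset of a Polish space is analytic if it is the continuous image of a Borel subset of a Polish space, and coanalytic if its complement is analytic. A coanalytic subset $\mathcal A$ of a Polish space $\mathcal X$ is complete coanalytic if for every coanalytic subset $\mathcal B$ of a Polish space $\mathcal Y$ there is a Borel function $f:\mathcal Y\to\mathcal X$ with $f^{-1}(\mathcal A)=\mathcal B$. *)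

theory Defs
  imports "HOL-Analysis.Analysis"
begin

section \<open>Polish spaces, analytic and coanalytic sets\<close>

definition polish_space_in :: "'a topology \<Rightarrow> bool" where
  "polish_space_in X \<longleftrightarrow> completely_metrizable_space X \<and> separable_space X"

definition borel_of :: "'a topology \<Rightarrow> 'a measure" where
  "borel_of X = sigma (topspace X) {U. openin X U}"

text \<open>
  A definition cannot quantify over types. Wherever a definition below quantifies over all Polish
  spaces or over all compact metrizable spaces, it quantifies over all such topologies (with
  arbitrary carrier, and unrelated to the Euclidean topology) on the type \<^typ>\<open>real\<close>.
  Spaces of either kind have at most continuum many points, so this covers all of them up to
  homeomorphism (\<open>polish_space_real_copy\<close>, \<open>compact_metrizable_real_copy\<close>). The lemmas
  \<open>analytic_inI\<close>, \<open>complete_coanalytic_inD\<close> and \<open>has_cpe_factorD\<close> recover the definitions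
  for spaces over an arbitrary type.
\<close>

definition analytic_in :: "'a topology \<Rightarrow> 'a set \<Rightarrow> bool" where
  "analytic_in X A \<longleftrightarrow> A \<subseteq> topspace X \<and>
     (\<exists>(Z :: real topology) B f. polish_space_in Z \<and> B \<in> sets (borel_of Z) \<and>
        continuous_map (subtopology Z B) X f \<and> f ` B = A)"

definition coanalytic_in :: "'a topology \<Rightarrow> 'a set \<Rightarrow> bool" where
  "coanalytic_in X A \<longleftrightarrow> A \<subseteq> topspace X \<and> analytic_in X (topspace X - A)"

definition complete_coanalytic_in :: "'a topology \<Rightarrow> 'a set \<Rightarrow> bool" where
  "complete_coanalytic_in X A \<longleftrightarrow> polish_space_in X \<and> coanalytic_in X A \<and>
     (\<forall>(Y :: real topology) B. polish_space_in Y \<and> coanalytic_in Y B \<longrightarrow>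
        (\<exists>f \<in> measurable (borel_of Y) (borel_of X). {y \<in> topspace Y. f y \<in> A} = B))"

section \<open>Topological dynamical systems and entropy\<close>

definition is_tds :: "'a topology \<Rightarrow> ('a \<Rightarrow> 'a) \<Rightarrow> bool" where
  "is_tds X T \<longleftrightarrow> compact_space X \<and> metrizable_space X \<and> continuous_map X X T"

definition is_factor ::
    "'a topology \<Rightarrow> ('a \<Rightarrow> 'a) \<Rightarrow> 'b topology \<Rightarrow> ('b \<Rightarrow> 'b) \<Rightarrow> bool" where
  "is_factor X T Y S \<longleftrightarrow> is_tds Y S \<and>
     (\<exists>\<phi>. continuous_map X Y \<phi> \<and> \<phi> ` topspace X = topspace Y \<and>
        (\<forall>x \<in> topspace X. \<phi> (T x) = S (\<phi> x)))"

definition open_cover :: "'a topology \<Rightarrow> 'a set set \<Rightarrow> bool" where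
  "open_cover X \<U> \<longleftrightarrow> (\<forall>U \<in> \<U>. openin X U) \<and> \<Union>\<U> = topspace X"

definition cover_number :: "'a topology \<Rightarrow> 'a set set \<Rightarrow> nat" where
  "cover_number X \<U> =
     (LEAST k. \<exists>\<V>. \<V> \<subseteq> \<U> \<and> finite \<V> \<and> card \<V> = k \<and> \<Union>\<V> = topspace X)"

text \<open>The common refinement of the preimages of \<open>\<U>\<close> under \<open>T ^^ i\<close> for \<open>i < n\<close>.\<close>

definition cover_iterate ::
    "'a topology \<Rightarrow> ('a \<Rightarrow> 'a) \<Rightarrow> 'a set set \<Rightarrow> nat \<Rightarrow> 'a set set" where
  "cover_iterate X T \<U> n =
     {{x \<in> topspace X. \<forall>i<n. (T ^^ i) x \<in> U i} | U. U \<in> {..<n} \<rightarrow> \<U>}"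

text \<open>
  Entropy in the sense of Adler, Konheim and McAndrew. The limit defining \<open>cover_entropy\<close> exists
  by subadditivity; \<^const>\<open>limsup\<close> is used because it is total.
\<close>

definition cover_entropy :: "'a topology \<Rightarrow> ('a \<Rightarrow> 'a) \<Rightarrow> 'a set set \<Rightarrow> ereal" where
  "cover_entropy X T \<U> =
     limsup (\<lambda>n. ereal (ln (real (cover_number X (cover_iterate X T \<U> n))) / real n))"

definition topological_entropy :: "'a topology \<Rightarrow> ('a \<Rightarrow> 'a) \<Rightarrow> ereal" where
  "topological_entropy X T = (SUP \<U> \<in> {\<U>. open_cover X \<U>}. cover_entropy X T \<U>)"

definition has_cpe :: "'a topology \<Rightarrow> ('a \<Rightarrow> 'a) \<Rightarrow> bool" where
  "has_cpe X T \<longleftrightarrow> is_tds X T \<and>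
     (\<forall>(Y :: real topology) S. is_factor X T Y S \<and> \<not> (\<exists>y. topspace Y = {y}) \<longrightarrow>
        topological_entropy Y S > 0)"

text \<open>
  The library's space of bounded continuous functions with the sup metric. Its points are
  extensional, so each continuous self-map of the compact space \<open>m\<close> is represented exactly once,
  and boundedness is automatic.
\<close>

definition TDS :: "'a metric \<Rightarrow> ('a \<Rightarrow> 'a) topology" where
  "TDS m = mtopology_of (cfunspace (mtopology_of m) m)"

definition CPE :: "'a metric \<Rightarrow> ('a \<Rightarrow> 'a) set" where
  "CPE m = {T \<in> topspace (TDS m). has_cpe (mtopology_of m) T}"

definition unit_cube :: "(real ^ 'n) metric" where
  "unit_cube = submetric euclidean_metric {x. \<forall>i. 0 \<le> x $ i \<and> x $ i \<le> 1}"

section \<open>Independence of the carrier type\<close>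

lemma homeomorphic_copy_of_inj:
  fixes X :: "'a topology" and g :: "'a \<Rightarrow> 'b"
  assumes "inj_on g (topspace X)"
  shows "\<exists>Y :: 'b topology. X homeomorphic_space Y"
proof -
  define k where "k = inv_into (topspace X) g"
  define Y where "Y = pullback_topology (g ` topspace X) k X"
  have kg: "k (g x) = x" if "x \<in> topspace X" for x
    using assms that by (simp add: k_def)
  have tY: "topspace Y = g ` topspace X"
    using kg by (auto simp: Y_def topspace_pullback_topology)
  have "continuous_map X Y g"
    unfolding continuous_map_def
  proof (intro conjI allI impI)
    show "g \<in> topspace X \<rightarrow> topspace Y" using tY by auto
    fix U assume "openin Y U"
    then obtain V where V: "openin X V" "U = k -` V \<inter> g ` topspace X"
      by (auto simp: Y_def openin_pullback_topology)
    have "g x \<in> U \<longleftrightarrow> x \<in> V" if "x \<in> topspace X" for x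
      using V(2) kg[OF that] that by simp
    then have "{x \<in> topspace X. g x \<in> U} = V"
      using openin_subset[OF V(1)] by blast
    with V show "openin X {x \<in> topspace X. g x \<in> U}" by simp
  qed
  moreover have "continuous_map Y X k"
    unfolding continuous_map_def
  proof (intro conjI allI impI)
    show "k \<in> topspace Y \<rightarrow> topspace X" using tY kg by auto
    fix U assume "openin X U"
    then show "openin Y {x \<in> topspace Y. k x \<in> U}"
      unfolding Y_def openin_pullback_topology using tY Y_def by blast
  qed
  ultimately have "homeomorphic_maps X Y g k"
    using kg tY by (auto simp: homeomorphic_maps_def)
  then show ?thesis by (auto simp: homeomorphic_space_def)
qed

lemma separable_metrizable_real_copy:
  fixes X :: "'a topology"
  assumes "metrizable_space X" "separable_space X"
  shows "\<exists>Y :: real topology. X homeomorphic_space Y"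
proof -
  obtain M d where Md: "Metric_space M d" "X = Metric_space.mtopology M d"
    using assms(1) by (auto simp: metrizable_space_def)
  interpret Metric_space M d by fact
  have tX: "topspace X = M" using Md by simp
  obtain C where C: "countable C" "C \<subseteq> M" "mtopology closure_of C = M"
    using assms(2) Md tX by (auto simp: separable_space_def)
  define c where "c = from_nat_into C"
  define e where "e x = (\<lambda>p::nat \<times> nat. d (c (fst p)) x < inverse (real (Suc (snd p))))" for x
  define s :: "'a \<Rightarrow> nat set" where "s x = to_nat ` {p. e x p}" for x
  have "inj_on s M"
  proof (rule inj_onI, rule ccontr)
    fix x y assume xy: "x \<in> M" "y \<in> M" "s x = s y" "x \<noteq> y"
    then have ee: "e x p = e y p" for p
      by (auto simp: s_def inj_image_eq_iff)
    have "d x y > 0" using xy by simp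
    then obtain n where n: "inverse (real (Suc n)) < d x y / 2"
      using reals_Archimedean[of "d x y / 2"] by auto
    have "x \<in> mtopology closure_of C" using xy C by simp
    moreover have "inverse (real (Suc n)) > 0" by simp
    ultimately obtain z where z: "z \<in> C" "z \<in> mball x (inverse (real (Suc n)))"
      unfolding metric_closure_of by blast
    have "C \<noteq> {}" using z by blast
    then obtain i where i: "z = c i"
      using from_nat_into_surj[OF C(1) z(1)] by (auto simp: c_def)
    have dzx: "d z x < inverse (real (Suc n))" using z by (simp add: commute)
    then have "e x (i, n)" by (simp add: e_def i)
    then have "e y (i, n)" using ee by simp
    then have "d z y < inverse (real (Suc n))" by (simp add: e_def i)
    moreover have "d x y \<le> d x z + d z y" using xy z C by (intro triangle) auto
    ultimately show False using dzx n commute[of x z] by linarith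
  qed
  moreover obtain b :: "nat set \<Rightarrow> real" where "inj b"
    using nat_sets_eqpoll_reals by (auto simp: eqpoll_def bij_betw_def)
  ultimately have "inj_on (b \<circ> s) (topspace X)"
    unfolding tX by (intro comp_inj_on) (auto intro: inj_on_subset)
  then show ?thesis by (rule homeomorphic_copy_of_inj)
qed

lemma polish_space_real_copy:
  fixes X :: "'a topology"
  assumes "polish_space_in X"
  shows "\<exists>Y :: real topology. polish_space_in Y \<and> X homeomorphic_space Y"
proof -
  have X: "completely_metrizable_space X" "separable_space X"
    using assms by (auto simp: polish_space_in_def)
  obtain Y :: "real topology" where Y: "X homeomorphic_space Y"
    using separable_metrizable_real_copy[OF completely_metrizable_imp_metrizable_space[OF X(1)] X(2)]
    by blast
  have "completely_metrizable_space Y"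
    using X(1) homeomorphic_completely_metrizable_space[OF Y] by blast
  moreover obtain f where f: "homeomorphic_map X Y f"
    using Y homeomorphic_space by blast
  have "separable_space Y"
    using separable_space_continuous_map_image[OF X(2) homeomorphic_imp_continuous_map[OF f]
        homeomorphic_imp_surjective_map[OF f]] .
  ultimately show ?thesis using Y unfolding polish_space_in_def by blast
qed

lemma compact_metrizable_imp_separable:
  assumes "compact_space X" "metrizable_space X"
  shows "separable_space X"
proof -
  obtain M d where Md: "Metric_space M d" "X = Metric_space.mtopology M d"
    using assms(2) by (auto simp: metrizable_space_def)
  interpret Metric_space M d by fact
  have "mtotally_bounded M"
    using assms(1) Md compact_space_eq_mcomplete_mtotally_bounded by blast
  then have "\<exists>K. finite K \<and> K \<subseteq> M \<and> M \<subseteq> (\<Union>x\<in>K. mball x (inverse (real (Suc n))))" for n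
    unfolding mtotally_bounded_def by simp
  then obtain K where K: "\<And>n. finite (K n)" "\<And>n. K n \<subseteq> M"
    "\<And>n. M \<subseteq> (\<Union>x\<in>K n. mball x (inverse (real (Suc n))))" by metis
  have "mtopology closure_of (\<Union>n. K n) = M"
  proof
    show "M \<subseteq> mtopology closure_of (\<Union>n. K n)"
    proof
      fix x assume x: "x \<in> M"
      have "\<exists>y\<in>\<Union>n. K n. y \<in> mball x r" if r: "r > 0" for r
      proof -
        obtain n where n: "inverse (real (Suc n)) < r" using reals_Archimedean[OF r] by auto
        obtain y where "y \<in> K n" "x \<in> mball y (inverse (real (Suc n)))" using K(3)[of n] x by blast
        then show ?thesis using n x by (force simp: commute)
      qed
      then show "x \<in> mtopology closure_of (\<Union>n. K n)" using x by (simp add: metric_closure_of)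
    qed
  qed (metis closure_of_subset_topspace topspace_mtopology)
  moreover have "countable (\<Union>n. K n)" using K(1) by (simp add: countable_finite)
  ultimately show ?thesis
    unfolding separable_space_def Md(2) using K(2) by (metis UN_least topspace_mtopology)
qed

lemma compact_metrizable_real_copy:
  fixes X :: "'a topology"
  assumes "compact_space X" "metrizable_space X"
  shows "\<exists>Y :: real topology. compact_space Y \<and> metrizable_space Y \<and> X homeomorphic_space Y"
  using separable_metrizable_real_copy[OF assms(2) compact_metrizable_imp_separable[OF assms]]
    homeomorphic_compact_space homeomorphic_metrizable_space assms by blast

lemma space_borel_of [simp]: "space (borel_of X) = topspace X"
  by (simp add: borel_of_def space_measure_of_conv)

lemma sets_borel_of: "sets (borel_of X) = sigma_sets (topspace X) {U. openin X U}"
  unfolding borel_of_def by (rule sets_measure_of) (auto dest: openin_subset)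

lemma continuous_map_imp_borel_measurable:
  assumes "continuous_map X Y f"
  shows "f \<in> measurable (borel_of X) (borel_of Y)"
proof (rule measurable_sigma_sets[OF sets_borel_of])
  show "{U. openin Y U} \<subseteq> Pow (topspace Y)" by (auto dest: openin_subset)
  show "f \<in> space (borel_of X) \<rightarrow> topspace Y"
    using assms by (simp add: continuous_map_def)
  fix U assume "U \<in> {U. openin Y U}"
  then have "openin X (f -` U \<inter> space (borel_of X))"
    using assms by (auto simp: continuous_map_alt)
  then show "f -` U \<inter> space (borel_of X) \<in> sets (borel_of X)"
    by (auto simp: sets_borel_of)
qed

lemma analytic_inI:
  fixes Z :: "'b topology"
  assumes "polish_space_in Z" "B \<in> sets (borel_of Z)" "continuous_map (subtopology Z B) X f"
  shows "analytic_in X (f ` B)"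
proof -
  obtain Z' :: "real topology" and h k where Z': "polish_space_in Z'" "homeomorphic_maps Z Z' h k"
    using polish_space_real_copy[OF assms(1)] by (auto simp: homeomorphic_space_def)
  have BZ: "B \<subseteq> topspace Z" using sets.sets_into_space[OF assms(2)] by simp
  define B' where "B' = k -` B \<inter> topspace Z'"
  have h: "continuous_map Z Z' h" and k: "continuous_map Z' Z k"
    and kh: "\<And>x. x \<in> topspace Z \<Longrightarrow> k (h x) = x"
    using Z'(2) by (auto simp: homeomorphic_maps_def)
  have "B' \<in> sets (borel_of Z')"
    using measurable_sets[OF continuous_map_imp_borel_measurable[OF k] assms(2)]
    by (simp add: B'_def)
  moreover have "continuous_map (subtopology Z' B') X (f \<circ> k)"
  proof (rule continuous_map_compose[OF _ assms(3)])
    show "continuous_map (subtopology Z' B') (subtopology Z B) k"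
      using continuous_map_from_subtopology[OF k]
      by (auto simp: continuous_map_in_subtopology B'_def)
  qed
  moreover have "k ` B' = B"
  proof (intro equalityI subsetI)
    fix x assume "x \<in> B"
    then have x: "x \<in> topspace Z" "k (h x) \<in> B" using BZ kh by auto
    have "h x \<in> topspace Z'" using continuous_map_funspace[OF h] x(1) by (rule funcset_mem)
    then have "h x \<in> B'" using x(2) by (simp add: B'_def)
    then show "x \<in> k ` B'" using kh[OF x(1)] by (metis image_eqI)
  qed (auto simp: B'_def)
  then have "(f \<circ> k) ` B' = f ` B" by (metis image_comp)
  moreover have "f ` B \<subseteq> topspace X"
    using continuous_map_image_subset_topspace[OF assms(3)] BZ by (simp add: Int_absorb1)
  ultimately show ?thesis using Z'(1) unfolding analytic_in_def by blast
qed

lemma analytic_in_continuous_image: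
  assumes "analytic_in X A" "continuous_map X Y h"
  shows "analytic_in Y (h ` A)"
proof -
  obtain Z :: "real topology" and B f where Z: "polish_space_in Z" "B \<in> sets (borel_of Z)"
    "continuous_map (subtopology Z B) X f" "f ` B = A"
    using assms(1) unfolding analytic_in_def by blast
  have "analytic_in Y ((h \<circ> f) ` B)"
    using Z(1,2) continuous_map_compose[OF Z(3) assms(2)] by (rule analytic_inI)
  then show ?thesis using Z(4) by (metis image_comp)
qed

lemma complete_coanalytic_inD:
  fixes Y :: "'b topology"
  assumes "complete_coanalytic_in X A" "polish_space_in Y" "coanalytic_in Y B"
  shows "\<exists>f \<in> measurable (borel_of Y) (borel_of X). {y \<in> topspace Y. f y \<in> A} = B"
proof -
  obtain Y' :: "real topology" and h k where Y': "polish_space_in Y'" "homeomorphic_maps Y Y' h k"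
    using polish_space_real_copy[OF assms(2)] by (auto simp: homeomorphic_space_def)
  have h: "continuous_map Y Y' h" and k: "continuous_map Y' Y k"
    and kh: "\<And>x. x \<in> topspace Y \<Longrightarrow> k (h x) = x" and hk: "\<And>y. y \<in> topspace Y' \<Longrightarrow> h (k y) = y"
    using Y'(2) by (auto simp: homeomorphic_maps_def)
  have hY: "\<And>x. x \<in> topspace Y \<Longrightarrow> h x \<in> topspace Y'" and kY: "\<And>y. y \<in> topspace Y' \<Longrightarrow> k y \<in> topspace Y"
    using h k by (auto simp: continuous_map_def)
  have BY: "B \<subseteq> topspace Y" using assms(3) by (simp add: coanalytic_in_def)
  have "h ` (topspace Y - B) = topspace Y' - h ` B"
  proof (intro equalityI subsetI)
    fix y assume y: "y \<in> topspace Y' - h ` B"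
    then have "k y \<in> topspace Y - B" using hk kY by (metis Diff_iff image_eqI)
    then show "y \<in> h ` (topspace Y - B)" using y hk by (metis DiffD1 image_eqI)
  next
    fix y assume "y \<in> h ` (topspace Y - B)"
    then obtain x where x: "x \<in> topspace Y" "x \<notin> B" "y = h x" by auto
    have "y \<notin> h ` B"
    proof
      assume "y \<in> h ` B"
      then obtain x' where "x' \<in> B" "y = h x'" by auto
      then have "x = x'" using x kh[of x] kh[of x'] BY by auto
      then show False using x \<open>x' \<in> B\<close> by simp
    qed
    then show "y \<in> topspace Y' - h ` B" using x hY by auto
  qed
  then have "coanalytic_in Y' (h ` B)"
    using analytic_in_continuous_image[OF _ h] assms(3) BY hY
    unfolding coanalytic_in_def by (metis image_subsetI subsetD)
  then obtain f where f: "f \<in> measurable (borel_of Y') (borel_of X)"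
    "{y \<in> topspace Y'. f y \<in> A} = h ` B"
    using assms(1) Y'(1) unfolding complete_coanalytic_in_def by blast
  have "{y \<in> topspace Y. (f \<circ> h) y \<in> A} = B"
  proof -
    have "(f \<circ> h) y \<in> A \<longleftrightarrow> h y \<in> h ` B" if "y \<in> topspace Y" for y
      using f(2) hY[OF that] by auto
    moreover have "h y \<in> h ` B \<longleftrightarrow> y \<in> B" if "y \<in> topspace Y" for y
      using that kh BY by (metis image_iff subsetD)
    ultimately show ?thesis using BY by auto
  qed
  moreover have "f \<circ> h \<in> measurable (borel_of Y) (borel_of X)"
    using continuous_map_imp_borel_measurable[OF h] f(1) by (rule measurable_comp)
  ultimately show ?thesis by blast
qed

lemma funpow_mem:
  assumes "continuous_map X X T" "x \<in> topspace X"
  shows "(T ^^ i) x \<in> topspace X"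
proof (induction i)
  case (Suc i)
  then have "T ((T ^^ i) x) \<in> topspace X"
    by (rule funcset_mem[OF continuous_map_funspace[OF assms(1)]])
  then show ?case by simp
qed (simp add: assms)

lemma continuous_map_funpow:
  assumes "continuous_map X X T"
  shows "continuous_map X X (T ^^ i)"
proof (induction i)
  case (Suc i)
  then show ?case using continuous_map_compose[OF Suc assms] by (simp only: funpow.simps)
qed simp

lemma open_cover_iterate:
  assumes T: "continuous_map X X T" and \<U>: "open_cover X \<U>"
  shows "open_cover X (cover_iterate X T \<U> n)"
  unfolding open_cover_def
proof (intro conjI ballI equalityI subsetI)
  fix W assume "W \<in> cover_iterate X T \<U> n"
  then obtain U where U: "U \<in> {..<n} \<rightarrow> \<U>" "W = {x \<in> topspace X. \<forall>i<n. (T ^^ i) x \<in> U i}"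
    by (auto simp: cover_iterate_def)
  have op: "openin X {x \<in> topspace X. (T ^^ i) x \<in> U i}" if "i < n" for i
  proof -
    have "openin X (U i)" using U(1) \<U> that by (auto simp: open_cover_def Pi_iff)
    then show ?thesis
      by (rule openin_continuous_map_preimage[OF continuous_map_funpow[OF T]])
  qed
  have "openin X {x \<in> topspace X. \<forall>i\<in>{..<m}. (T ^^ i) x \<in> U i}" if "m \<le> n" for m
    using that
  proof (induction m)
    case (Suc m)
    have "{x \<in> topspace X. \<forall>i\<in>{..<Suc m}. (T ^^ i) x \<in> U i} =
      {x \<in> topspace X. \<forall>i\<in>{..<m}. (T ^^ i) x \<in> U i} \<inter> {x \<in> topspace X. (T ^^ m) x \<in> U m}"
      by (auto simp: less_Suc_eq)
    moreover have "openin X {x \<in> topspace X. (T ^^ m) x \<in> U m}" using op Suc.prems by simp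
    ultimately show ?case using Suc by (simp only: openin_Int Suc_leD)
  qed simp
  from this[OF order_refl] show "openin X W" unfolding U(2) by (simp only: Ball_def lessThan_iff)
next
  fix x assume "x \<in> topspace X"
  then have "\<forall>i. \<exists>U\<in>\<U>. (T ^^ i) x \<in> U"
    using funpow_mem[OF T, of x] \<U> unfolding open_cover_def by (metis UnionE)
  then obtain U where "\<forall>i. U i \<in> \<U> \<and> (T ^^ i) x \<in> U i" by metis
  then show "x \<in> \<Union>(cover_iterate X T \<U> n)"
  proof (intro UnionI)
    show "{x \<in> topspace X. \<forall>i<n. (T ^^ i) x \<in> U i} \<in> cover_iterate X T \<U> n"
      using \<open>\<forall>i. U i \<in> \<U> \<and> (T ^^ i) x \<in> U i\<close>
      unfolding cover_iterate_def by (intro CollectI exI[of _ U]) simp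
  qed (use \<open>x \<in> topspace X\<close> \<open>\<forall>i. U i \<in> \<U> \<and> (T ^^ i) x \<in> U i\<close> in simp)
qed (auto simp: cover_iterate_def)

lemma cover_number_attained:
  assumes "compact_space X" "open_cover X \<U>"
  shows "\<exists>\<V>. \<V> \<subseteq> \<U> \<and> finite \<V> \<and> card \<V> = cover_number X \<U> \<and> \<Union>\<V> = topspace X"
proof -
  have "\<exists>k \<V>. \<V> \<subseteq> \<U> \<and> finite \<V> \<and> card \<V> = k \<and> \<Union>\<V> = topspace X"
    using assms(1)[unfolded compact_space, rule_format, of \<U>] assms(2)
    by (auto simp: open_cover_def)
  then show ?thesis unfolding cover_number_def by (rule LeastI_ex)
qed

lemma topological_entropy_factor_le:
  assumes X: "is_tds X T" and fac: "is_factor X T Y S"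
  shows "topological_entropy Y S \<le> topological_entropy X T"
  unfolding topological_entropy_def
proof (rule SUP_mono)
  fix \<V> assume "\<V> \<in> {\<V>. open_cover Y \<V>}"
  then have \<V>: "open_cover Y \<V>" by simp
  obtain \<phi> where \<phi>: "continuous_map X Y \<phi>" "\<phi> ` topspace X = topspace Y"
    "\<And>x. x \<in> topspace X \<Longrightarrow> \<phi> (T x) = S (\<phi> x)"
    using fac by (auto simp: is_factor_def)
  have T: "continuous_map X X T" and cX: "compact_space X" using X by (auto simp: is_tds_def)
  have \<phi>n: "\<phi> ((T ^^ i) x) = (S ^^ i) (\<phi> x)" if "x \<in> topspace X" for x i
  proof (induction i)
    case (Suc i)
    then show ?case using \<phi>(3)[OF funpow_mem[OF T that, of i]] by simp
  qed simp
  define \<psi> where "\<psi> V = {x \<in> topspace X. \<phi> x \<in> V}" for V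
  define \<U> where "\<U> = \<psi> ` \<V>"
  have \<U>: "open_cover X \<U>"
    using \<V> \<phi>(1,2) by (auto simp: open_cover_def \<U>_def \<psi>_def continuous_map_def)
  have le: "cover_number Y (cover_iterate Y S \<V> n) \<le> cover_number X (cover_iterate X T \<U> n)" for n
  proof -
    obtain \<W> where \<W>: "\<W> \<subseteq> cover_iterate X T \<U> n" "finite \<W>"
      "card \<W> = cover_number X (cover_iterate X T \<U> n)" "\<Union>\<W> = topspace X"
      using cover_number_attained[OF cX open_cover_iterate[OF T \<U>]] by metis
    have "\<phi> ` W \<in> cover_iterate Y S \<V> n" if W: "W \<in> \<W>" for W
    proof -
      obtain U where U: "U \<in> {..<n} \<rightarrow> \<U>" "W = {x \<in> topspace X. \<forall>i<n. (T ^^ i) x \<in> U i}"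
        using subsetD[OF \<W>(1) W] by (auto simp: cover_iterate_def)
      then have "\<forall>i. \<exists>V. i < n \<longrightarrow> V \<in> \<V> \<and> U i = \<psi> V" by (auto simp: \<U>_def Pi_iff image_iff)
      then obtain V where V: "\<And>i. i < n \<Longrightarrow> V i \<in> \<V> \<and> U i = \<psi> (V i)" by metis
      have "W = {x \<in> topspace X. \<forall>i<n. (S ^^ i) (\<phi> x) \<in> V i}"
        using U(2) V \<phi>n funpow_mem[OF T] by (auto simp: \<psi>_def)
      then have "\<phi> ` W = {y \<in> topspace Y. \<forall>i<n. (S ^^ i) y \<in> V i}"
        using \<phi>(2) by auto
      moreover have "V \<in> {..<n} \<rightarrow> \<V>" using V by simp
      ultimately show ?thesis unfolding cover_iterate_def by (intro CollectI exI[of _ V] conjI)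
    qed
    moreover have "\<Union>((`) \<phi> ` \<W>) = topspace Y" using image_Union[of \<phi> \<W>] \<W>(4) \<phi>(2) by simp
    ultimately have "cover_number Y (cover_iterate Y S \<V> n) \<le> card ((`) \<phi> ` \<W>)"
      unfolding cover_number_def using \<W>(2)
      by (intro Least_le exI[of _ "(`) \<phi> ` \<W>"]) (simp add: image_subset_iff)
    also have "\<dots> \<le> card \<W>" using \<W>(2) by (rule card_image_le)
    finally show ?thesis using \<W>(3) by simp
  qed
  have ln_le: "ln (real a) \<le> ln (real b)" if "a \<le> b" for a b :: nat
    using that by (cases "a = 0"; cases "b = 0") auto
  have "cover_entropy Y S \<V> \<le> cover_entropy X T \<U>"
    unfolding cover_entropy_def
    by (intro Limsup_mono always_eventually allI)
      (simp only: ereal_less_eq, intro divide_right_mono ln_le le, simp)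
  then show "\<exists>\<U>\<in>{\<U>. open_cover X \<U>}. cover_entropy Y S \<V> \<le> cover_entropy X T \<U>"
    using \<U> by blast
qed

lemma has_cpe_factorD:
  fixes Y :: "'b topology"
  assumes "has_cpe X T" "is_factor X T Y S" "\<not> (\<exists>y. topspace Y = {y})"
  shows "topological_entropy Y S > 0"
proof -
  have Y: "is_tds Y S" using assms(2) by (simp add: is_factor_def)
  then obtain Y' :: "real topology" and h k where
    Y': "compact_space Y'" "metrizable_space Y'" "homeomorphic_maps Y Y' h k"
    using compact_metrizable_real_copy[of Y] by (auto simp: homeomorphic_space_def is_tds_def)
  have h: "continuous_map Y Y' h" and k: "continuous_map Y' Y k"
    and kh: "\<And>x. x \<in> topspace Y \<Longrightarrow> k (h x) = x" and hk: "\<And>y. y \<in> topspace Y' \<Longrightarrow> h (k y) = y"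
    using Y'(3) by (auto simp: homeomorphic_maps_def)
  have hY: "\<And>x. x \<in> topspace Y \<Longrightarrow> h x \<in> topspace Y'" and kY: "\<And>y. y \<in> topspace Y' \<Longrightarrow> k y \<in> topspace Y"
    using h k by (auto simp: continuous_map_def)
  define S' where "S' = h \<circ> S \<circ> k"
  have S: "continuous_map Y Y S" using Y by (simp add: is_tds_def)
  have tds': "is_tds Y' S'"
    using Y' continuous_map_compose[OF k continuous_map_compose[OF S h]]
    by (simp add: is_tds_def S'_def comp_assoc)
  have surj: "h ` topspace Y = topspace Y'" using hY kY hk by (force simp: image_iff)
  obtain \<phi> where \<phi>: "continuous_map X Y \<phi>" "\<phi> ` topspace X = topspace Y"
    "\<And>x. x \<in> topspace X \<Longrightarrow> \<phi> (T x) = S (\<phi> x)"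
    using assms(2) by (auto simp: is_factor_def)
  have hS: "h (S x) = S' (h x)" if "x \<in> topspace Y" for x
    using that kh by (simp add: S'_def)
  have "is_factor X T Y' S'"
    unfolding is_factor_def
  proof (intro conjI exI[of _ "h \<circ> \<phi>"] ballI)
    show "continuous_map X Y' (h \<circ> \<phi>)" using \<phi>(1) h by (rule continuous_map_compose)
    show "(h \<circ> \<phi>) ` topspace X = topspace Y'" using \<phi>(2) surj by (metis image_comp)
    show "(h \<circ> \<phi>) (T x) = S' ((h \<circ> \<phi>) x)" if "x \<in> topspace X" for x
      using \<phi>(2,3) hS that by auto
  qed (rule tds')
  moreover have "\<not> (\<exists>y. topspace Y' = {y})"
  proof
    assume "\<exists>y. topspace Y' = {y}"
    then obtain y where y: "topspace Y' = {y}" by blast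
    then have "k ` topspace Y' = {k y}" by simp
    moreover have "k ` topspace Y' = topspace Y" using hY kY kh by (force simp: image_iff)
    ultimately show False using assms(3) by simp
  qed
  ultimately have "topological_entropy Y' S' > 0" using assms(1) by (simp add: has_cpe_def)
  also have "topological_entropy Y' S' \<le> topological_entropy Y S"
    using h surj hS tds' by (intro topological_entropy_factor_le[OF Y]) (auto simp: is_factor_def)
  finally show ?thesis .
qed

end

theory Submission
  imports Defs
begin

text \<open>
  \<^bold>\<open>Coanalyticity.\<close> A map \<open>T\<close> fails to have completely positive entropy when some non-trivial factor
  has entropy zero. Pulling back a metric of the factor gives a continuous pseudometric \<open>\<rho>\<close> on the
  space, and the factor can be recovered from \<open>\<rho>\<close> as a quotient. So the complement of the set of CPE
  maps is the projection of the set of pairs \<open>(T, \<rho>)\<close> in which \<open>\<rho>\<close> is a non-zero pseudometric whose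
  quotient carries a map induced by \<open>T\<close> of entropy zero (\<open>null_pseudometric\<close>). Compactness makes every
  clause of this condition Borel: a property that has to hold at all points of a compact space is an
  open condition on \<open>(T, \<rho>)\<close> as soon as it is an open condition at each point.

  \<^bold>\<open>Hardness.\<close> A coanalytic set is reduced to the countability of a closed subset of \<open>[0,1]\<close>. The
  starting point is that a point \<open>y\<close> belongs to a given analytic set exactly when a graph on the
  natural numbers, which depends on \<open>y\<close> in a Borel way, has an infinite clique (\<open>analytic_clique\<close>). Reading
  a set of natural numbers as a binary expansion turns the cliques of the graph into a set \<open>K\<close> of
  reals. Subsets of cliques are cliques, so one infinite clique yields uncountably many; if all cliques
  are finite there are only countably many. Hence \<open>K\<close> is countable exactly when \<open>y\<close> lies in the coanalytic
  set (\<open>countable_surviving_iff\<close>).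

  The interval map attached to \<open>y\<close> fixes \<open>K\<close> pointwise and acts on each of the dyadic intervals that
  fill the complement of \<open>K\<close> as a rescaled zigzag with three full branches. On the cube this map acts on one
  coordinate and the zigzag acts on all the others. The zigzag is topologically exact, and a factor
  that separates two points of an exact piece contains a horseshoe, so it has positive entropy
  (\<open>horseshoe_positive_entropy\<close>). A factor of entropy zero therefore collapses every exact piece and has
  at most countably many points besides images of points of \<open>K\<close>. If \<open>K\<close> is countable, such a
  factor is countable and connected, that is, a point. If \<open>K\<close> is uncountable, there is a Cantor function,
  continuous and onto \<open>[0,1]\<close>, that is constant on the complementary intervals (\<open>cantor_function\<close>); it is
  a factor map onto the identity of \<open>[0,1]\<close>, which is non-trivial and has entropy zero.
\<close>

section \<open>Covers, names and entropy\<close>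

text \<open>
  The covering number of the refined cover is at most \<open>k\<close> (\<open>cover_number_le_iff\<close>), stated through names: each
  \<open>W \<in> F\<close> prescribes a member of the cover for every time below \<open>n\<close>. Names can be moved along factor
  maps in both directions, because they do not mention the sets that they cut out.
\<close>

definition itinerary_cover ::
    "'a topology \<Rightarrow> ('a \<Rightarrow> 'a) \<Rightarrow> 'a set set \<Rightarrow> nat \<Rightarrow> nat \<Rightarrow> bool" where
  "itinerary_cover X T \<U> n k \<longleftrightarrow>
     (\<exists>F. finite F \<and> card F \<le> k \<and> F \<subseteq> {..<n} \<rightarrow> \<U> \<and>
        (\<forall>x \<in> topspace X. \<exists>W \<in> F. \<forall>i<n. (T ^^ i) x \<in> W i))"

lemma cover_number_le_iff:
  assumes X: "compact_space X" and T: "continuous_map X X T" and \<U>: "open_cover X \<U>"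
  shows "cover_number X (cover_iterate X T \<U> n) \<le> k \<longleftrightarrow> itinerary_cover X T \<U> n k"
proof
  assume le: "cover_number X (cover_iterate X T \<U> n) \<le> k"
  obtain \<W> where \<W>: "\<W> \<subseteq> cover_iterate X T \<U> n" "finite \<W>"
    "card \<W> = cover_number X (cover_iterate X T \<U> n)" "\<Union>\<W> = topspace X"
    using cover_number_attained[OF X open_cover_iterate[OF T \<U>]] by metis
  have "\<forall>W\<in>\<W>. \<exists>U. U \<in> {..<n} \<rightarrow> \<U> \<and> W = {x \<in> topspace X. \<forall>i<n. (T ^^ i) x \<in> U i}"
    using \<W>(1) unfolding cover_iterate_def by blast
  from bchoice[OF this] obtain u where "\<forall>W\<in>\<W>. u W \<in> {..<n} \<rightarrow> \<U> \<and>
    W = {x \<in> topspace X. \<forall>i<n. (T ^^ i) x \<in> u W i}" by (rule exE)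
  note u = this[THEN bspec, THEN conjunct1] this[THEN bspec, THEN conjunct2]
  have "\<exists>V\<in>u ` \<W>. \<forall>i<n. (T ^^ i) x \<in> V i" if x: "x \<in> topspace X" for x
  proof -
    obtain W where W: "W \<in> \<W>" "x \<in> W" using x \<W>(4) by blast
    then show ?thesis using subsetD[OF equalityD1[OF u(2)[OF W(1)]] W(2)] W(1) by auto
  qed
  moreover have "card (u ` \<W>) \<le> k" using card_image_le[OF \<W>(2), of u] \<W>(3) le by simp
  ultimately show "itinerary_cover X T \<U> n k"
    unfolding itinerary_cover_def using \<W>(2) u(1) by (intro exI[of _ "u ` \<W>"] conjI image_subsetI) simp_all
next
  assume "itinerary_cover X T \<U> n k"
  then obtain F where F: "finite F" "card F \<le> k" "F \<subseteq> {..<n} \<rightarrow> \<U>"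
    "\<And>x. x \<in> topspace X \<Longrightarrow> \<exists>W \<in> F. \<forall>i<n. (T ^^ i) x \<in> W i"
    unfolding itinerary_cover_def by blast
  define v where "v W = {x \<in> topspace X. \<forall>i<n. (T ^^ i) x \<in> W i}" for W
  have "v ` F \<subseteq> cover_iterate X T \<U> n"
    using F(3) unfolding cover_iterate_def v_def by blast
  moreover have "\<Union>(v ` F) = topspace X" using F(4) unfolding v_def by blast
  ultimately have "cover_number X (cover_iterate X T \<U> n) \<le> card (v ` F)"
    unfolding cover_number_def using F(1) by (intro Least_le exI[of _ "v ` F"]) simp
  also have "\<dots> \<le> k" using card_image_le[OF F(1), of v] F(2) by simp
  finally show "cover_number X (cover_iterate X T \<U> n) \<le> k" .
qed

text \<open>
  The point of this form is that its quantifiers range over natural numbers only and its matrix is the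
  existence of a finite cover, so it can be read off as a Borel condition.
\<close>

lemma cover_entropy_le_0_iff:
  assumes "compact_space X" "continuous_map X X T" "open_cover X \<U>"
  shows "cover_entropy X T \<U> \<le> 0 \<longleftrightarrow>
    (\<forall>m. \<exists>n0. \<forall>n\<ge>n0. itinerary_cover X T \<U> n (nat \<lfloor>exp (real n / real (Suc m))\<rfloor>))"
proof -
  define N where "N n = cover_number X (cover_iterate X T \<U> n)" for n
  have iff: "itinerary_cover X T \<U> n (nat \<lfloor>exp (real n / real (Suc m))\<rfloor>)
      \<longleftrightarrow> ln (real (N n)) / real n \<le> 1 / real (Suc m)" if n: "n > 0" for n m
  proof -
    have "itinerary_cover X T \<U> n (nat \<lfloor>exp (real n / real (Suc m))\<rfloor>)
        \<longleftrightarrow> real (N n) \<le> exp (real n / real (Suc m))"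
      by (simp add: cover_number_le_iff[OF assms, symmetric] N_def le_nat_floor le_nat_iff le_floor_iff)
    also have "\<dots> \<longleftrightarrow> ln (real (N n)) \<le> real n / real (Suc m)"
    proof (cases "N n = 0")
      case False
      then have "ln (real (N n)) \<le> ln (exp (real n / real (Suc m))) \<longleftrightarrow> real (N n) \<le> exp (real n / real (Suc m))"
        by (intro ln_le_cancel_iff) auto
      then show ?thesis by simp
    qed simp
    also have "\<dots> \<longleftrightarrow> ln (real (N n)) / real n \<le> 1 / real (Suc m)"
      using n by (simp add: field_simps)
    finally show ?thesis .
  qed
  have "cover_entropy X T \<U> \<le> 0 \<longleftrightarrow>
      (\<forall>m. eventually (\<lambda>n. ln (real (N n)) / real n \<le> 1 / real (Suc m)) sequentially)"
    unfolding cover_entropy_def Limsup_le_iff N_def[symmetric]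
  proof (intro iffI allI impI)
    fix m assume "\<forall>y>0. \<forall>\<^sub>F n in sequentially. ereal (ln (real (N n)) / real n) < y"
    from this[rule_format, of "ereal (1 / real (Suc m))"]
    have "\<forall>\<^sub>F n in sequentially. ereal (ln (real (N n)) / real n) < ereal (1 / real (Suc m))"
      by simp
    then show "\<forall>\<^sub>F n in sequentially. ln (real (N n)) / real n \<le> 1 / real (Suc m)"
      by (rule eventually_mono) simp
  next
    fix y :: ereal
    assume H: "\<forall>m. \<forall>\<^sub>F n in sequentially. ln (real (N n)) / real n \<le> 1 / real (Suc m)" and "0 < y"
    then obtain r where r: "0 < r" "ereal r < y" using ereal_dense2[of 0 y] by auto
    obtain m where m: "1 / real (Suc m) < r" using nat_approx_posE[OF r(1)] by auto
    show "\<forall>\<^sub>F n in sequentially. ereal (ln (real (N n)) / real n) < y"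
      using H[rule_format, of m]
    proof (rule eventually_mono)
      fix n assume "ln (real (N n)) / real n \<le> 1 / real (Suc m)"
      then have "ln (real (N n)) / real n < r" using m by simp
      then show "ereal (ln (real (N n)) / real n) < y" using r(2) by (meson ereal_less_eq(3) less_imp_le order_le_less_trans)
    qed
  qed
  also have "\<dots> \<longleftrightarrow> (\<forall>m. eventually (\<lambda>n. itinerary_cover X T \<U> n (nat \<lfloor>exp (real n / real (Suc m))\<rfloor>)) sequentially)"
  proof (rule all_cong1)
    fix m
    have "\<forall>\<^sub>F n in sequentially. (ln (real (N n)) / real n \<le> 1 / real (Suc m)) =
        itinerary_cover X T \<U> n (nat \<lfloor>exp (real n / real (Suc m))\<rfloor>)"
      by (rule eventually_mono[OF eventually_gt_at_top[of 0]]) (rule iff[symmetric])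
    then show "(\<forall>\<^sub>F n in sequentially. ln (real (N n)) / real n \<le> 1 / real (Suc m)) =
        (\<forall>\<^sub>F n in sequentially. itinerary_cover X T \<U> n (nat \<lfloor>exp (real n / real (Suc m))\<rfloor>))"
      by (rule eventually_subst)
  qed
  finally show ?thesis unfolding eventually_sequentially .
qed

lemma topological_entropy_le_0_iff:
  "topological_entropy X T \<le> 0 \<longleftrightarrow> (\<forall>\<U>. open_cover X \<U> \<longrightarrow> cover_entropy X T \<U> \<le> 0)"
  unfolding topological_entropy_def by (auto simp: SUP_le_iff)

lemma itinerary_cover_mono: "itinerary_cover X T \<U> n k \<Longrightarrow> k \<le> l \<Longrightarrow> itinerary_cover X T \<U> n l"
  unfolding itinerary_cover_def by (meson order_trans)

text \<open>
  Under the identity a constant name serves for all times, so the covering numbers stay bounded.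
\<close>

lemma topological_entropy_identity:
  assumes X: "compact_space X" and S: "\<And>x. x \<in> topspace X \<Longrightarrow> S x = x"
  shows "topological_entropy X S \<le> 0"
  unfolding topological_entropy_le_0_iff
proof (intro allI impI)
  have cS: "continuous_map X X S" by (rule continuous_map_eq[OF continuous_map_id]) (simp add: S)
  have Sn: "(S ^^ i) x = x" if "x \<in> topspace X" for x i by (induction i) (use S that in auto)
  fix \<U> assume \<U>: "open_cover X \<U>"
  obtain \<V> where \<V>: "\<V> \<subseteq> \<U>" "finite \<V>" "\<Union>\<V> = topspace X"
    using cover_number_attained[OF X \<U>] by metis
  have k: "itinerary_cover X S \<U> n (card \<V>)" for n
    unfolding itinerary_cover_def
  proof (intro exI[of _ "(\<lambda>V i. V) ` \<V>"] conjI ballI)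
    show "card ((\<lambda>V i. V) ` \<V>) \<le> card \<V>" using \<V>(2) by (rule card_image_le)
    fix x assume x: "x \<in> topspace X"
    then obtain V where V: "V \<in> \<V>" "x \<in> V" using \<V>(3) by blast
    then show "\<exists>W\<in>(\<lambda>V i. V) ` \<V>. \<forall>i<n. (S ^^ i) x \<in> W i"
      by (intro bexI[of _ "\<lambda>i. V"] imageI) (simp_all add: Sn[OF x])
  qed (use \<V>(1,2) in auto)
  show "cover_entropy X S \<U> \<le> 0"
    unfolding cover_entropy_le_0_iff[OF X cS \<U>]
  proof (intro allI)
    fix m
    have n0: "real (card \<V>) \<le> exp (real n / real (Suc m))" if "n \<ge> Suc m * card \<V>" for n
    proof -
      have "real (Suc m * card \<V>) \<le> real n" using that by (rule of_nat_mono)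
      then have "real (card \<V>) \<le> real n / real (Suc m)" by (simp add: field_simps)
      also have "\<dots> \<le> exp (real n / real (Suc m))" using exp_ge_add_one_self[of "real n / real (Suc m)"] by linarith
      finally show ?thesis .
    qed
    show "\<exists>n0. \<forall>n\<ge>n0. itinerary_cover X S \<U> n (nat \<lfloor>exp (real n / real (Suc m))\<rfloor>)"
      using itinerary_cover_mono[OF k] n0 by (intro exI[of _ "Suc m * card \<V>"] allI impI) (meson le_nat_floor)
  qed
qed

text \<open>
  The orbit is built backwards: the point realising the shifted word has a preimage in the first
  prescribed set, because that set is mapped over all of \<open>C\<close>.
\<close>

lemma horseshoe_itinerary:
  fixes A :: "bool \<Rightarrow> 'a set"
  assumes sub: "\<And>c. A c \<subseteq> C" and onto: "\<And>c. C \<subseteq> (T ^^ N) ` A c" and "C \<noteq> {}"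
  shows "\<exists>x\<in>C. \<forall>i<n. (T ^^ (N * i)) x \<in> A (w i)"
proof (induction n arbitrary: w)
  case 0
  then show ?case using \<open>C \<noteq> {}\<close> by auto
next
  case (Suc n)
  obtain y where y: "y \<in> C" "\<And>i. i < n \<Longrightarrow> (T ^^ (N * i)) y \<in> A (w (Suc i))"
    using Suc.IH[of "w \<circ> Suc"] by auto
  obtain x where x: "x \<in> A (w 0)" "y = (T ^^ N) x" using onto y(1) by blast
  have "(T ^^ (N * i)) x \<in> A (w i)" if "i < Suc n" for i
  proof (cases i)
    case (Suc k)
    then have "(T ^^ (N * i)) x = (T ^^ (N * k)) y"
      using x(2) by (simp add: funpow_add add.commute[of N])
    then show ?thesis using y(2)[of k] Suc that by simp
  qed (use x in simp)
  then show ?case using x sub by blast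
qed

lemma limsup_ge_of_multiples:
  fixes u :: "nat \<Rightarrow> ereal"
  assumes "N > 0" "\<And>n. n > 0 \<Longrightarrow> c \<le> u (N * n)"
  shows "c \<le> limsup u"
proof -
  have "c \<le> limsup (u \<circ> (\<lambda>n. N * Suc n))"
    using assms(2) by (intro le_Limsup always_eventually) (auto simp del: mult_Suc_right)
  also have "\<dots> \<le> limsup u"
    by (rule limsup_subseq_mono) (use assms(1) in \<open>simp add: strict_mono_def\<close>)
  finally show ?thesis .
qed

text \<open>
  Two points of \<open>C\<close> with different images have neighbourhoods whose images lie in disjoint closed sets
  \<open>P True\<close> and \<open>P False\<close>. Some iterate maps the traces of both neighbourhoods over \<open>C\<close>, so every binary word is an
  itinerary at multiples of \<open>N\<close>. A member of the cover by the two complements of these sets excludes one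
  of the two letters, hence a name determines the word and \<open>2 ^ n\<close> names are needed at time \<open>N * n\<close>.
\<close>

lemma horseshoe_positive_entropy:
  fixes X :: "'a topology" and Y :: "'b topology"
  assumes X: "is_tds X T" and fac: "is_factor X T Y S"
    and \<phi>: "continuous_map X Y \<phi>" "\<And>x. x \<in> topspace X \<Longrightarrow> \<phi> (T x) = S (\<phi> x)"
    and C: "C \<subseteq> topspace X"
    and exact: "\<And>U. openin X U \<Longrightarrow> U \<inter> C \<noteq> {} \<Longrightarrow> \<exists>N. \<forall>n\<ge>N. C \<subseteq> (T ^^ n) ` (U \<inter> C)"
    and ab: "a \<in> C" "b \<in> C" "\<phi> a \<noteq> \<phi> b"
  shows "topological_entropy Y S > 0"
proof -
  have Y: "compact_space Y" "metrizable_space Y" and S: "continuous_map Y Y S"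
    using fac by (auto simp: is_factor_def is_tds_def)
  have T: "continuous_map X X T" using X by (auto simp: is_tds_def)
  have \<phi>Y: "\<phi> x \<in> topspace Y" if "x \<in> topspace X" for x
    using \<phi>(1) that by (auto simp: continuous_map_def)
  have Haus: "Hausdorff_space Y" using Y(2) by (rule metrizable_imp_Hausdorff_space)
  have reg: "regular_space Y" using Y(2) by (rule metrizable_imp_regular_space)
  have abY: "\<phi> a \<in> topspace Y" "\<phi> b \<in> topspace Y" using ab C \<phi>Y by blast+
  obtain V V2 where V: "openin Y V" "\<phi> a \<in> V" "openin Y V2" "\<phi> b \<in> V2" "disjnt V V2"
    using Haus[unfolded Hausdorff_space_def, rule_format, of "\<phi> a" "\<phi> b"] abY ab(3) by blast
  have bV: "\<phi> b \<notin> Y closure_of V"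
    using V(3-5) unfolding in_closure_of disjnt_def by blast
  define W where "W = topspace Y - Y closure_of V"
  have W: "openin Y W" "\<phi> b \<in> W" using bV abY by (auto simp: W_def)
  obtain W1 V' where W1: "openin Y W1" "\<phi> b \<in> W1" "closedin Y V'" "W1 \<subseteq> V'" "V' \<subseteq> W"
    using iffD2[OF neighbourhood_base_of_closedin reg, unfolded neighbourhood_base_of,
        rule_format, OF conjI[OF W]] by blast
  then have W1c: "Y closure_of W1 \<subseteq> W" by (meson closure_of_minimal order_trans)
  define P where "P c = (if c then Y closure_of V else Y closure_of W1)" for c
  have Pc: "closedin Y (P c)" for c by (simp add: P_def)
  have Pdis: "P True \<inter> P False = {}" using W1c by (auto simp: P_def W_def)
  define O' where "O' c = {x \<in> topspace X. \<phi> x \<in> (if c then V else W1)}" for c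
  have Oo: "openin X (O' c)" for c
    using openin_continuous_map_preimage[OF \<phi>(1)] V(1) W1(1) by (simp add: O'_def)
  have Oc: "O' c \<inter> C \<noteq> {}" for c
    using ab C V(2) W1(2) by (cases c) (auto simp: O'_def)
  have OP: "\<phi> x \<in> P c" if "x \<in> O' c" for x c
    using that closure_of_subset[OF openin_subset[OF V(1)]] closure_of_subset[OF openin_subset[OF W1(1)]]
    by (cases c) (auto simp: O'_def P_def)
  obtain N1 N2 where N12: "\<And>n. n \<ge> N1 \<Longrightarrow> C \<subseteq> (T ^^ n) ` (O' True \<inter> C)"
    "\<And>n. n \<ge> N2 \<Longrightarrow> C \<subseteq> (T ^^ n) ` (O' False \<inter> C)"
    using exact[OF Oo Oc] by metis
  define N where "N = Suc (max N1 N2)"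
  have N0: "N > 0" by (simp add: N_def)
  have N: "C \<subseteq> (T ^^ N) ` (O' c \<inter> C)" for c
  proof -
    have "N1 \<le> N" "N2 \<le> N" by (simp_all add: N_def)
    then show ?thesis using N12 by (cases c) simp_all
  qed
  define \<U> where "\<U> = range (\<lambda>c. topspace Y - P c)"
  have \<U>: "open_cover Y \<U>"
    using Pc Pdis by (auto simp: open_cover_def \<U>_def openin_diff)
  have \<phi>n: "\<phi> ((T ^^ i) x) = (S ^^ i) (\<phi> x)" if "x \<in> topspace X" for x i
  proof (induction i)
    case (Suc i)
    then show ?case using \<phi>(2)[OF funpow_mem[OF T that, of i]] by simp
  qed simp
  have card_ge: "2 ^ n \<le> k" if cov: "itinerary_cover Y S \<U> (N * n) k" for n k
  proof -
    obtain F where F: "finite F" "card F \<le> k" "F \<subseteq> {..<N * n} \<rightarrow> \<U>"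
      "\<And>y. y \<in> topspace Y \<Longrightarrow> \<exists>W \<in> F. \<forall>i<N * n. (S ^^ i) y \<in> W i"
      using cov unfolding itinerary_cover_def by blast
    define \<Omega> where "\<Omega> = {..<n} \<rightarrow>\<^sub>E (UNIV :: bool set)"
    have "\<exists>x\<in>C. \<forall>i<n. (T ^^ (N * i)) x \<in> O' (w i) \<inter> C" for w
      by (rule horseshoe_itinerary[OF _ N]) (use ab(1) in auto)
    then obtain x where x: "\<And>w. x w \<in> C" "\<And>w i. i < n \<Longrightarrow> (T ^^ (N * i)) (x w) \<in> O' (w i)"
      unfolding Bex_def Int_iff by metis
    have "\<exists>W \<in> F. \<forall>i<N * n. (S ^^ i) (\<phi> (x w)) \<in> W i" for w
      by (intro F(4) \<phi>Y subsetD[OF C] x(1))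
    then have "\<forall>w. \<exists>W. W \<in> F \<and> (\<forall>i<N * n. (S ^^ i) (\<phi> (x w)) \<in> W i)" by (simp add: Bex_def)
    from choice[OF this] obtain f
      where f0: "\<forall>w. f w \<in> F \<and> (\<forall>i<N * n. (S ^^ i) (\<phi> (x w)) \<in> f w i)" by (rule exE)
    have f: "f w \<in> F" "i < N * n \<Longrightarrow> (S ^^ i) (\<phi> (x w)) \<in> f w i" for w i
      using f0[rule_format, of w] by simp_all
    have "inj_on f \<Omega>"
    proof (rule inj_onI, rule ccontr)
      fix v w assume vw: "v \<in> \<Omega>" "w \<in> \<Omega>" "f v = f w" "v \<noteq> w"
      have "\<exists>i\<in>{..<n}. v i \<noteq> w i"
        using PiE_ext[of v "{..<n}" "\<lambda>_. UNIV" w] vw(1,2,4) unfolding \<Omega>_def by blast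
      then obtain i where i: "i < n" "v i \<noteq> w i" by auto
      have Ni: "N * i < N * n" using i N0 by simp
      have in': "(S ^^ (N * i)) (\<phi> (x u)) \<in> P (u i)" for u
        using OP[OF x(2)[OF i(1), of u]] by (simp only: \<phi>n[OF subsetD[OF C x(1)]])
      obtain c where c: "f v (N * i) = topspace Y - P c"
      proof -
        have "f v (N * i) \<in> \<U>" using subsetD[OF F(3) f(1)[of v]] Ni by (simp add: Pi_iff)
        then show ?thesis using that by (auto simp: \<U>_def)
      qed
      have "c \<noteq> u i" if "f u (N * i) = topspace Y - P c" for u
        using f(2)[OF Ni, of u] in'[of u] unfolding that by blast
      from this[of v] this[of w] have "c \<noteq> v i" "c \<noteq> w i" using c vw(3) by simp_all
      then show False using i(2) by blast
    qed
    then have "card \<Omega> \<le> card F" using f(1) F(1) by (intro card_inj_on_le) auto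
    moreover have "card \<Omega> = 2 ^ n" by (simp add: \<Omega>_def card_PiE)
    ultimately show ?thesis using F(2) by simp
  qed
  have "ereal (ln 2 / real N) \<le> cover_entropy Y S \<U>"
    unfolding cover_entropy_def
  proof (rule limsup_ge_of_multiples)
    show "N > 0" by (rule N0)
    fix n :: nat assume n: "n > 0"
    define c where "c = cover_number Y (cover_iterate Y S \<U> (N * n))"
    have "2 ^ n \<le> c"
      unfolding c_def by (rule card_ge) (simp add: cover_number_le_iff[OF Y(1) S \<U>, symmetric])
    then have "real (2 ^ n) \<le> real c" by (rule of_nat_mono)
    then have "ln (2 ^ n) \<le> ln (real c)"
      by (subst ln_le_cancel_iff) (auto intro: less_le_trans[of 0 "2 ^ n"])
    then have "real n * ln 2 \<le> ln (real c)" by (simp add: ln_realpow)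
    then have "ln 2 / real N \<le> ln (real c) / real (N * n)"
      using n N0 by (simp add: field_simps)
    then show "ereal (ln 2 / real N) \<le> ereal (ln (real c) / real (N * n))" by simp
  qed
  moreover have "ereal (ln 2 / real N) > 0" by (simp add: N_def)
  moreover have "cover_entropy Y S \<U> \<le> topological_entropy Y S"
    unfolding topological_entropy_def using \<U> by (intro SUP_upper) simp
  ultimately show ?thesis by (meson order_less_le_trans)
qed

section \<open>Polish spaces of continuous functions\<close>

lemma metrizable_obtain_metric:
  assumes "metrizable_space X"
  obtains m where "X = mtopology_of m"
  using assms unfolding metrizable_space_def by (metis Metric_space.mtopology_of)

lemma separable_mtopology_ofI:
  assumes "\<And>e. e > 0 \<Longrightarrow> \<exists>C. countable C \<and> C \<subseteq> mspace m \<and> (\<forall>x\<in>mspace m. \<exists>c\<in>C. mdist m x c < e)"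
  shows "separable_space (mtopology_of m)"
proof -
  interpret Metric_space "mspace m" "mdist m" by simp
  have "\<exists>C. countable C \<and> C \<subseteq> mspace m \<and> (\<forall>x\<in>mspace m. \<exists>c\<in>C. mdist m x c < inverse (real (Suc n)))" for n
    by (rule assms) simp
  then obtain C where C: "\<And>n. countable (C n)" "\<And>n. C n \<subseteq> mspace m"
    "\<And>n x. x \<in> mspace m \<Longrightarrow> \<exists>c\<in>C n. mdist m x c < inverse (real (Suc n))" by metis
  have "x \<in> mtopology closure_of (\<Union>n. C n)" if x: "x \<in> mspace m" for x
    unfolding metric_closure_of
  proof (intro CollectI conjI allI impI x)
    fix r :: real assume "r > 0"
    then obtain n where n: "inverse (real (Suc n)) < r" using reals_Archimedean by blast
    obtain c where "c \<in> C n" "mdist m x c < inverse (real (Suc n))" using C(3)[OF x] by blast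
    then show "\<exists>y\<in>\<Union>n. C n. y \<in> mball x r"
      using n x C(2)[of n] by (intro bexI[of _ c]) auto
  qed
  then have "mtopology closure_of (\<Union>n. C n) = topspace mtopology"
    by (intro equalityI closure_of_subset_topspace) auto
  then show ?thesis
    unfolding separable_space_def mtopology_of_def using C(1,2) by (intro exI[of _ "\<Union>n. C n"]) auto
qed

lemma separable_mtopology_ofE:
  assumes "separable_space (mtopology_of m)"
  obtains C where "countable C" "C \<subseteq> mspace m"
    "\<And>x e. x \<in> mspace m \<Longrightarrow> e > 0 \<Longrightarrow> \<exists>c\<in>C. mdist m x c < e"
proof -
  interpret Metric_space "mspace m" "mdist m" by simp
  obtain C where C: "countable C" "C \<subseteq> mspace m" "mtopology closure_of C = mspace m"
    using assms by (auto simp: separable_space_def mtopology_of_def)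
  have "\<exists>c\<in>C. mdist m x c < e" if "x \<in> mspace m" "e > 0" for x e
  proof -
    have "x \<in> mtopology closure_of C" using that(1) C(3) by simp
    then show ?thesis using that(2) unfolding metric_closure_of by auto
  qed
  then show ?thesis using that C by blast
qed

lemma compact_net:
  assumes "compact_space (mtopology_of m)" "e > 0"
  obtains F where "finite F" "F \<subseteq> mspace m" "\<And>x. x \<in> mspace m \<Longrightarrow> \<exists>y\<in>F. mdist m y x < e"
proof -
  interpret Metric_space "mspace m" "mdist m" by simp
  have "mtotally_bounded (mspace m)"
    using assms(1) compact_space_eq_mcomplete_mtotally_bounded by (simp add: mtopology_of_def)
  then have "\<exists>K. finite K \<and> K \<subseteq> mspace m \<and> mspace m \<subseteq> (\<Union>x\<in>K. mball x e)"
    using assms(2) by (simp add: mtotally_bounded_def)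
  then obtain K where K: "finite K" "K \<subseteq> mspace m" "mspace m \<subseteq> (\<Union>x\<in>K. mball x e)" by (elim exE conjE)
  have "\<exists>y\<in>K. mdist m y x < e" if "x \<in> mspace m" for x
    using subsetD[OF K(3) that] by auto
  then show ?thesis using that K(1,2) by simp
qed

lemma mem_cfunspace_compact:
  assumes "compact_space K"
  shows "f \<in> mspace (cfunspace K m) \<longleftrightarrow> f \<in> extensional (topspace K) \<and> continuous_map K (mtopology_of m) f"
proof -
  have "compactin K (topspace K)" using assms by (simp add: compact_space_def)
  from compactin_mspace_cfunspace[OF this, of m] show ?thesis
    by (auto dest: continuous_map_funspace simp: Pi_iff simp del: mspace_cfunspace)
qed

text \<open>
  A uniformly continuous function is determined up to a small error by its scale of continuity and by
  approximate values on a finite net at that scale. Approximate values can be taken in a countable dense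
  set, so countably many such descriptions suffice; one function is chosen for each of them.
\<close>

lemma separable_cfunspace:
  assumes K: "compact_space K" "metrizable_space K" and m: "separable_space (mtopology_of m)"
  shows "separable_space (mtopology_of (cfunspace K m))"
proof (rule separable_mtopology_ofI)
  fix e :: real assume e: "e > 0"
  obtain k where k: "K = mtopology_of k" using K(2) by (rule metrizable_obtain_metric)
  obtain Q where Q: "countable Q" "Q \<subseteq> mspace m" "\<And>x e. x \<in> mspace m \<Longrightarrow> e > 0 \<Longrightarrow> \<exists>c\<in>Q. mdist m x c < e"
    by (rule separable_mtopology_ofE[OF m], rule that)
  have "\<exists>F. finite F \<and> F \<subseteq> mspace k \<and> (\<forall>x\<in>mspace k. \<exists>y\<in>F. mdist k y x < inverse (real (Suc n)))" for n
    by (rule compact_net[of k "inverse (real (Suc n))"]) (use K k in auto)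
  then obtain F where F: "\<And>n. finite (F n)" "\<And>n. F n \<subseteq> mspace k"
    "\<And>n x. x \<in> mspace k \<Longrightarrow> \<exists>y\<in>F n. mdist k y x < inverse (real (Suc n))" by metis
  \<comment> \<open>Functions that are near the same values on the same net are within \<open>4 * e / 5\<close> of each other.\<close>
  define near where "near n q f \<longleftrightarrow> f \<in> mspace (cfunspace K m) \<and> (\<forall>x\<in>F n. mdist m (f x) (q x) < e / 5) \<and>
     (\<forall>x\<in>mspace k. \<forall>y\<in>mspace k. mdist k x y < inverse (real (Suc n)) \<longrightarrow> mdist m (f x) (f y) < e / 5)" for n q f
  define I where "I = (SIGMA n:UNIV. F n \<rightarrow>\<^sub>E Q)"
  have cI: "countable I" unfolding I_def
    by (intro countable_SIGMA countable_PiE F(1) Q(1)) auto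
  define C where "C = (\<lambda>(n, q). SOME f. near n q f) ` {(n, q) \<in> I. \<exists>f. near n q f}"
  have nearC: "near n q (SOME f. near n q f)" if "\<exists>f. near n q f" for n q
    using that by (rule someI_ex)
  have close: "mdist (cfunspace K m) f g < e" if f: "near n q f" and g: "near n q g" and nq: "(n, q) \<in> I" for n q f g
  proof -
    have "mdist (cfunspace K m) f g \<le> 4 * e / 5"
    proof (rule mdist_cfunspace_le)
      fix x assume "x \<in> topspace K"
      then have x: "x \<in> mspace k" by (simp add: k)
      then obtain y where y: "y \<in> F n" "mdist k y x < inverse (real (Suc n))" using F(3) by blast
      have yk: "y \<in> mspace k" using y(1) F(2) by blast
      have qy: "q y \<in> mspace m" using nq y(1) Q(2) by (auto simp: I_def)
      have mem: "f x \<in> mspace m" "f y \<in> mspace m" "g x \<in> mspace m" "g y \<in> mspace m"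
        using f g x yk unfolding near_def mspace_cfunspace by (auto simp: k Pi_iff)
      have 1: "mdist m (f y) (q y) < e / 5" "mdist m (g y) (q y) < e / 5"
        using f g y(1) by (auto simp: near_def)
      have 2: "mdist m (f y) (f x) < e / 5" "mdist m (g y) (g x) < e / 5"
        using f g y(2) x yk unfolding near_def by blast+
      have "mdist m (f x) (g x) \<le> mdist m (f x) (f y) + mdist m (f y) (g x)"
        by (rule mdist_triangle) (use mem in auto)
      also have "mdist m (f y) (g x) \<le> mdist m (f y) (g y) + mdist m (g y) (g x)"
        by (rule mdist_triangle) (use mem in auto)
      also have "mdist m (f y) (g y) \<le> mdist m (f y) (q y) + mdist m (q y) (g y)"
        by (rule mdist_triangle) (use mem qy in auto)
      finally show "mdist m (f x) (g x) \<le> 4 * e / 5"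
        using 1 2 mdist_commute[of m "f x" "f y"] mdist_commute[of m "q y" "g y"] by linarith
    qed (use e in simp)
    also have "\<dots> < e" using e by simp
    finally show ?thesis .
  qed
  show "\<exists>C. countable C \<and> C \<subseteq> mspace (cfunspace K m) \<and> (\<forall>f\<in>mspace (cfunspace K m). \<exists>g\<in>C. mdist (cfunspace K m) f g < e)"
  proof (intro exI[of _ C] conjI ballI)
    have "countable {(n, q) \<in> I. \<exists>f. near n q f}" by (rule countable_subset[OF _ cI]) auto
    then show "countable C" unfolding C_def by (rule countable_image)
    show "C \<subseteq> mspace (cfunspace K m)"
    proof
      fix g assume "g \<in> C"
      then obtain n q where "g = (SOME f. near n q f)" "\<exists>f. near n q f" unfolding C_def by auto
      then have "near n q g" using nearC by simp
      then show "g \<in> mspace (cfunspace K m)" unfolding near_def by blast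
    qed
    fix f assume f: "f \<in> mspace (cfunspace K m)"
    then have "continuous_map (mtopology_of k) (mtopology_of m) f" by (simp add: k)
    then have "uniformly_continuous_map k m f"
      using K(1) k continuous_imp_uniformly_continuous_map by blast
    from this[unfolded uniformly_continuous_map_def, THEN conjunct2, rule_format, of "e / 5"] e
    obtain \<delta> where \<delta>0: "\<delta> > 0" "\<forall>x\<in>mspace k. \<forall>y\<in>mspace k. mdist k y x < \<delta> \<longrightarrow> mdist m (f y) (f x) < e / 5"
      by auto
    note \<delta> = \<delta>0(1) \<delta>0(2)[rule_format]
    obtain n where n: "inverse (real (Suc n)) < \<delta>" using reals_Archimedean[OF \<delta>(1)] by blast
    have fm: "f x \<in> mspace m" if "x \<in> F n" for x
      using f F(2)[of n] that unfolding mspace_cfunspace by (auto simp: k Pi_iff)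
    have "\<forall>x\<in>F n. \<exists>c. c \<in> Q \<and> mdist m (f x) c < e / 5"
      using Q(3)[OF fm, of _ "e / 5"] e by (auto simp: Bex_def)
    from bchoice[OF this] obtain q where q: "\<forall>x\<in>F n. q x \<in> Q \<and> mdist m (f x) (q x) < e / 5" ..
    define q' where "q' = restrict q (F n)"
    have I: "(n, q') \<in> I" using q by (auto simp: I_def q'_def)
    have "near n q' f"
      using f q \<delta>(2) n unfolding near_def q'_def by auto
    then have ex: "\<exists>f. near n q' f" by blast
    then have "(SOME f. near n q' f) \<in> C" unfolding C_def using I by (intro image_eqI[of _ _ "(n, q')"]) auto
    then show "\<exists>g\<in>C. mdist (cfunspace K m) f g < e"
      using close[OF \<open>near n q' f\<close> nearC[OF ex] I] by blast
  qed
qed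

lemma mcomplete_of_imp_completely_metrizable:
  "mcomplete_of m \<Longrightarrow> completely_metrizable_space (mtopology_of m)"
  unfolding mcomplete_of_def mtopology_of_def
  by (intro Metric_space.completely_metrizable_space_mtopology) auto

lemma compact_imp_mcomplete_of:
  "compact_space (mtopology_of m) \<Longrightarrow> mcomplete_of m"
  unfolding mcomplete_of_def mtopology_of_def
  by (simp add: Metric_space.compact_space_eq_mcomplete_mtotally_bounded)

lemma polish_cfunspace:
  assumes K: "compact_space K" "metrizable_space K" 
    and m: "mcomplete_of m" "separable_space (mtopology_of m)"
  shows "polish_space_in (mtopology_of (cfunspace K m))"
proof -
  interpret Metric_space "mspace m" "mdist m" by simp
  have "mcomplete_of (cfunspace K Self)"
    using m(1) by (intro mcomplete_cfunspace) (simp add: mcomplete_of_def)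
  then have "mcomplete_of (cfunspace K m)" by (simp add: Self_def)
  then show ?thesis
    using separable_cfunspace[OF K m(2)]
    by (simp add: polish_space_in_def mcomplete_of_imp_completely_metrizable)
qed

lemma separable_space_prod_topology:
  assumes "separable_space X" "separable_space Y"
  shows "separable_space (prod_topology X Y)"
proof -
  obtain C D where "countable C" "C \<subseteq> topspace X" "X closure_of C = topspace X"
    "countable D" "D \<subseteq> topspace Y" "Y closure_of D = topspace Y"
    using assms unfolding separable_space_def by blast
  then show ?thesis
    unfolding separable_space_def by (intro exI[of _ "C \<times> D"]) (auto simp: closure_of_Times)
qed

lemma polish_prod_topology:
  assumes "polish_space_in X" "polish_space_in Y"
  shows "polish_space_in (prod_topology X Y)"
  using assms
  by (simp add: polish_space_in_def separable_space_prod_topology completely_metrizable_space_prod_topology)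

lemma polish_imp_second_countable:
  assumes "polish_space_in X"
  shows "second_countable X"
proof -
  obtain m where X: "X = mtopology_of m"
    using assms unfolding polish_space_in_def
    by (meson completely_metrizable_imp_metrizable_space metrizable_obtain_metric)
  interpret Metric_space "mspace m" "mdist m" by simp
  have XM: "X = mtopology" by (simp add: X mtopology_of_def)
  have sep: "separable_space (mtopology_of m)" using assms unfolding polish_space_in_def X by blast
  obtain C where C: "countable C" "C \<subseteq> mspace m" "\<And>x e. x \<in> mspace m \<Longrightarrow> e > 0 \<Longrightarrow> \<exists>c\<in>C. mdist m x c < e"
    by (rule separable_mtopology_ofE[OF sep], rule that)
  define B where "B = (\<lambda>(c, n). mball c (inverse (real (Suc n)))) ` (C \<times> UNIV)"
  have "\<exists>V\<in>B. x \<in> V \<and> V \<subseteq> U" if U: "openin X U" "x \<in> U" for U x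
  proof -
    obtain r where r: "r > 0" "mball x r \<subseteq> U" "U \<subseteq> mspace m" using U by (auto simp: XM openin_mtopology)
    obtain n where n: "inverse (real (Suc n)) < r / 2" using reals_Archimedean[of "r / 2"] r(1) by auto
    have x: "x \<in> mspace m" using r(3) U(2) by blast
    obtain c where c: "c \<in> C" "mdist m x c < inverse (real (Suc n))"
      using C(3)[OF x, of "inverse (real (Suc n))"] by auto
    have cm: "c \<in> mspace m" using c C by blast
    have "mball c (inverse (real (Suc n))) \<subseteq> mball x r"
    proof
      fix y assume y: "y \<in> mball c (inverse (real (Suc n)))"
      then have "mdist m x y \<le> mdist m x c + mdist m c y" using x cm by (intro triangle) auto
      then show "y \<in> mball x r" using y c n x by auto
    qed
    moreover have "x \<in> mball c (inverse (real (Suc n)))" using c x cm by (simp add: commute)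
    moreover have "mball c (inverse (real (Suc n))) \<in> B" using c(1) unfolding B_def by force
    ultimately show ?thesis using r(2) by blast
  qed
  moreover have "countable B" unfolding B_def using C(1) by auto
  moreover have "openin X V" if "V \<in> B" for V using that by (auto simp: B_def XM)
  ultimately show ?thesis unfolding second_countable_def by blast
qed

lemma polish_closed_subspace:
  assumes "polish_space_in X" "closedin X C"
  shows "polish_space_in (subtopology X C)"
  using assms polish_imp_second_countable[OF assms(1)]
  unfolding polish_space_in_def
  by (simp add: completely_metrizable_space_closedin second_countable_imp_separable_space second_countable_subtopology)

lemma continuous_map_cfunspace_eval:
  assumes X: "topspace K \<noteq> {}"
  shows "continuous_map (prod_topology (mtopology_of (cfunspace K m)) K) (mtopology_of m) (\<lambda>z. fst z (snd z))"
proof -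
  interpret Metric_space "mspace m" "mdist m" by simp
  interpret C: Metric_space "mspace (cfunspace K m)" "mdist (cfunspace K m)" by (rule Metric_space_mspace_mdist)
  have "continuous_map (prod_topology (mtopology_of (cfunspace K m)) K) mtopology (\<lambda>z. fst z (snd z))"
    unfolding continuous_map_to_metric
  proof (intro ballI allI impI)
    fix z \<epsilon> assume z: "z \<in> topspace (prod_topology (mtopology_of (cfunspace K m)) K)" and \<epsilon>: "(\<epsilon>::real) > 0"
    obtain f x where fx: "z = (f, x)" by fastforce
    have f: "f \<in> mspace (cfunspace K m)" and x: "x \<in> topspace K" using z fx by (auto simp del: mspace_cfunspace)
    define U where "U = {y \<in> topspace K. f y \<in> mball (f x) (\<epsilon> / 2)}"
    have fc: "continuous_map K mtopology f" using f by (simp add: mtopology_of_def)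
    have fm: "f y \<in> mspace m" if "y \<in> topspace K" for y using f that by (auto simp: Pi_iff)
    have "openin K U" unfolding U_def by (rule openin_continuous_map_preimage[OF fc]) simp
    then have op: "openin (prod_topology (mtopology_of (cfunspace K m)) K) (C.mball f (\<epsilon> / 2) \<times> U)"
      by (simp add: openin_prod_Times_iff mtopology_of_def del: mspace_cfunspace)
    show "\<exists>U. openin (prod_topology (mtopology_of (cfunspace K m)) K) U \<and> z \<in> U \<and>
             (\<forall>w\<in>U. fst w (snd w) \<in> mball (fst z (snd z)) \<epsilon>)"
    proof (intro exI conjI ballI)
      show "z \<in> C.mball f (\<epsilon> / 2) \<times> U"
        using f x \<epsilon> fm[OF x] by (simp add: fx U_def del: mspace_cfunspace)
      fix w assume w: "w \<in> C.mball f (\<epsilon> / 2) \<times> U"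
      obtain g y where gy: "w = (g, y)" by fastforce
      have g: "g \<in> mspace (cfunspace K m)" "mdist (cfunspace K m) f g < \<epsilon> / 2" and y: "y \<in> U"
        using w gy by (auto simp del: mspace_cfunspace)
      have yK: "y \<in> topspace K" using y by (simp add: U_def)
      have gm: "g y \<in> mspace m" using g(1) yK by (auto simp: Pi_iff)
      have "mdist m (f y) (g y) \<le> mdist (cfunspace K m) f g"
        by (rule mdist_cfunspace_imp_mdist_le[OF f g(1) order_refl yK])
      moreover have "mdist m (f x) (f y) < \<epsilon> / 2" using y by (auto simp: U_def)
      moreover have "mdist m (f x) (g y) \<le> mdist m (f x) (f y) + mdist m (f y) (g y)"
        by (rule triangle) (use fm x yK gm in auto)
      ultimately show "fst w (snd w) \<in> mball (fst z (snd z)) \<epsilon>"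
        using g(2) fm[OF x] gm by (simp add: fx gy)
    qed (rule op)
  qed
  then show ?thesis by (simp add: mtopology_of_def)
qed

text \<open>
  The projection along a compact factor is a closed map. This turns conditions at all points of a
  compact space into open conditions on the parameter.
\<close>

lemma openin_Ball_compact:
  assumes K: "compact_space K" and U: "openin (prod_topology P K) U"
  shows "openin P {p \<in> topspace P. \<forall>x\<in>topspace K. (p, x) \<in> U}"
proof -
  have "closedin P (fst ` (topspace (prod_topology P K) - U))"
    using closed_map_fst[OF K, of P] closedin_diff[OF closedin_topspace U] unfolding closed_map_def by blast
  then have "openin P (topspace P - fst ` (topspace (prod_topology P K) - U))" by (rule openin_diff[OF openin_topspace])
  also have "topspace P - fst ` (topspace (prod_topology P K) - U) = {p \<in> topspace P. \<forall>x\<in>topspace K. (p, x) \<in> U}"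
    by force
  finally show ?thesis .
qed

section \<open>The CPE maps form a coanalytic set\<close>

text \<open>
  For an indexed cover the members can be replaced by their indices, which do not depend on the map or on
  the pseudometric.
\<close>

lemma itinerary_cover_image_iff:
  "itinerary_cover X T (h ` I) n k \<longleftrightarrow>
    (\<exists>G. finite G \<and> card G \<le> k \<and> G \<subseteq> {..<n} \<rightarrow> I \<and> (\<forall>x\<in>topspace X. \<exists>c\<in>G. \<forall>i<n. (T ^^ i) x \<in> h (c i)))"
proof
  assume "itinerary_cover X T (h ` I) n k"
  then obtain F where F: "finite F" "card F \<le> k" "F \<subseteq> {..<n} \<rightarrow> h ` I"
    "\<forall>x\<in>topspace X. \<exists>W\<in>F. \<forall>i<n. (T ^^ i) x \<in> W i"
    unfolding itinerary_cover_def by (elim exE conjE)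
  define g where "g W = (\<lambda>i. SOME c. c \<in> I \<and> W i = h c)" for W :: "nat \<Rightarrow> 'a set"
  have g: "g W i \<in> I \<and> W i = h (g W i)" if "W \<in> F" "i < n" for W i
  proof -
    have "W i \<in> h ` I" using F(3) that by blast
    then have "\<exists>c. c \<in> I \<and> W i = h c" by blast
    then show ?thesis unfolding g_def by (rule someI_ex)
  qed
  show "\<exists>G. finite G \<and> card G \<le> k \<and> G \<subseteq> {..<n} \<rightarrow> I \<and> (\<forall>x\<in>topspace X. \<exists>c\<in>G. \<forall>i<n. (T ^^ i) x \<in> h (c i))"
  proof (intro exI[of _ "g ` F"] conjI ballI)
    show "finite (g ` F)" using F(1) by simp
    show "card (g ` F) \<le> k" using card_image_le[OF F(1), of g] F(2) by simp
    show "g ` F \<subseteq> {..<n} \<rightarrow> I" using g by auto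
    fix x assume "x \<in> topspace X"
    then obtain W where W: "W \<in> F" "\<forall>i<n. (T ^^ i) x \<in> W i" using F(4) by (elim ballE bexE) auto
    have "(T ^^ i) x \<in> h (g W i)" if "i < n" for i
      using W(2)[rule_format, OF that] g[OF W(1) that] by simp
    then show "\<exists>c\<in>g ` F. \<forall>i<n. (T ^^ i) x \<in> h (c i)" using W(1) by (intro bexI[of _ "g W"]) auto
  qed
next
  assume "\<exists>G. finite G \<and> card G \<le> k \<and> G \<subseteq> {..<n} \<rightarrow> I \<and> (\<forall>x\<in>topspace X. \<exists>c\<in>G. \<forall>i<n. (T ^^ i) x \<in> h (c i))"
  then obtain G where G: "finite G" "card G \<le> k" "G \<subseteq> {..<n} \<rightarrow> I"
    "\<forall>x\<in>topspace X. \<exists>c\<in>G. \<forall>i<n. (T ^^ i) x \<in> h (c i)" by (elim exE conjE)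
  show "itinerary_cover X T (h ` I) n k"
    unfolding itinerary_cover_def
  proof (intro exI[of _ "(\<lambda>c. h \<circ> c) ` G"] conjI ballI)
    show "finite ((\<lambda>c. h \<circ> c) ` G)" using G(1) by simp
    show "card ((\<lambda>c. h \<circ> c) ` G) \<le> k" using card_image_le[OF G(1), of "\<lambda>c. h \<circ> c"] G(2) by simp
    show "(\<lambda>c. h \<circ> c) ` G \<subseteq> {..<n} \<rightarrow> h ` I" using G(3) by fastforce
    fix x assume "x \<in> topspace X"
    then obtain c where "c \<in> G" "\<forall>i<n. (T ^^ i) x \<in> h (c i)" using G(4) by (elim ballE bexE) auto
    then show "\<exists>W\<in>(\<lambda>c. h \<circ> c) ` G. \<forall>i<n. (T ^^ i) x \<in> W i" by (intro bexI[of _ "h \<circ> c"]) auto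
  qed
qed

definition pball :: "'a set \<Rightarrow> ('a \<times> 'a \<Rightarrow> real) \<Rightarrow> real \<Rightarrow> 'a \<Rightarrow> 'a set" where
  "pball A \<rho> e c = {x \<in> A. \<rho> (x, c) < e}"

text \<open>
  The third clause is a uniform form of the requirement that \<open>T\<close> induces a map of the quotient by
  \<open>\<rho>\<close>; it is chosen because it is a countable intersection of open conditions. The last clause says
  that the induced map has entropy zero.
\<close>

definition null_pseudometric :: "'a topology \<Rightarrow> ('a \<Rightarrow> 'a) \<Rightarrow> ('a \<times> 'a \<Rightarrow> real) \<Rightarrow> bool" where
  "null_pseudometric X T \<rho> \<longleftrightarrow>
    (\<forall>x\<in>topspace X. \<forall>y\<in>topspace X. \<forall>z\<in>topspace X.
        \<rho> (x, x) = 0 \<and> \<rho> (x, y) = \<rho> (y, x) \<and> \<rho> (x, z) \<le> \<rho> (x, y) + \<rho> (y, z)) \<and>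
    (\<exists>x\<in>topspace X. \<exists>y\<in>topspace X. \<rho> (x, y) > 0) \<and>
    (\<forall>j. \<exists>l. \<forall>x\<in>topspace X. \<forall>y\<in>topspace X.
        \<rho> (x, y) > inverse (real (Suc l)) \<or> \<rho> (T x, T y) < inverse (real (Suc j))) \<and>
    (\<forall>j m. \<exists>n0. \<forall>n\<ge>n0. itinerary_cover X T (pball (topspace X) \<rho> (inverse (real (Suc j))) ` topspace X) n
        (nat \<lfloor>exp (real n / real (Suc m))\<rfloor>))"

text \<open>
  The pseudometric is the pullback of a metric of the factor.
\<close>

lemma not_cpe_imp_null_pseudometric:
  assumes X: "is_tds X T" "topspace X \<noteq> {}" and not: "\<not> has_cpe X T"
  shows "\<exists>\<rho>. \<rho> \<in> mspace (cfunspace (prod_topology X X) euclidean_metric) \<and> null_pseudometric X T \<rho>"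
proof -
  have cX: "compact_space X" and T: "continuous_map X X T" using X by (auto simp: is_tds_def)
  obtain Y :: "real topology" and S where fac: "is_factor X T Y S" and triv: "\<not> (\<exists>y. topspace Y = {y})"
    and ent: "topological_entropy Y S \<le> 0"
    using not X(1) by (auto simp: has_cpe_def not_less)
  obtain \<phi> where \<phi>: "continuous_map X Y \<phi>" "\<phi> ` topspace X = topspace Y"
    "\<And>x. x \<in> topspace X \<Longrightarrow> \<phi> (T x) = S (\<phi> x)" and Y: "is_tds Y S"
    using fac by (auto simp: is_factor_def)
  obtain m where m: "Y = mtopology_of m"
    using Y unfolding is_tds_def by (meson metrizable_obtain_metric)
  have cY: "compact_space Y" and S: "continuous_map Y Y S" using Y by (auto simp: is_tds_def)
  have \<phi>m: "\<phi> x \<in> mspace m" if "x \<in> topspace X" for x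
    using \<phi>(2) that by (auto simp: m)
  define \<rho> where "\<rho> = restrict (\<lambda>z. mdist m (\<phi> (fst z)) (\<phi> (snd z))) (topspace (prod_topology X X))"
  have \<rho>: "\<rho> (x, y) = mdist m (\<phi> x) (\<phi> y)" if "x \<in> topspace X" "y \<in> topspace X" for x y
    using that by (simp add: \<rho>_def)
  have cont: "continuous_map (prod_topology X X) euclidean \<rho>"
  proof (rule continuous_map_eq)
    have "continuous_map (prod_topology X X) (mtopology_of m) (\<phi> \<circ> fst)"
      "continuous_map (prod_topology X X) (mtopology_of m) (\<phi> \<circ> snd)"
      using \<phi>(1) unfolding m by (auto intro: continuous_map_compose continuous_map_fst continuous_map_snd)
    then show "continuous_map (prod_topology X X) euclidean (\<lambda>z. mdist m ((\<phi> \<circ> fst) z) ((\<phi> \<circ> snd) z))"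
      by (rule continuous_map_mdist)
  qed (simp add: \<rho>_def)
  have \<rho>mem: "\<rho> \<in> mspace (cfunspace (prod_topology X X) euclidean_metric)"
    using cont cX by (simp add: mem_cfunspace_compact compact_space_prod_topology \<rho>_def del: mspace_cfunspace)
  have S_uc: "uniformly_continuous_map m m S"
    using continuous_imp_uniformly_continuous_map cY S m by blast
  have "null_pseudometric X T \<rho>"
    unfolding null_pseudometric_def
  proof (intro conjI ballI allI)
    fix x y z assume "x \<in> topspace X" "y \<in> topspace X" "z \<in> topspace X"
    then show "\<rho> (x, x) = 0" "\<rho> (x, y) = \<rho> (y, x)" "\<rho> (x, z) \<le> \<rho> (x, y) + \<rho> (y, z)"
      using \<phi>m by (simp_all add: \<rho> mdist_commute mdist_triangle)
  next
    obtain x where x: "x \<in> topspace X" using X(2) by blast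
    then have "\<phi> x \<in> topspace Y" using \<phi>(2) by blast
    then obtain z where "z \<in> topspace Y" "z \<noteq> \<phi> x" using triv by blast
    then obtain y where y: "y \<in> topspace X" "\<phi> y \<noteq> \<phi> x" using \<phi>(2) by (metis imageE)
    then have "mdist m (\<phi> x) (\<phi> y) > 0" using x \<phi>m by (intro Metric_space.mdist_pos_less[OF Metric_space_mspace_mdist]) auto
    then show "\<exists>x\<in>topspace X. \<exists>y\<in>topspace X. \<rho> (x, y) > 0"
      using x y(1) \<rho> by (intro bexI[of _ x] bexI[of _ y]) simp_all
  next
    fix j
    from S_uc[unfolded uniformly_continuous_map_def, THEN conjunct2, rule_format, of "inverse (real (Suc j))"]
    obtain \<delta> where \<delta>: "\<delta> > 0" "\<forall>x\<in>mspace m. \<forall>y\<in>mspace m. mdist m y x < \<delta> \<longrightarrow> mdist m (S y) (S x) < inverse (real (Suc j))"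
      by auto
    obtain l where l: "inverse (real (Suc l)) < \<delta>" using reals_Archimedean[OF \<delta>(1)] by blast
    have "\<rho> (x, y) > inverse (real (Suc l)) \<or> \<rho> (T x, T y) < inverse (real (Suc j))"
      if xy: "x \<in> topspace X" "y \<in> topspace X" for x y
    proof (rule disjCI)
      assume "\<not> \<rho> (T x, T y) < inverse (real (Suc j))"
      moreover have "T x \<in> topspace X" "T y \<in> topspace X" using funpow_mem[OF T, of _ 1] xy by auto
      ultimately have "\<not> mdist m (S (\<phi> x)) (S (\<phi> y)) < inverse (real (Suc j))" by (simp add: \<rho> \<phi>(3) xy)
      then have "\<not> mdist m (\<phi> x) (\<phi> y) < \<delta>" using \<delta>(2) \<phi>m xy by blast
      then show "\<rho> (x, y) > inverse (real (Suc l))" using l xy by (simp add: \<rho>)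
    qed
    then show "\<exists>l. \<forall>x\<in>topspace X. \<forall>y\<in>topspace X. \<rho> (x, y) > inverse (real (Suc l)) \<or> \<rho> (T x, T y) < inverse (real (Suc j))"
      by blast
  next
    fix j p
    define e where "e = inverse (real (Suc j))"
    have e: "e > 0" by (simp add: e_def)
    define B where "B c = {y \<in> topspace Y. mdist m y c < e}" for c
    have eqB: "\<phi> x \<in> B (\<phi> c) \<longleftrightarrow> x \<in> pball (topspace X) \<rho> e c" if "x \<in> topspace X" "c \<in> topspace X" for x c
      using that \<phi>(2) by (auto simp: B_def pball_def \<rho>)
    have "open_cover Y (B ` topspace Y)"
    proof -
      interpret Metric_space "mspace m" "mdist m" by simp
      have "B c = mball c e" if "c \<in> topspace Y" for c using that by (auto simp: B_def m commute)
      then show ?thesis using e by (auto simp: open_cover_def m mtopology_of_def)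
    qed
    then have "cover_entropy Y S (B ` topspace Y) \<le> 0"
      using ent by (simp add: topological_entropy_le_0_iff)
    then obtain n0 where n0: "\<forall>n\<ge>n0. itinerary_cover Y S (B ` topspace Y) n (nat \<lfloor>exp (real n / real (Suc p))\<rfloor>)"
      using cover_entropy_le_0_iff[OF cY S \<open>open_cover Y (B ` topspace Y)\<close>] by blast
    have \<phi>n: "\<phi> ((T ^^ i) x) = (S ^^ i) (\<phi> x)" if "x \<in> topspace X" for x i
    proof (induction i)
      case (Suc i)
      then show ?case using \<phi>(3)[OF funpow_mem[OF T that, of i]] by simp
    qed simp
    have "itinerary_cover X T (pball (topspace X) \<rho> e ` topspace X) n k"
      if cov: "itinerary_cover Y S (B ` topspace Y) n k" for n k
    proof -
      have "itinerary_cover Y S ((B \<circ> \<phi>) ` topspace X) n k" using cov \<phi>(2) by (metis image_comp)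
      then obtain G where G: "finite G" "card G \<le> k" "G \<subseteq> {..<n} \<rightarrow> topspace X"
        "\<forall>y\<in>topspace Y. \<exists>c\<in>G. \<forall>i<n. (S ^^ i) y \<in> (B \<circ> \<phi>) (c i)"
        unfolding itinerary_cover_image_iff by (elim exE conjE)
      show ?thesis
        unfolding itinerary_cover_image_iff
      proof (intro exI[of _ G] conjI ballI G(1-3))
        fix x assume x: "x \<in> topspace X"
        then have "\<phi> x \<in> topspace Y" using \<phi>(2) by blast
        from bspec[OF G(4) this] obtain c where c: "c \<in> G" "\<forall>i<n. (S ^^ i) (\<phi> x) \<in> (B \<circ> \<phi>) (c i)" by (elim bexE)
        have "(T ^^ i) x \<in> pball (topspace X) \<rho> e (c i)" if "i < n" for i
        proof -
          have ci: "c i \<in> topspace X" using subsetD[OF G(3) c(1)] that by (simp add: Pi_iff)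
          have "\<phi> ((T ^^ i) x) \<in> B (\<phi> (c i))" using c(2) that by (simp add: \<phi>n[OF x])
          then show ?thesis using eqB[OF funpow_mem[OF T x] ci] by simp
        qed
        then show "\<exists>c\<in>G. \<forall>i<n. (T ^^ i) x \<in> pball (topspace X) \<rho> e (c i)" using c(1) by blast
      qed
    qed
    then show "\<exists>n0. \<forall>n\<ge>n0. itinerary_cover X T (pball (topspace X) \<rho> (inverse (real (Suc j))) ` topspace X) n (nat \<lfloor>exp (real n / real (Suc p))\<rfloor>)"
      unfolding e_def[symmetric] using n0 by blast
  qed
  then show ?thesis using \<rho>mem by blast
qed

text \<open>
  The factor is the quotient by \<open>\<rho>\<close>. By a Lebesgue number, each of its covers is refined by the balls of some radius, so
  the last clause of the definition bounds the entropy of all covers.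
\<close>

lemma null_pseudometric_imp_not_cpe:
  assumes X: "is_tds X T"
    and \<rho>c: "continuous_map (prod_topology X X) euclidean \<rho>" and \<rho>: "null_pseudometric X T \<rho>"
  shows "\<not> has_cpe X T"
proof
  assume cpe: "has_cpe X T"
  have cX: "compact_space X" and T: "continuous_map X X T" using X by (auto simp: is_tds_def)
  define A where "A = topspace X"
  have TA: "T x \<in> A" if "x \<in> A" for x using funpow_mem[OF T, of x 1] that by (simp add: A_def)
  have r0: "\<rho> (x, x) = 0" if "x \<in> A" for x using \<rho> that unfolding null_pseudometric_def A_def by blast
  have sym: "\<rho> (x, y) = \<rho> (y, x)" if "x \<in> A" "y \<in> A" for x y using \<rho> that unfolding null_pseudometric_def A_def by blast
  have tri: "\<rho> (x, z) \<le> \<rho> (x, y) + \<rho> (y, z)" if "x \<in> A" "y \<in> A" "z \<in> A" for x y z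
    using \<rho> that unfolding null_pseudometric_def A_def by blast
  have pos: "\<rho> (x, y) \<ge> 0" if "x \<in> A" "y \<in> A" for x y
    using tri[of x y x] r0[of x] sym[of x y] that by simp
  obtain a b where ab: "a \<in> A" "b \<in> A" "\<rho> (a, b) > 0" using \<rho> unfolding null_pseudometric_def A_def by blast
  have uc: "\<exists>l. \<forall>x\<in>A. \<forall>y\<in>A. \<rho> (x, y) > inverse (real (Suc l)) \<or> \<rho> (T x, T y) < inverse (real (Suc j))" for j
    using \<rho> unfolding null_pseudometric_def A_def by blast
  have zero: "\<exists>n0. \<forall>n\<ge>n0. itinerary_cover X T (pball A \<rho> (inverse (real (Suc j))) ` A) n (nat \<lfloor>exp (real n / real (Suc m))\<rfloor>)" for j m
    using \<rho> unfolding null_pseudometric_def A_def by blast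
  have ker: "\<rho> (T x, T y) = 0" if "x \<in> A" "y \<in> A" "\<rho> (x, y) = 0" for x y
  proof (rule ccontr)
    assume "\<rho> (T x, T y) \<noteq> 0"
    then have "\<rho> (T x, T y) > 0" using pos[OF TA TA] that by (simp add: less_le)
    then obtain j where j: "inverse (real (Suc j)) < \<rho> (T x, T y)" using reals_Archimedean by blast
    obtain l where "\<forall>x\<in>A. \<forall>y\<in>A. \<rho> (x, y) > inverse (real (Suc l)) \<or> \<rho> (T x, T y) < inverse (real (Suc j))"
      using uc by blast
    from this[rule_format, OF that(1,2)] j that(3) have "0 > inverse (real (Suc l))" by linarith
    then show False by simp
  qed
  \<comment> \<open>The quotient lives on a set of representatives of the classes, so no quotient type is needed.\<close>
  define r where "r x = (SOME y. y \<in> A \<and> \<rho> (x, y) = 0)" for x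
  have r: "r x \<in> A" "\<rho> (x, r x) = 0" if "x \<in> A" for x
  proof -
    have "\<exists>y. y \<in> A \<and> \<rho> (x, y) = 0" using r0 that by blast
    from someI_ex[OF this] show "r x \<in> A" "\<rho> (x, r x) = 0" unfolding r_def by blast+
  qed
  have eqv: "\<rho> (x, z) = \<rho> (y, z)" if "x \<in> A" "y \<in> A" "z \<in> A" "\<rho> (x, y) = 0" for x y z
    using tri[of x y z] tri[of y x z] sym[of x y] that by simp
  have r_eq: "r x = r y" if "x \<in> A" "y \<in> A" "\<rho> (x, y) = 0" for x y
  proof -
    have "(\<lambda>z. z \<in> A \<and> \<rho> (x, z) = 0) = (\<lambda>z. z \<in> A \<and> \<rho> (y, z) = 0)"
      using eqv[OF that(1,2) _ that(3)] by (intro ext) auto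
    then show ?thesis unfolding r_def by simp
  qed
  have r1: "\<rho> (r x, y) = \<rho> (x, y)" if "x \<in> A" "y \<in> A" for x y
    using eqv[OF that(1) r(1)[OF that(1)] that(2) r(2)[OF that(1)]] by simp
  have r2: "\<rho> (y, r x) = \<rho> (y, x)" if "x \<in> A" "y \<in> A" for x y
    using r1[OF that] sym that r(1) by metis
  define d where "d x y = (if x \<in> A \<and> y \<in> A then \<rho> (x, y) else 0)" for x y
  interpret M: Metric_space "r ` A" d
  proof
    fix x y show "0 \<le> d x y" "d x y = d y x" using pos sym by (auto simp: d_def)
  next
    fix x y assume "x \<in> r ` A" "y \<in> r ` A"
    then obtain x' y' where xy: "x' \<in> A" "x = r x'" "y' \<in> A" "y = r y'" by blast
    have "d x y = \<rho> (x', y')" using xy r(1) by (simp add: d_def r1 r2)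
    moreover have "\<rho> (x', y') = 0 \<longleftrightarrow> x = y"
    proof
      assume "x = y"
      then have "\<rho> (x', y') = \<rho> (r x', r x')" using xy r1 r2 r(1) by metis
      then show "\<rho> (x', y') = 0" using r0[OF r(1)[OF xy(1)]] by simp
    qed (use r_eq xy in auto)
    ultimately show "d x y = 0 \<longleftrightarrow> x = y" by simp
  next
    fix x y z assume "x \<in> r ` A" "y \<in> r ` A" "z \<in> r ` A"
    then have "x \<in> A" "y \<in> A" "z \<in> A" using r(1) by blast+
    then show "d x z \<le> d x y + d y z" using tri by (simp add: d_def)
  qed
  define Y where "Y = M.mtopology"
  define S where "S = (\<lambda>y. r (T y))"
  have tY: "topspace Y = r ` A" by (simp add: Y_def)
  have rc: "continuous_map X Y r"
    unfolding Y_def M.continuous_map_to_metric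
  proof (intro ballI allI impI)
    fix x e assume x: "x \<in> topspace X" and e: "(e::real) > 0"
    have xA: "x \<in> A" using x by (simp add: A_def)
    have "continuous_map X (prod_topology X X) (\<lambda>y. (x, y))"
      using x by (simp add: continuous_map_pairedI)
    from continuous_map_compose[OF this \<rho>c] have "continuous_map X euclidean (\<lambda>y. \<rho> (x, y))" by (simp add: comp_def)
    then have "openin X {y \<in> topspace X. \<rho> (x, y) \<in> {..<e}}"
      by (rule openin_continuous_map_preimage) auto
    moreover have "r y \<in> M.mball (r x) e" if "y \<in> A" "\<rho> (x, y) < e" for y
      using that xA r(1) by (simp add: d_def r1 r2)
    ultimately show "\<exists>U. openin X U \<and> x \<in> U \<and> (\<forall>y\<in>U. r y \<in> M.mball (r x) e)"
      using r0[OF xA] e x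
      by (intro exI[of _ "{y \<in> topspace X. \<rho> (x, y) \<in> {..<e}}"]) (simp add: A_def[symmetric])
  qed
  have cY: "compact_space Y"
  proof -
    have "compactin Y (r ` topspace X)" using cX rc by (intro image_compactin[of X]) (auto simp: compact_space_def)
    then show ?thesis by (simp add: compact_space_def tY A_def)
  qed
  have mY: "metrizable_space Y" unfolding Y_def by (rule M.metrizable_space_mtopology)
  have Sc: "continuous_map Y Y S"
    unfolding Y_def M.metric_continuous_map[OF M.Metric_space_axioms]
  proof (intro conjI ballI allI impI)
    show "S ` r ` A \<subseteq> r ` A" using r(1) TA by (auto simp: S_def)
    fix a e assume a: "a \<in> r ` A" and e: "(e::real) > 0"
    obtain j where j: "inverse (real (Suc j)) < e" using reals_Archimedean[OF e] by blast
    obtain l where l: "\<forall>x\<in>A. \<forall>y\<in>A. \<rho> (x, y) > inverse (real (Suc l)) \<or> \<rho> (T x, T y) < inverse (real (Suc j))"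
      using uc by blast
    have aA: "a \<in> A" using a r(1) by blast
    show "\<exists>\<delta>>0. \<forall>x. x \<in> r ` A \<and> d a x < \<delta> \<longrightarrow> d (S a) (S x) < e"
    proof (intro exI[of _ "inverse (real (Suc l))"] conjI allI impI)
      fix x assume x: "x \<in> r ` A \<and> d a x < inverse (real (Suc l))"
      then have xA: "x \<in> A" using r(1) by blast
      have "\<rho> (T a, T x) < inverse (real (Suc j))" using l[rule_format, OF aA xA] x aA xA by (simp add: d_def)
      then show "d (S a) (S x) < e" using j aA xA TA r(1) by (simp add: S_def d_def r1 r2)
    qed simp
  qed
  have eqS: "r (T x) = S (r x)" if "x \<in> A" for x
    unfolding S_def using that ker[OF that r(1)[OF that] r(2)[OF that]] TA r(1) by (intro r_eq) auto
  have fac: "is_factor X T Y S"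
    unfolding is_factor_def is_tds_def
    using cY mY Sc rc tY eqS by (auto simp: A_def[symmetric])
  have "r a \<noteq> r b" 
  proof
    assume "r a = r b"
    then have "\<rho> (a, b) = \<rho> (r a, r a)" using ab r1 r2 r(1) by metis
    then show False using ab r0[OF r(1)[OF ab(1)]] by simp
  qed
  then have "\<not> (\<exists>y. topspace Y = {y})" using ab(1,2) unfolding tY by (metis imageI singletonD)
  from has_cpe_factorD[OF cpe fac this] have pos_ent: "topological_entropy Y S > 0" .
  have Sn: "(S ^^ i) (r x) = r ((T ^^ i) x)" if "x \<in> A" for x i
  proof (induction i)
    case (Suc i)
    have "(T ^^ i) x \<in> A" using funpow_mem[OF T] that by (simp add: A_def)
    then show ?case using Suc eqS by simp
  qed simp
  have "cover_entropy Y S \<V> \<le> 0" if \<V>: "open_cover Y \<V>" for \<V>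
  proof -
    have "\<exists>e>0. \<forall>x\<in>r ` A. \<exists>U\<in>\<V>. M.mball x e \<subseteq> U"
    proof (rule M.lebesgue_number)
      show "compactin M.mtopology (r ` A)" using cY tY by (simp add: compact_space_def Y_def)
      show "r ` A \<subseteq> \<Union>\<V>" using \<V> tY by (simp add: open_cover_def)
      show "openin M.mtopology U" if "U \<in> \<V>" for U using \<V> that by (simp add: open_cover_def Y_def)
    qed
    then obtain e where e: "e > 0" "\<forall>x\<in>r ` A. \<exists>U\<in>\<V>. M.mball x e \<subseteq> U" by blast
    obtain j where j: "inverse (real (Suc j)) < e" using reals_Archimedean[OF e(1)] by blast
    have "\<forall>x\<in>r ` A. \<exists>U. U \<in> \<V> \<and> M.mball x e \<subseteq> U" using e(2) by blast
    from bchoice[OF this] obtain v where v: "\<forall>x\<in>r ` A. v x \<in> \<V> \<and> M.mball x e \<subseteq> v x" ..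
    have tr: "itinerary_cover Y S \<V> n k" if cov: "itinerary_cover X T (pball A \<rho> (inverse (real (Suc j))) ` A) n k" for n k
    proof -
      obtain G where G: "finite G" "card G \<le> k" "G \<subseteq> {..<n} \<rightarrow> A"
        "\<forall>x\<in>topspace X. \<exists>c\<in>G. \<forall>i<n. (T ^^ i) x \<in> pball A \<rho> (inverse (real (Suc j))) (c i)"
        using cov unfolding itinerary_cover_image_iff by (elim exE conjE)
      define h where "h c = (\<lambda>i. v (r (c i)))" for c :: "nat \<Rightarrow> 'a"
      show ?thesis
        unfolding itinerary_cover_def
      proof (intro exI[of _ "h ` G"] conjI ballI)
        show "finite (h ` G)" using G(1) by simp
        show "card (h ` G) \<le> k" using card_image_le[OF G(1), of h] G(2) by simp
        have "h c i \<in> \<V>" if "c \<in> G" "i < n" for c i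
        proof -
          have "c i \<in> A" using subsetD[OF G(3) that(1)] that(2) by (simp add: Pi_iff)
          then show ?thesis using v by (simp add: h_def)
        qed
        then show "h ` G \<subseteq> {..<n} \<rightarrow> \<V>" by auto
        fix y assume "y \<in> topspace Y"
        then obtain x where x: "x \<in> A" "y = r x" using tY by blast
        then obtain c where c: "c \<in> G" "\<forall>i<n. (T ^^ i) x \<in> pball A \<rho> (inverse (real (Suc j))) (c i)"
          using G(4)[rule_format, of x] by (auto simp: A_def)
        have "(S ^^ i) y \<in> h c i" if i: "i < n" for i
        proof -
          have ci: "c i \<in> A" using subsetD[OF G(3) c(1)] i by (simp add: Pi_iff)
          have t: "(T ^^ i) x \<in> A" "\<rho> ((T ^^ i) x, c i) < inverse (real (Suc j))"
            using c(2) i by (auto simp: pball_def)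
          have "r ((T ^^ i) x) \<in> M.mball (r (c i)) e"
            using t ci r(1) j sym[OF t(1) ci] by (simp add: d_def r1 r2)
          moreover have "M.mball (r (c i)) e \<subseteq> h c i" using v ci by (simp add: h_def)
          ultimately show ?thesis using Sn[OF x(1)] x(2) by auto
        qed
        then show "\<exists>W\<in>h ` G. \<forall>i<n. (S ^^ i) y \<in> W i" using c(1) by blast
      qed
    qed
    show ?thesis unfolding cover_entropy_le_0_iff[OF cY Sc \<V>]
      using zero[of j] tr by meson
  qed
  then have "topological_entropy Y S \<le> 0" by (simp add: topological_entropy_le_0_iff)
  then show False using pos_ent by simp
qed

lemma continuous_map_cfunspace_eval_compose:
  assumes "topspace K \<noteq> {}" "continuous_map Z (mtopology_of (cfunspace K m)) f" "continuous_map Z K g"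
  shows "continuous_map Z (mtopology_of m) (\<lambda>z. f z (g z))"
  using continuous_map_compose[OF continuous_map_pairedI[OF assms(2,3)] continuous_map_cfunspace_eval[OF assms(1)]]
  by (simp add: comp_def)

lemma borel_of_openin: "openin X U \<Longrightarrow> U \<in> sets (borel_of X)"
  by (auto simp: sets_borel_of)

lemma borel_of_closedin:
  assumes "closedin X C"
  shows "C \<in> sets (borel_of X)"
proof -
  have "topspace X - C \<in> sets (borel_of X)" using assms by (intro borel_of_openin) (simp add: openin_diff)
  then have "space (borel_of X) - (topspace X - C) \<in> sets (borel_of X)" by (rule sets.compl_sets)
  then show ?thesis using closedin_subset[OF assms] by (simp add: double_diff)
qed

text \<open>
  The set of pairs \<open>(T, \<rho>)\<close> is built from open and closed sets by countable unions and intersections,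
  and the non-CPE maps are its projection. The clause on covers is open because, for a fixed finite set of
  names by centres of balls, it asks for an open condition at each point of a compact space.
\<close>

lemma coanalytic_CPE:
  fixes m :: "'a metric"
  assumes c: "compact_space (mtopology_of m)" and ne: "mspace m \<noteq> {}"
  shows "coanalytic_in (TDS m) (CPE m)"
proof -
  define X where "X = mtopology_of m"
  have tX: "topspace X = mspace m" by (simp add: X_def)
  have neX: "topspace X \<noteq> {}" using ne by (simp add: tX)
  have cX: "compact_space X" using c by (simp add: X_def)
  have mX: "metrizable_space X" 
    unfolding X_def mtopology_of_def by (rule Metric_space.metrizable_space_mtopology) simp
  have sX: "separable_space X" by (rule compact_metrizable_imp_separable[OF cX mX])
  define R where "R = mtopology_of (cfunspace (prod_topology X X) (euclidean_metric :: real metric))"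
  define P where "P = prod_topology (TDS m) R"
  have TDS: "TDS m = mtopology_of (cfunspace X m)" by (simp add: TDS_def X_def)
  have cXX: "compact_space (prod_topology X X)" and mXX: "metrizable_space (prod_topology X X)"
    using cX mX by (simp_all add: compact_space_prod_topology metrizable_space_prod_topology)
  have polT: "polish_space_in (TDS m)"
    unfolding TDS using cX mX c sX by (intro polish_cfunspace compact_imp_mcomplete_of) (simp_all add: X_def)
  have polR: "polish_space_in R"
    unfolding R_def
  proof (intro polish_cfunspace cXX mXX)
    show "mcomplete_of (euclidean_metric :: real metric)"
      by (simp add: mcomplete_of_def complete_UNIV)
    show "separable_space (mtopology_of (euclidean_metric :: real metric))"
    proof (rule separable_mtopology_ofI)
      fix e :: real assume e: "e > 0"
      have "\<exists>c\<in>\<rat>. dist x c < e" for x :: real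
      proof -
        obtain q where "q \<in> \<rat>" "x < q" "q < x + e" using Rats_dense_in_real[of x "x + e"] e by auto
        then show ?thesis by (intro bexI[of _ q]) (auto simp: dist_real_def)
      qed
      then show "\<exists>C. countable C \<and> C \<subseteq> mspace (euclidean_metric :: real metric) \<and>
          (\<forall>x\<in>mspace euclidean_metric. \<exists>c\<in>C. mdist euclidean_metric x c < e)"
        by (intro exI[of _ "\<rat>"]) (simp add: countable_rat)
    qed
  qed
  have polP: "polish_space_in P" unfolding P_def by (rule polish_prod_topology[OF polT polR])
  have neXX: "topspace (prod_topology X X) \<noteq> {}" using neX by simp
  have tT: "topspace (TDS m) = {T. T \<in> extensional (topspace X) \<and> continuous_map X X T}"
    unfolding TDS topspace_mtopology_of using mem_cfunspace_compact[OF cX, of _ m] by (auto simp: X_def simp del: mspace_cfunspace)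
  have tR: "topspace R = {\<rho>. \<rho> \<in> extensional (topspace (prod_topology X X)) \<and> continuous_map (prod_topology X X) euclidean \<rho>}"
    unfolding R_def topspace_mtopology_of using mem_cfunspace_compact[OF cXX, of _ "euclidean_metric :: real metric"]
    by (auto simp del: mspace_cfunspace)
  \<comment> \<open>Evaluation is jointly continuous in the function and the point.\<close>
  have iter: "continuous_map Q X (\<lambda>q. (t q ^^ i) (g q))"
    if "continuous_map Q (TDS m) t" "continuous_map Q X g" for Q :: "'q topology" and t g i
  proof (induction i)
    case (Suc i)
    have "continuous_map Q X (\<lambda>q. t q ((t q ^^ i) (g q)))"
      using continuous_map_cfunspace_eval_compose[OF neX that(1)[unfolded TDS] Suc] by (simp add: X_def)
    then show ?case by simp
  qed (use that in simp)
  have rho: "continuous_map Q euclidean (\<lambda>q. s q (f q, g q))"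
    if "continuous_map Q R s" "continuous_map Q X f" "continuous_map Q X g" for Q :: "'q topology" and s f g
    using continuous_map_cfunspace_eval_compose[OF neXX that(1)[unfolded R_def] continuous_map_pairedI[OF that(2,3)]] by simp
  have fstP: "continuous_map P (TDS m) fst" and sndP: "continuous_map P R snd"
    unfolding P_def by (simp_all add: continuous_map_fst continuous_map_snd)
  have pt: "continuous_map Q X (\<lambda>q. x)" if "x \<in> topspace X" for Q :: "'q topology" and x using that by simp
  have ev1: "continuous_map P euclidean (\<lambda>p. snd p (x, y))" if "x \<in> topspace X" "y \<in> topspace X" for x y
    by (rule rho[OF sndP pt pt]) (use that in auto)
  let ?M = "borel_of P"
  define Z where "Z = {p \<in> topspace P. null_pseudometric X (fst p) (snd p)}"
  define N1 where "N1 p \<longleftrightarrow> (\<forall>x\<in>topspace X. \<forall>y\<in>topspace X. \<forall>z\<in>topspace X.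
     snd p (x, x) = 0 \<and> snd p (x, y) = snd p (y, x) \<and> snd p (x, z) \<le> snd p (x, y) + snd p (y, z))"
    for p :: "('a \<Rightarrow> 'a) \<times> ('a \<times> 'a \<Rightarrow> real)"
  define N2 where "N2 p \<longleftrightarrow> (\<exists>x\<in>topspace X. \<exists>y\<in>topspace X. snd p (x, y) > 0)"
    for p :: "('a \<Rightarrow> 'a) \<times> ('a \<times> 'a \<Rightarrow> real)"
  define N3 where "N3 j l p \<longleftrightarrow> (\<forall>x\<in>topspace X. \<forall>y\<in>topspace X.
     snd p (x, y) > inverse (real (Suc l)) \<or> snd p (fst p x, fst p y) < inverse (real (Suc j)))"
    for j l and p :: "('a \<Rightarrow> 'a) \<times> ('a \<times> 'a \<Rightarrow> real)"
  define N4 where "N4 j r n p \<longleftrightarrow> itinerary_cover X (fst p)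
        (pball (topspace X) (snd p) (inverse (real (Suc j))) ` topspace X) n (nat \<lfloor>exp (real n / real (Suc r))\<rfloor>)"
    for j r n and p :: "('a \<Rightarrow> 'a) \<times> ('a \<times> 'a \<Rightarrow> real)"
  define Z1 where "Z1 = {p \<in> topspace P. N1 p}"
  define Z2 where "Z2 = {p \<in> topspace P. N2 p}"
  define Z3 where "Z3 j l = {p \<in> topspace P. N3 j l p}" for j l
  define Z4 where "Z4 j r n = {p \<in> topspace P. N4 j r n p}" for j r n
  have "null_pseudometric X (fst p) (snd p) \<longleftrightarrow>
      N1 p \<and> N2 p \<and> (\<forall>j. \<exists>l. N3 j l p) \<and> (\<forall>j r. \<exists>n0. \<forall>n\<in>{n0..}. N4 j r n p)" for p
    unfolding null_pseudometric_def N1_def N2_def N3_def N4_def Ball_def atLeast_iff ..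
  then have Zeq: "Z = Z1 \<inter> Z2 \<inter> (\<Inter>j. \<Union>l. Z3 j l) \<inter> (\<Inter>j. \<Inter>r. \<Union>n0. \<Inter>n\<in>{n0..}. Z4 j r n)"
    unfolding Z_def Z1_def Z2_def Z3_def Z4_def by auto
  have Z1: "closedin P Z1"
  proof -
    define E where "E x y z = {p \<in> topspace P. snd p (x, x) = 0} \<inter> {p \<in> topspace P. snd p (x, y) = snd p (y, x)}
       \<inter> {p \<in> topspace P. snd p (x, z) \<le> snd p (x, y) + snd p (y, z)}" for x y z
    have E: "closedin P (E x y z)" if "x \<in> topspace X" "y \<in> topspace X" "z \<in> topspace X" for x y z
    proof -
      have 1: "closedin P {p \<in> topspace P. snd p (x, x) \<in> {0}}"
        by (rule closedin_continuous_map_preimage[OF ev1]) (use that in auto)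
      have "continuous_map P euclidean (\<lambda>p. snd p (x, y) - snd p (y, x))"
        by (intro continuous_map_diff ev1 that)
      then have 2: "closedin P {p \<in> topspace P. snd p (x, y) - snd p (y, x) \<in> {0}}"
        by (rule closedin_continuous_map_preimage) auto
      have "continuous_map P euclidean (\<lambda>p. snd p (x, z) - (snd p (x, y) + snd p (y, z)))"
        by (intro continuous_map_diff continuous_map_add ev1 that)
      then have 3: "closedin P {p \<in> topspace P. snd p (x, z) - (snd p (x, y) + snd p (y, z)) \<in> {..0}}"
        by (rule closedin_continuous_map_preimage) auto
      show ?thesis unfolding E_def by (intro closedin_Int) (use 1 2 3 in \<open>simp_all add: algebra_simps\<close>)
    qed
    have "Z1 = (\<Inter>x\<in>topspace X. \<Inter>y\<in>topspace X. \<Inter>z\<in>topspace X. E x y z)"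
    proof (intro equalityI subsetI)
      fix p assume "p \<in> Z1"
      then show "p \<in> (\<Inter>x\<in>topspace X. \<Inter>y\<in>topspace X. \<Inter>z\<in>topspace X. E x y z)"
        by (simp add: Z1_def N1_def E_def)
    next
      fix p assume p: "p \<in> (\<Inter>x\<in>topspace X. \<Inter>y\<in>topspace X. \<Inter>z\<in>topspace X. E x y z)"
      obtain x where "x \<in> topspace X" using neX by blast
      have pE: "p \<in> E x y z" if "x \<in> topspace X" "y \<in> topspace X" "z \<in> topspace X" for x y z
        using p that by blast
      have "p \<in> topspace P" using pE[OF \<open>x \<in> topspace X\<close> \<open>x \<in> topspace X\<close> \<open>x \<in> topspace X\<close>] by (simp add: E_def)
      moreover have "N1 p" using pE unfolding N1_def by (simp add: E_def)
      ultimately show "p \<in> Z1" by (simp add: Z1_def)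
    qed
    then show ?thesis using neX E by (auto intro!: closedin_INT)
  qed
  have Z2: "openin P Z2"
  proof -
    have E: "openin P {p \<in> topspace P. snd p (x, y) \<in> {0<..}}" if "x \<in> topspace X" "y \<in> topspace X" for x y
      by (rule openin_continuous_map_preimage[OF ev1[OF that]]) auto
    have "Z2 = (\<Union>x\<in>topspace X. \<Union>y\<in>topspace X. {p \<in> topspace P. snd p (x, y) \<in> {0<..}})"
      unfolding Z2_def N2_def by auto
    then show ?thesis using E by auto
  qed
  have Z3: "openin P (Z3 j l)" for j l
  proof -
    define Q where "Q = prod_topology P (prod_topology X X)"
    have a: "continuous_map Q (TDS m) (fst \<circ> fst)" "continuous_map Q R (snd \<circ> fst)"
      unfolding Q_def by (auto intro: continuous_map_compose[OF continuous_map_fst] fstP sndP)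
    have b: "continuous_map Q X (fst \<circ> snd)" "continuous_map Q X (snd \<circ> snd)"
      unfolding Q_def by (auto intro: continuous_map_compose[OF continuous_map_snd] continuous_map_fst continuous_map_snd)
    have "continuous_map Q euclidean (\<lambda>q. (snd \<circ> fst) q ((fst \<circ> snd) q, (snd \<circ> snd) q))"
      by (rule rho[OF a(2) b])
    then have 1: "openin Q {q \<in> topspace Q. (snd \<circ> fst) q ((fst \<circ> snd) q, (snd \<circ> snd) q) \<in> {inverse (real (Suc l))<..}}"
      by (rule openin_continuous_map_preimage) auto
    have "continuous_map Q euclidean (\<lambda>q. (snd \<circ> fst) q (((fst \<circ> fst) q ^^ 1) ((fst \<circ> snd) q), ((fst \<circ> fst) q ^^ 1) ((snd \<circ> snd) q)))"
      by (rule rho[OF a(2) iter[OF a(1) b(1)] iter[OF a(1) b(2)]])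
    then have 2: "openin Q {q \<in> topspace Q. (snd \<circ> fst) q (((fst \<circ> fst) q ^^ 1) ((fst \<circ> snd) q), ((fst \<circ> fst) q ^^ 1) ((snd \<circ> snd) q)) \<in> {..<inverse (real (Suc j))}}"
      by (rule openin_continuous_map_preimage) auto
    from openin_Ball_compact[OF cXX openin_Un[OF 1 2, unfolded Q_def]]
    show ?thesis by (rule back_subst[of "openin P"]) (auto simp: Z3_def N3_def)
  qed
  have Z4: "openin P (Z4 j r n)" for j r n
  proof -
    define e where "e = inverse (real (Suc j))"
    define k where "k = nat \<lfloor>exp (real n / real (Suc r))\<rfloor>"
    define \<G> where "\<G> = {G. finite G \<and> card G \<le> k \<and> G \<subseteq> {..<n} \<rightarrow> topspace X}"
    define O' where "O' G = {p \<in> topspace P. \<forall>x\<in>topspace X. \<exists>c\<in>G. \<forall>i<n. (fst p ^^ i) x \<in> pball (topspace X) (snd p) e (c i)}" for G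
    have "Z4 j r n = (\<Union>G\<in>\<G>. O' G)"
      unfolding Z4_def N4_def itinerary_cover_image_iff e_def[symmetric] k_def[symmetric] O'_def \<G>_def by blast
    moreover have "openin P (O' G)" if G: "G \<in> \<G>" for G
    proof -
      define Q where "Q = prod_topology P X"
      have a: "continuous_map Q (TDS m) (fst \<circ> fst)" "continuous_map Q R (snd \<circ> fst)"
        unfolding Q_def by (auto intro: continuous_map_compose[OF continuous_map_fst] fstP sndP)
      have b: "continuous_map Q X snd" unfolding Q_def by (rule continuous_map_snd)
      define V where "V c i = {q \<in> topspace Q. (snd \<circ> fst) q (((fst \<circ> fst) q ^^ i) (snd q), c i) \<in> {..<e}}" for c :: "nat \<Rightarrow> 'a" and i
      have V: "openin Q (V c i)" if "c \<in> G" "i < n" for c i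
      proof -
        have "c i \<in> topspace X" using G that by (auto simp: \<G>_def Pi_iff)
        then have "continuous_map Q euclidean (\<lambda>q. (snd \<circ> fst) q (((fst \<circ> fst) q ^^ i) (snd q), c i))"
          by (intro rho[OF a(2) iter[OF a(1) b]] pt)
        then show ?thesis unfolding V_def by (rule openin_continuous_map_preimage) auto
      qed
      have "openin Q (\<Union>c\<in>G. topspace Q \<inter> (\<Inter>i\<in>{..<n}. V c i))"
      proof (intro openin_Union ballI, elim imageE)
        fix W c assume W: "W = topspace Q \<inter> (\<Inter>i\<in>{..<n}. V c i)" "c \<in> G"
        show "openin Q W"
        proof (cases "n = 0")
          case False
          then show ?thesis unfolding W(1) using V[OF W(2)] by (intro openin_Int openin_INT2) auto
        qed (simp add: W(1))
      qed
      from openin_Ball_compact[OF cX this[unfolded Q_def]]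
      show ?thesis
      proof (rule back_subst[of "openin P"])
        have T: "continuous_map X X (fst p)" if p: "p \<in> topspace P" for p
        proof -
          have "fst p \<in> topspace (TDS m)" using p by (simp add: P_def mem_Times_iff)
          then show ?thesis unfolding tT by blast
        qed
        have mem: "(p, x) \<in> V c i \<longleftrightarrow> (fst p ^^ i) x \<in> pball (topspace X) (snd p) e (c i)"
          if "p \<in> topspace P" "x \<in> topspace X" for p x c i
          using that funpow_mem[OF T[OF that(1)] that(2), of i] by (simp add: V_def pball_def Q_def)
        show "{p \<in> topspace P. \<forall>x\<in>topspace X. (p, x) \<in> (\<Union>c\<in>G. topspace (prod_topology P X) \<inter> (\<Inter>i\<in>{..<n}. V c i))} = O' G"
          unfolding O'_def
        proof (intro Collect_cong conj_cong refl ball_cong)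
          fix p x assume "p \<in> topspace P" "x \<in> topspace X"
          note mem' = mem[OF this] and this
          then show "(p, x) \<in> (\<Union>c\<in>G. topspace (prod_topology P X) \<inter> (\<Inter>i\<in>{..<n}. V c i)) \<longleftrightarrow>
            (\<exists>c\<in>G. \<forall>i<n. (fst p ^^ i) x \<in> pball (topspace X) (snd p) e (c i))"
            by (simp add: mem' Ball_def[of "{..<n}"])
        qed
      qed
    qed
    ultimately show ?thesis by auto
  qed
  have "Z \<in> sets ?M"
  proof -
    have "Z1 \<in> sets ?M" "Z2 \<in> sets ?M" "\<And>j l. Z3 j l \<in> sets ?M" "\<And>j r n. Z4 j r n \<in> sets ?M"
      using Z1 Z2 Z3 Z4 by (auto intro: borel_of_openin borel_of_closedin)
    then show ?thesis unfolding Zeq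
      by (intro sets.Int sets.countable_INT'' sets.countable_UN sets.countable_INT' ) auto
  qed
  moreover have "continuous_map (subtopology P Z) (TDS m) fst"
    by (rule continuous_map_from_subtopology[OF fstP])
  ultimately have "analytic_in (TDS m) (fst ` Z)" using polP by (intro analytic_inI)
  moreover have "fst ` Z = topspace (TDS m) - CPE m"
  proof (intro equalityI subsetI)
    fix T assume "T \<in> fst ` Z"
    then obtain \<rho> where Tr: "T \<in> topspace (TDS m)" "\<rho> \<in> topspace R" "null_pseudometric X T \<rho>"
      by (auto simp: Z_def P_def)
    have "is_tds X T" using Tr(1) cX mX tT by (simp add: is_tds_def)
    moreover have "continuous_map (prod_topology X X) euclidean \<rho>" using Tr(2) tR by blast
    ultimately have "\<not> has_cpe X T" using null_pseudometric_imp_not_cpe Tr(3) by blast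
    then show "T \<in> topspace (TDS m) - CPE m" using Tr(1) by (simp add: CPE_def X_def)
  next
    fix T assume T: "T \<in> topspace (TDS m) - CPE m"
    then have "\<not> has_cpe X T" by (simp add: CPE_def X_def)
    moreover have "is_tds X T" using T cX mX tT by (simp add: is_tds_def)
    ultimately obtain \<rho> where "\<rho> \<in> topspace R" "null_pseudometric X T \<rho>"
      using not_cpe_imp_null_pseudometric[OF _ neX] unfolding R_def topspace_mtopology_of by blast
    then show "T \<in> fst ` Z" using T by (intro image_eqI[of _ _ "(T, \<rho>)"]) (auto simp: Z_def P_def)
  qed
  ultimately show ?thesis unfolding coanalytic_in_def by (auto simp: CPE_def)
qed

section \<open>Analytic sets and infinite cliques\<close>

text \<open>
  Sequences of reals serve as the parameter space because their type is already a Polish space; the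
  proofs use them like sequences of natural numbers.
\<close>

definition closed_projection :: "'a topology \<Rightarrow> 'a set \<Rightarrow> bool" where
  "closed_projection Z B \<longleftrightarrow>
     (\<exists>C. closedin (prod_topology Z (euclidean :: (nat \<Rightarrow> real) topology)) C \<and> fst ` C = B)"

lemma closed_projection_closed:
  assumes "closedin Z F"
  shows "closed_projection Z F"
  unfolding closed_projection_def
  by (rule exI[of _ "F \<times> UNIV"]) (use assms in \<open>simp add: closedin_prod_Times_iff\<close>)

lemma closed_projection_reindex:
  assumes "closedin (prod_topology Z (euclidean :: (nat \<Rightarrow> real) topology)) C"
  shows "closedin (prod_topology Z (euclidean :: (nat \<Rightarrow> real) topology))
    {p \<in> topspace (prod_topology Z euclidean). (fst p, snd p \<circ> h) \<in> C}"
proof -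
  have "continuous_on UNIV (\<lambda>x::nat \<Rightarrow> real. x \<circ> h)"
    unfolding comp_def by (intro continuous_on_coordinatewise_then_product continuous_on_product_coordinates)
  then have h: "continuous_map euclidean euclidean (\<lambda>x::nat \<Rightarrow> real. x \<circ> h)" by simp
  have "continuous_map (prod_topology Z euclidean) (prod_topology Z (euclidean :: (nat \<Rightarrow> real) topology)) (\<lambda>p. (fst p, snd p \<circ> h))"
    by (intro continuous_map_pairedI continuous_map_fst continuous_map_compose[OF continuous_map_snd h, unfolded comp_def[of "\<lambda>x. x \<circ> h"]])
  then show ?thesis using assms by (rule closedin_continuous_map_preimage)
qed

text \<open>
  The first entry of the sequence selects the index \<open>i\<close>. The resulting set is closed because the
  admissible values \<open>real i\<close> are at distance at least \<open>1\<close> from each other.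
\<close>

lemma closed_projection_Union:
  assumes "\<And>i::nat. closed_projection Z (B i)"
  shows "closed_projection Z (\<Union>i. B i)"
proof -
  let ?P = "prod_topology Z (euclidean :: (nat \<Rightarrow> real) topology)"
  obtain C where C: "\<And>i. closedin ?P (C i)" "\<And>i. fst ` C i = B i"
    using assms unfolding closed_projection_def by metis
  define pre where "pre i = {p \<in> topspace ?P. (fst p, snd p \<circ> Suc) \<in> C i}" for i
  define away where "away i = {p \<in> topspace ?P. snd p 0 \<in> {t::real. 1 \<le> \<bar>t - real i\<bar>}}" for i
  define nat0 where "nat0 = {p \<in> topspace ?P. snd p 0 \<in> (\<nat> :: real set)}"
  have "continuous_map euclidean euclidean (\<lambda>x::nat \<Rightarrow> real. x 0)"
    by (simp add: continuous_on_product_coordinates)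
  from continuous_map_compose[OF continuous_map_snd this]
  have c0: "continuous_map ?P euclidean (\<lambda>p. snd p 0)" by (simp add: comp_def)
  have "closed {t::real. 1 \<le> \<bar>t - real i\<bar>}" for i
    by (intro closed_Collect_le continuous_intros)
  then have away: "closedin ?P (away i)" for i
    unfolding away_def by (intro closedin_continuous_map_preimage[OF c0]) simp
  have nat0: "closedin ?P nat0"
    unfolding nat0_def by (intro closedin_continuous_map_preimage[OF c0]) (simp add: closed_Nats)
  have pre: "closedin ?P (pre i)" for i
    unfolding pre_def by (rule closed_projection_reindex[OF C(1)])
  define D where "D = nat0 \<inter> (\<Inter>i. away i \<union> pre i)"
  have "closedin ?P D" unfolding D_def
    by (intro closedin_Int nat0 closedin_INT closedin_Un away pre) auto
  moreover have "fst ` D = (\<Union>i. B i)"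
  proof (intro equalityI subsetI)
    fix z assume "z \<in> fst ` D"
    then obtain x where x: "(z, x) \<in> D" by auto
    then obtain i where i: "x 0 = real i" by (auto simp: D_def nat0_def Nats_def)
    have "(z, x) \<notin> away i" using i by (simp add: away_def)
    then have "(z, x \<circ> Suc) \<in> C i" using x by (auto simp: D_def pre_def)
    then show "z \<in> (\<Union>i. B i)" using C(2)[of i] by (metis UN_I UNIV_I fst_conv imageI)
  next
    fix z assume "z \<in> (\<Union>i. B i)"
    then obtain i where "z \<in> B i" by blast
    then have "z \<in> fst ` C i" by (simp only: C(2))
    then obtain x where x: "(z, x) \<in> C i" by auto
    then have z: "z \<in> topspace Z" using closedin_subset[OF C(1)[of i]] by auto
    define y where "y = case_nat (real i) x"
    have y: "y 0 = real i" "y \<circ> Suc = x" by (auto simp: y_def)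
    have "(z, y) \<in> away j \<union> pre j" for j
    proof (cases "j = i")
      case False
      then have "1 \<le> \<bar>real i - real j\<bar>" by (cases "i < j") auto
      then show ?thesis using z y by (simp add: away_def)
    qed (use x y z in \<open>simp add: pre_def\<close>)
    then have "(z, y) \<in> D" using z y by (simp add: D_def nat0_def)
    then show "z \<in> fst ` D" by force
  qed
  ultimately show ?thesis unfolding closed_projection_def by blast
qed

text \<open>
  One sequence codes a sequence of witnesses through a pairing function.
\<close>

lemma closed_projection_Inter:
  assumes "\<And>i::nat. closed_projection Z (B i)"
  shows "closed_projection Z (\<Inter>i. B i)"
proof -
  let ?P = "prod_topology Z (euclidean :: (nat \<Rightarrow> real) topology)"
  obtain C where C: "\<And>i. closedin ?P (C i)" "\<And>i. fst ` C i = B i"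
    using assms unfolding closed_projection_def by metis
  define D where "D = (\<Inter>i. {p \<in> topspace ?P. (fst p, snd p \<circ> (\<lambda>n. prod_encode (i, n))) \<in> C i})"
  have "closedin ?P D" unfolding D_def
    by (intro closedin_INT closed_projection_reindex C(1)) auto
  moreover have "fst ` D = (\<Inter>i. B i)"
  proof (intro equalityI subsetI)
    fix z assume "z \<in> fst ` D"
    then obtain x where x: "(z, x) \<in> D" by auto
    have "z \<in> B i" for i
    proof -
      have "(z, x \<circ> (\<lambda>n. prod_encode (i, n))) \<in> C i" using x by (simp add: D_def)
      then show ?thesis using C(2)[of i] by (metis fst_conv imageI)
    qed
    then show "z \<in> (\<Inter>i. B i)" by blast
  next
    fix z assume z: "z \<in> (\<Inter>i. B i)"
    have "\<exists>x. (z, x) \<in> C i" for i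
    proof -
      have "z \<in> fst ` C i" using z C(2)[of i] by blast
      then show ?thesis by auto
    qed
    then obtain x where x: "\<And>i. (z, x i) \<in> C i" by metis
    define y where "y = (\<lambda>k. x (fst (prod_decode k)) (snd (prod_decode k)))"
    have y: "y \<circ> (\<lambda>n. prod_encode (i, n)) = x i" for i by (auto simp: y_def)
    have zZ: "z \<in> topspace Z" using closedin_subset[OF C(1)[of 0]] x[of 0] by auto
    have "(z, y) \<in> D" using zZ x by (simp add: D_def y)
    then show "z \<in> fst ` D" by force
  qed
  ultimately show ?thesis unfolding closed_projection_def by blast
qed

text \<open>
  Open sets are countable unions of closed sets, so the sets that are projections together with their
  complements form a sigma-algebra that contains them.
\<close>

lemma closed_projection_borel:
  assumes Z: "metrizable_space Z" and B: "B \<in> sets (borel_of Z)"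
  shows "closed_projection Z B"
proof -
  have op: "closed_projection Z U" if "openin Z U" for U
  proof -
    have "fsigma_in Z U" using Z that by (rule open_imp_fsigma_in)
    then obtain C where "\<And>n::nat. closedin Z (C n)" "\<Union>(range C) = U"
      unfolding fsigma_in_ascending by blast
    then show ?thesis using closed_projection_Union[of Z C] closed_projection_closed by blast
  qed
  have "B \<in> sigma_sets (topspace Z) {U. openin Z U}" using B by (simp add: sets_borel_of)
  then have "closed_projection Z B \<and> closed_projection Z (topspace Z - B)"
  proof (induction rule: sigma_sets.induct)
    case (Basic U)
    then show ?case using op by (simp add: closed_projection_closed closedin_diff)
  next
    case Empty
    then show ?case by (simp add: closed_projection_closed)
  next
    case (Compl A)
    have "A \<subseteq> topspace Z" using sigma_sets_into_sp[OF _ Compl.hyps] openin_subset by blast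
    then show ?case using Compl.IH by (simp add: double_diff)
  next
    case (Union A)
    have "topspace Z - (\<Union>i. A i) = (\<Inter>i. topspace Z - A i)" by blast
    then show ?case using Union.IH closed_projection_Union[of Z A] closed_projection_Inter[of Z "\<lambda>i. topspace Z - A i"] by simp
  qed
  then show ?thesis ..
qed

lemma polish_seq_real: "polish_space_in (euclidean :: (nat \<Rightarrow> real) topology)"
proof -
  obtain B :: "(nat \<Rightarrow> real) set set" where B: "countable B" "topological_basis B" using ex_countable_basis by blast
  have "second_countable (euclidean :: (nat \<Rightarrow> real) topology)"
    unfolding second_countable_def
  proof (intro exI[of _ B] conjI ballI allI impI)
    show "openin euclidean V" if "V \<in> B" for V using B(2) that by (simp add: topological_basis_open)
    show "\<exists>V\<in>B. x \<in> V \<and> V \<subseteq> U" if "openin euclidean U \<and> x \<in> U" for U x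
      using topological_basisE[OF B(2), of U x] that by auto
  qed (rule B(1))
  then show ?thesis
    by (simp add: polish_space_in_def completely_metrizable_space_euclidean second_countable_imp_separable_space)
qed

lemma analytic_continuous_image_polish:
  assumes "analytic_in Y A"
  shows "\<exists>(W :: (real \<times> (nat \<Rightarrow> real)) topology) g. polish_space_in W \<and> continuous_map W Y g \<and> g ` topspace W = A"
proof -
  obtain Z :: "real topology" and B f where Z: "polish_space_in Z" "B \<in> sets (borel_of Z)"
    "continuous_map (subtopology Z B) Y f" "f ` B = A"
    using assms unfolding analytic_in_def by blast
  let ?P = "prod_topology Z (euclidean :: (nat \<Rightarrow> real) topology)"
  have "metrizable_space Z" using Z(1) by (simp add: polish_space_in_def completely_metrizable_imp_metrizable_space)
  then obtain C where C: "closedin ?P C" "fst ` C = B"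
    using closed_projection_borel Z(2) unfolding closed_projection_def by blast
  define W where "W = subtopology ?P C"
  have tW: "topspace W = C" using closedin_subset[OF C(1)] by (auto simp: W_def)
  have "polish_space_in W"
    unfolding W_def by (intro polish_closed_subspace polish_prod_topology Z(1) polish_seq_real C(1))
  moreover have "continuous_map W (subtopology Z B) fst"
    unfolding continuous_map_in_subtopology
  proof
    show "continuous_map W Z fst" unfolding W_def by (intro continuous_map_from_subtopology continuous_map_fst)
  qed (use tW C(2) in auto)
  then have "continuous_map W Y (f \<circ> fst)" using Z(3) by (rule continuous_map_compose)
  moreover have "(f \<circ> fst) ` topspace W = A" using tW C(2) Z(4) by (metis image_comp)
  ultimately show ?thesis by blast
qed

text \<open>
  A vertex of the graph codes a level \<open>n\<close> and a point of a dense sequence, the centre of a ball of radius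
  \<open>2 ^ (- n)\<close>. Edges between different vertices join centres, at different levels, whose balls are close enough to come from one
  point. An infinite clique meets arbitrarily high levels, so its centres form a Cauchy sequence. The
  requirement that \<open>y\<close> lies in the closure of the image of each ball forces \<open>y\<close> to be the image of the limit.
\<close>

lemma continuous_image_polish_clique:
  fixes W :: "'w topology" and Y :: "'y topology"
  assumes W: "polish_space_in W" and Y: "Hausdorff_space Y" and g: "continuous_map W Y g"
  shows "\<exists>R :: nat \<Rightarrow> nat \<Rightarrow> 'y set. (\<forall>i j. closedin Y (R i j)) \<and>
    (\<forall>y\<in>topspace Y. y \<in> g ` topspace W \<longleftrightarrow> (\<exists>N. infinite N \<and> (\<forall>i\<in>N. \<forall>j\<in>N. y \<in> R i j)))"
proof (cases "topspace W = {}")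
  case True
  have "N = {}" if "\<forall>i\<in>N. \<forall>j\<in>N. y \<in> {}" for N :: "nat set" and y :: 'y using that by blast
  then have "\<not> (\<exists>N::nat set. infinite N \<and> (\<forall>i\<in>N. \<forall>j\<in>N. y \<in> {}))" for y :: 'y by (metis finite.emptyI)
  then show ?thesis using True by (intro exI[of _ "\<lambda>_ _. {}"] conjI allI ballI) simp_all
next
  case False
  obtain M d where Md: "Metric_space M d" "W = Metric_space.mtopology M d" "Metric_space.mcomplete M d"
    using W unfolding polish_space_in_def completely_metrizable_space_def by blast
  interpret Metric_space M d by fact
  have tW: "topspace W = M" using Md(2) by simp
  obtain D where D: "countable D" "D \<subseteq> M" "mtopology closure_of D = M"
    using W Md(2) tW by (auto simp: polish_space_in_def separable_space_def)
  have "D \<noteq> {}" using D(3) False tW by auto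
  define c where "c = from_nat_into D"
  have cM: "c k \<in> M" for k using from_nat_into[OF \<open>D \<noteq> {}\<close>] D(2) by (auto simp: c_def)
  have dense: "\<exists>k. d x (c k) < e" if "x \<in> M" "e > 0" for x e
  proof -
    have "x \<in> mtopology closure_of D" using that(1) D(3) by simp
    then have "\<exists>z\<in>D. z \<in> mball x e" using that(2) unfolding metric_closure_of by blast
    then obtain z where "z \<in> D" "d x z < e" by auto
    then show ?thesis using from_nat_into_surj[OF D(1)] unfolding c_def by metis
  qed
  define lev pt where "lev i = fst (prod_decode i)" and "pt i = c (snd (prod_decode i))" for i
  \<comment> \<open>Vertices at the same level are never joined, so a clique has at most one vertex per level.\<close>
  define F where "F i = Y closure_of (g ` mball (pt i) ((1/2) ^ lev i))" for i
  define ok where "ok i j \<longleftrightarrow> (lev i = lev j \<longrightarrow> i = j) \<and> d (pt i) (pt j) < (1/2) ^ lev i + (1/2) ^ lev j" for i j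
  define R where "R i j = (if ok i j then F i else {})" for i j
  have ptM: "pt i \<in> M" for i by (simp add: pt_def cM)
  have "y \<in> g ` M \<longleftrightarrow> (\<exists>N. infinite N \<and> (\<forall>i\<in>N. \<forall>j\<in>N. y \<in> R i j))" if y: "y \<in> topspace Y" for y
  proof
    assume "y \<in> g ` M"
    then obtain w where w: "w \<in> M" "y = g w" by blast
    have "\<exists>k. d w (c k) < (1/2) ^ n" for n :: nat by (rule dense[OF w(1)]) simp
    then obtain \<kappa> where \<kappa>: "\<And>n::nat. d w (c (\<kappa> n)) < (1/2) ^ n" by metis
    define e where "e n = prod_encode (n, \<kappa> n)" for n
    have le: "lev (e n) = n" and pe: "pt (e n) = c (\<kappa> n)" for n by (simp_all add: lev_def pt_def e_def)
    have "inj e" by (rule inj_on_inverseI[of _ lev]) (simp add: le)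
    have "y \<in> R (e n) (e m)" for n m
    proof -
      have "d (c (\<kappa> n)) (c (\<kappa> m)) \<le> d (c (\<kappa> n)) w + d w (c (\<kappa> m))" using cM w(1) by (intro triangle)
      also have "\<dots> < (1/2) ^ n + (1/2) ^ m" using \<kappa>[of n] \<kappa>[of m] by (simp add: commute)
      finally have "ok (e n) (e m)" by (simp add: ok_def le pe)
      moreover have "w \<in> mball (pt (e n)) ((1/2) ^ n)" using \<kappa>[of n] cM w(1) by (simp add: pe commute)
      then have "y \<in> g ` mball (pt (e n)) ((1/2) ^ lev (e n))" unfolding w(2) le by (rule imageI)
      then have "y \<in> F (e n)" unfolding F_def using y by (metis IntI closure_of_subset_Int subsetD)
      ultimately show ?thesis by (simp add: R_def)
    qed
    then show "\<exists>N. infinite N \<and> (\<forall>i\<in>N. \<forall>j\<in>N. y \<in> R i j)"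
      using range_inj_infinite[OF \<open>inj e\<close>] by (intro exI[of _ "range e"]) auto
  next
    assume "\<exists>N. infinite N \<and> (\<forall>i\<in>N. \<forall>j\<in>N. y \<in> R i j)"
    then obtain N where N: "infinite N" "\<And>i j. i \<in> N \<Longrightarrow> j \<in> N \<Longrightarrow> y \<in> R i j" by blast
    have ok: "ok i j" and yF: "y \<in> F i" if "i \<in> N" "j \<in> N" for i j
      using N(2)[OF that] by (auto simp: R_def split: if_splits)
    have "inj_on lev N" using ok by (auto simp: inj_on_def ok_def)
    then have "infinite (lev ` N)" using N(1) finite_imageD by blast
    then have "\<exists>i. i \<in> N \<and> n \<le> lev i" for n
      unfolding infinite_nat_iff_unbounded_le by blast
    then obtain s where s: "\<And>n. s n \<in> N" "\<And>n. n \<le> lev (s n)" by metis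
    define x where "x n = pt (s n)" for n
    have half: "(1/2::real) ^ lev (s n) \<le> (1/2) ^ n" for n by (rule power_decreasing) (use s in auto)
    have dx: "d (x n) (x m) < (1/2) ^ n + (1/2) ^ m" for n m
    proof -
      have "d (x n) (x m) < (1/2) ^ lev (s n) + (1/2) ^ lev (s m)"
        using ok[OF s(1)[of n] s(1)[of m]] by (simp only: ok_def x_def)
      then show ?thesis using half[of n] half[of m] by linarith
    qed
    have "MCauchy x"
      unfolding MCauchy_def
    proof (intro conjI allI impI)
      show "range x \<subseteq> M" using ptM by (auto simp: x_def)
      fix e :: real assume "e > 0"
      then obtain k where k: "(1/2::real) ^ k < e / 2" using real_arch_pow_inv[of "e/2" "1/2"] by auto
      have "d (x n) (x m) < e" if "k \<le> n" "k \<le> m" for n m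
      proof -
        have "(1/2::real) ^ n \<le> (1/2) ^ k" "(1/2::real) ^ m \<le> (1/2) ^ k"
          using that by (auto intro!: power_decreasing)
        then show ?thesis using dx[of n m] k by linarith
      qed
      then show "\<exists>N. \<forall>n n'. N \<le> n \<longrightarrow> N \<le> n' \<longrightarrow> d (x n) (x n') < e" by blast
    qed
    then obtain w where w: "limitin mtopology x w sequentially" using Md(3) by (auto simp: mcomplete_def)
    then have wM: "w \<in> M" by (rule limitin_mspace)
    have "y = g w"
    proof (rule ccontr)
      assume "y \<noteq> g w"
      moreover have "g w \<in> topspace Y" using continuous_map_funspace[OF g] wM tW by auto
      ultimately obtain V V2 where V: "openin Y V" "g w \<in> V" "openin Y V2" "y \<in> V2" "disjnt V V2"
        using Y[unfolded Hausdorff_space_def, rule_format, of "g w" y] y by blast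
      have yV: "y \<notin> Y closure_of V" using V(3-5) unfolding in_closure_of disjnt_def by blast
      have "openin mtopology {z \<in> topspace W. g z \<in> V}" using openin_continuous_map_preimage[OF g V(1)] by (simp only: Md(2))
      moreover have "w \<in> {z \<in> topspace W. g z \<in> V}" using wM tW V(2) by simp
      ultimately obtain r where r: "r > 0" "mball w r \<subseteq> {z \<in> topspace W. g z \<in> V}"
        unfolding openin_mtopology by blast
      obtain k where k: "(1/2::real) ^ k < r / 2" using real_arch_pow_inv[of "r/2" "1/2"] r(1) by auto
      have "\<forall>\<^sub>F n in sequentially. x n \<in> M \<and> d (x n) w < r / 2"
        using w half_gt_zero[OF r(1)] unfolding limitin_metric by blast
      then have "\<forall>\<^sub>F n in sequentially. (x n \<in> M \<and> d (x n) w < r / 2) \<and> k \<le> n"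
        using eventually_ge_at_top[of k] by (rule eventually_conj)
      then obtain n where n: "d (x n) w < r / 2" "k \<le> n" by (auto simp: eventually_sequentially)
      have "(1/2::real) ^ lev (s n) \<le> (1/2) ^ k" by (rule power_decreasing) (use s(2)[of n] n(2) in auto)
      then have hn: "(1/2::real) ^ lev (s n) < r / 2" using k by (rule order_le_less_trans)
      have "mball (pt (s n)) ((1/2) ^ lev (s n)) \<subseteq> mball w r"
      proof
        fix z assume z: "z \<in> mball (pt (s n)) ((1/2) ^ lev (s n))"
        then have "d w z \<le> d w (x n) + d (x n) z" using wM ptM by (intro triangle) (auto simp: x_def)
        then show "z \<in> mball w r" using z n(1) hn wM by (auto simp: x_def commute)
      qed
      then have "g ` mball (pt (s n)) ((1/2) ^ lev (s n)) \<subseteq> V" using r(2) by blast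
      then have "F (s n) \<subseteq> Y closure_of V" unfolding F_def by (rule closure_of_mono)
      then show False using yF[OF s(1) s(1)] yV by blast
    qed
    then show "y \<in> g ` M" using wM by blast
  qed
  moreover have "closedin Y (R i j)" for i j by (simp add: R_def F_def)
  ultimately show ?thesis using tW by (intro exI[of _ R]) simp
qed

lemma analytic_clique:
  assumes "analytic_in Y A" "Hausdorff_space Y"
  shows "\<exists>R :: nat \<Rightarrow> nat \<Rightarrow> _ set. (\<forall>i j. closedin Y (R i j)) \<and>
    (\<forall>y\<in>topspace Y. y \<in> A \<longleftrightarrow> (\<exists>N. infinite N \<and> (\<forall>i\<in>N. \<forall>j\<in>N. y \<in> R i j)))"
  using analytic_continuous_image_polish[OF assms(1)] continuous_image_polish_clique[OF _ assms(2)] by metis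

section \<open>Cantor functions of uncountable sets\<close>

text \<open>
  Otherwise the supremum \<open>s\<close> of the points with only countably many elements of \<open>K\<close> to their left would have
  only countably many elements of \<open>K\<close> on both sides.
\<close>

lemma uncountable_interval_split:
  fixes K :: "real set"
  assumes unc: "uncountable (K \<inter> {x<..<y})"
  shows "\<exists>z. uncountable (K \<inter> {x<..<z}) \<and> uncountable (K \<inter> {z<..<y})"
proof (rule ccontr)
  assume H: "\<not> (\<exists>z. uncountable (K \<inter> {x<..<z}) \<and> uncountable (K \<inter> {z<..<y}))"
  define L where "L = {z. x \<le> z \<and> z \<le> y \<and> countable (K \<inter> {x<..<z})}"
  have xy: "x < y"
  proof (rule ccontr)
    assume "\<not> x < y"
    then have "K \<inter> {x<..<y} = {}" by auto
    then show False using unc by simp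
  qed
  have "x \<in> L" using xy by (simp add: L_def)
  have bdd: "bdd_above L" by (rule bdd_aboveI[of _ y]) (simp add: L_def)
  define s where "s = Sup L"
  have xs: "x \<le> s" unfolding s_def using \<open>x \<in> L\<close> bdd by (rule cSup_upper)
  have sy: "s \<le> y" unfolding s_def
  proof (rule cSup_least)
    show "L \<noteq> {}" using \<open>x \<in> L\<close> by blast
    show "z \<le> y" if "z \<in> L" for z using that by (simp add: L_def)
  qed
  have "countable (K \<inter> {x<..<s})"
  proof -
    have "K \<inter> {x<..<s} \<subseteq> (\<Union>q\<in>{q\<in>\<rat>. q < s}. K \<inter> {x<..<q})"
    proof
      fix t assume t: "t \<in> K \<inter> {x<..<s}"
      then obtain q where "q \<in> \<rat>" "t < q" "q < s" using Rats_dense_in_real[of t s] by auto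
      then show "t \<in> (\<Union>q\<in>{q\<in>\<rat>. q < s}. K \<inter> {x<..<q})" using t by auto
    qed
    moreover have "countable (K \<inter> {x<..<q})" if qs: "q < s" for q
    proof -
      obtain z where z: "z \<in> L" "q < z"
        using less_cSupE[OF qs[unfolded s_def]] \<open>x \<in> L\<close> by blast
      then have "countable (K \<inter> {x<..<z})" by (simp add: L_def)
      then show ?thesis by (rule countable_subset[rotated]) (use z in auto)
    qed
    moreover have "countable {q\<in>\<rat>. q < s}" by (rule countable_subset[OF _ countable_rat]) auto
    ultimately show ?thesis by (elim countable_subset) (intro countable_UN, auto)
  qed
  moreover have "countable (K \<inter> {s<..<y})"
  proof -
    have "K \<inter> {s<..<y} \<subseteq> (\<Union>q\<in>{q\<in>\<rat>. s < q \<and> q < y}. K \<inter> {q<..<y})"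
    proof
      fix t assume t: "t \<in> K \<inter> {s<..<y}"
      then obtain q where "q \<in> \<rat>" "s < q" "q < t" using Rats_dense_in_real[of s t] by auto
      then show "t \<in> (\<Union>q\<in>{q\<in>\<rat>. s < q \<and> q < y}. K \<inter> {q<..<y})" using t by auto
    qed
    moreover have "countable (K \<inter> {q<..<y})" if "s < q" "q < y" for q
    proof -
      have "q \<notin> L" using that(1) cSup_upper[OF _ bdd, of q] unfolding s_def by auto
      then have "uncountable (K \<inter> {x<..<q})" using that xs by (simp add: L_def)
      then show ?thesis using H by blast
    qed
    moreover have "countable {q\<in>\<rat>. s < q \<and> q < y}" by (rule countable_subset[OF _ countable_rat]) auto
    ultimately show ?thesis by (elim countable_subset) (intro countable_UN, auto)
  qed
  ultimately have "countable (K \<inter> {x<..<s} \<union> {s} \<union> K \<inter> {s<..<y})" by simp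
  then have "countable (K \<inter> {x<..<y})" by (rule countable_subset[rotated]) auto
  then show False using unc by blast
qed

lemma continuous_on_mono_dense_values:
  fixes f :: "real \<Rightarrow> real"
  assumes mono: "\<And>s t. s \<in> {0..1} \<Longrightarrow> t \<in> {0..1} \<Longrightarrow> s \<le> t \<Longrightarrow> f s \<le> f t"
    and range: "\<And>t. t \<in> {0..1} \<Longrightarrow> f t \<in> {0..1}"
    and dense: "\<And>a b. 0 \<le> a \<Longrightarrow> a < b \<Longrightarrow> b \<le> 1 \<Longrightarrow> \<exists>t\<in>{0..1}. a < f t \<and> f t < b"
  shows "continuous_on {0..1} f"
proof -
  have "\<exists>\<delta>>0. \<forall>s\<in>{0..1}. \<bar>s - t\<bar> < \<delta> \<longrightarrow> \<bar>f s - f t\<bar> < e" if t: "t \<in> {0..1}" and e: "e > 0" for t e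
  proof -
    have "\<exists>\<delta>>0. \<forall>s\<in>{0..1}. t \<le> s \<and> s < t + \<delta> \<longrightarrow> f s < f t + e"
    proof (cases "f t < 1")
      case True
      obtain u where u: "u \<in> {0..1}" "f t < f u" "f u < min 1 (f t + e)"
        using dense[of "f t" "min 1 (f t + e)"] True e range[OF t] by auto
      have "t < u" using mono[OF u(1) t] u(2) by force
      moreover have "f s < f t + e" if "s \<in> {0..1}" "s < u" for s
        using mono[OF that(1) u(1)] that(2) u(3) by auto
      ultimately show ?thesis by (intro exI[of _ "u - t"]) auto
    next
      case False
      have "f s < f t + e" if "s \<in> {0..1}" for s using range[OF that] False e by auto
      then show ?thesis by (intro exI[of _ 1]) auto
    qed
    then obtain d1 where d1: "d1 > 0" "\<And>s. s \<in> {0..1} \<Longrightarrow> t \<le> s \<Longrightarrow> s < t + d1 \<Longrightarrow> f s < f t + e" by blast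
    have "\<exists>\<delta>>0. \<forall>s\<in>{0..1}. s \<le> t \<and> t - \<delta> < s \<longrightarrow> f t - e < f s"
    proof (cases "0 < f t")
      case True
      obtain u where u: "u \<in> {0..1}" "max 0 (f t - e) < f u" "f u < f t"
        using dense[of "max 0 (f t - e)" "f t"] True e range[OF t] by auto
      have "u < t" using mono[OF t u(1)] u(3) by force
      moreover have "f t - e < f s" if "s \<in> {0..1}" "u < s" for s
        using mono[OF u(1) that(1)] that(2) u(2) by auto
      ultimately show ?thesis by (intro exI[of _ "t - u"]) auto
    next
      case False
      have "f t - e < f s" if "s \<in> {0..1}" for s using range[OF that] False e by auto
      then show ?thesis by (intro exI[of _ 1]) auto
    qed
    then obtain d2 where d2: "d2 > 0" "\<And>s. s \<in> {0..1} \<Longrightarrow> s \<le> t \<Longrightarrow> t - d2 < s \<Longrightarrow> f t - e < f s" by blast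
    have "\<bar>f s - f t\<bar> < e" if s: "s \<in> {0..1}" "\<bar>s - t\<bar> < min d1 d2" for s
    proof (cases "t \<le> s")
      case True
      then show ?thesis using d1(2)[OF s(1)] mono[OF t s(1)] s(2) by auto
    next
      case False
      then show ?thesis using d2(2)[OF s(1)] mono[OF s(1) t] s(2) by auto
    qed
    then show ?thesis using d1(1) d2(1) by (intro exI[of _ "min d1 d2"]) auto
  qed
  then show ?thesis unfolding continuous_on_iff dist_real_def by blast
qed

lemma dyadic_between:
  fixes a b :: real
  assumes "0 \<le> a" "a < b" 
  shows "\<exists>r\<in>dyadics. a < r \<and> r < b"
proof -
  obtain k where k: "(1/2::real) ^ k < b - a" using real_arch_pow_inv[of "b - a" "1/2"] assms by auto
  define m where "m = nat \<lfloor>a * 2 ^ k\<rfloor> + 1"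
  have fl: "real (nat \<lfloor>a * 2 ^ k\<rfloor>) = of_int \<lfloor>a * 2 ^ k\<rfloor>" using assms by simp
  have "a * 2 ^ k < real m" "real m \<le> a * 2 ^ k + 1" unfolding m_def using fl by linarith+
  then have "a < real m / 2 ^ k" "real m / 2 ^ k \<le> a + (1/2) ^ k" by (simp_all add: field_simps power_divide)
  then show ?thesis using k by (intro bexI[of _ "real m / 2 ^ k"]) (auto simp: dyadics_def)
qed

text \<open>
  Splitting \<open>K\<close> repeatedly gives points \<open>q r\<close>, increasing in the dyadic fraction \<open>r\<close>, with
  uncountably many elements of \<open>K\<close> between any two of them. The function \<open>f t = Sup {r. q r \<le> t}\<close> is monotone
  and takes all dyadic values, so it is continuous. If \<open>f\<close> grew on an interval that misses \<open>K\<close>, two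
  of the points \<open>q r\<close> would lie in that interval, with elements of \<open>K\<close> between them.
\<close>

lemma cantor_function:
  fixes K :: "real set"
  assumes K: "K \<subseteq> {0..1}" "uncountable K"
  shows "\<exists>f :: real \<Rightarrow> real. continuous_on {0..1} f \<and> f ` {0..1} = {0..1} \<and>
    (\<forall>s\<in>{0..1}. \<forall>t\<in>{0..1}. K \<inter> {s<..<t} = {} \<longrightarrow> s \<le> t \<longrightarrow> f s = f t)"
proof -
  let ?D = "dyadics \<inter> {0..1::real}"
  define R where "R x y \<longleftrightarrow> uncountable (K \<inter> {x<..<y})" for x y
  have "R 0 1"
  proof (unfold R_def, rule)
    assume "countable (K \<inter> {0<..<1})"
    then have "countable (K \<inter> {0<..<1} \<union> {0, 1})" by simp
    then have "countable K" by (rule countable_subset[rotated]) (use K(1) in force)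
    then show False using K(2) by blast
  qed
  moreover have "\<exists>z. R x z \<and> R z y" if "R x y" for x y
    using uncountable_interval_split that unfolding R_def .
  moreover have "R x z" if "R x y" "R y z" for x y z
  proof (unfold R_def, rule)
    assume c: "countable (K \<inter> {x<..<z})"
    have "y < z" using that(2) by (cases "y < z") (auto simp: R_def)
    then have "countable (K \<inter> {x<..<y})" by (intro countable_subset[OF _ c]) auto
    then show False using that(1) by (simp add: R_def)
  qed
  ultimately have "\<exists>q :: real \<Rightarrow> real. q 0 = 0 \<and> q 1 = 1 \<and> (\<forall>x\<in>?D. \<forall>y\<in>?D. x < y \<longrightarrow> R (q x) (q y))"
    by (rule recursion_on_dyadic_fractions)
  then obtain q :: "real \<Rightarrow> real" where q: "q 0 = 0" "q 1 = 1" "\<And>x y. x \<in> ?D \<Longrightarrow> y \<in> ?D \<Longrightarrow> x < y \<Longrightarrow> R (q x) (q y)"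
    by blast
  have R_less: "x < y" if "R x y" for x y using that by (cases "x < y") (auto simp: R_def)
  have qm: "q x < q y" if "x \<in> ?D" "y \<in> ?D" "x < y" for x y using R_less q(3) that by blast
  have qm': "q x \<le> q y \<longleftrightarrow> x \<le> y" if "x \<in> ?D" "y \<in> ?D" for x y
    using qm[of x y] qm[of y x] that by (metis less_imp_not_less linorder_less_linear not_le order_refl)
  have D01: "0 \<in> ?D" "1 \<in> ?D" using real_in_dyadics[of 0] real_in_dyadics[of 1] by auto
  have btw: "\<exists>r\<in>?D. a < r \<and> r < b" if "0 \<le> a" "a < b" "b \<le> 1" for a b
    using dyadic_between[OF that(1,2)] that by force
  define f where "f t = Sup {r \<in> ?D. q r \<le> t}" for t
  have bdd: "bdd_above {r \<in> ?D. q r \<le> t}" for t by (rule bdd_aboveI[of _ 1]) auto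
  have ne: "0 \<in> {r \<in> ?D. q r \<le> t}" if "t \<in> {0..1}" for t using D01 q(1) that by auto
  have up: "r \<le> f t" if "r \<in> ?D" "q r \<le> t" for r t
    unfolding f_def using that by (intro cSup_upper[OF _ bdd]) auto
  have least: "f t \<le> b" if "t \<in> {0..1}" "\<And>r. r \<in> ?D \<Longrightarrow> q r \<le> t \<Longrightarrow> r \<le> b" for t b
    unfolding f_def using ne[OF that(1)] that(2) by (intro cSup_least) blast+
  have f01: "f t \<in> {0..1}" if "t \<in> {0..1}" for t
    using up[OF D01(1), of t] least[OF that, of 1] q(1) that by auto
  have mono: "f s \<le> f t" if "s \<in> {0..1}" "s \<le> t" for s t
    using that up by (intro least) auto
  have fq: "f (q r) = r" if "r \<in> ?D" for r
  proof (rule antisym)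
    have "q r \<in> {0..1}" using qm'[OF D01(1) that] qm'[OF that D01(2)] q(1,2) that by auto
    then show "f (q r) \<le> r" using qm' that by (intro least) auto
    show "r \<le> f (q r)" using that by (intro up) auto
  qed
  have q01: "q r \<in> {0..1}" if "r \<in> ?D" for r
    using qm'[OF D01(1) that] qm'[OF that D01(2)] q(1,2) that by auto
  have cont: "continuous_on {0..1} f"
  proof (rule continuous_on_mono_dense_values)
    fix a b :: real assume "0 \<le> a" "a < b" "b \<le> 1"
    then obtain r where "r \<in> ?D" "a < r" "r < b" using btw by blast
    then show "\<exists>t\<in>{0..1}. a < f t \<and> f t < b" using fq q01 by (intro bexI[of _ "q r"]) auto
  qed (use mono f01 in auto)
  have f0: "f 0 = 0" and f1: "f 1 = 1" using fq[OF D01(1)] fq[OF D01(2)] q(1,2) by auto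
  have "f ` {0..1} = {0..1}"
  proof
    show "f ` {0..1} \<subseteq> {0..1}" using f01 by blast
    show "{0..1} \<subseteq> f ` {0..1}"
    proof
      fix y :: real assume "y \<in> {0..1}"
      then have "\<exists>x\<ge>0. x \<le> 1 \<and> f x = y" using f0 f1 cont by (intro IVT') auto
      then show "y \<in> f ` {0..1}" by auto
    qed
  qed
  moreover have "f s = f t" if st: "s \<in> {0..1}" "t \<in> {0..1}" "K \<inter> {s<..<t} = {}" "s \<le> t" for s t
  proof (rule ccontr)
    assume "f s \<noteq> f t"
    then have "f s < f t" using mono[OF st(1,4)] by simp
    then obtain r where r: "r \<in> ?D" "f s < r" "r < f t" using btw[of "f s" "f t"] f01 st by auto
    then obtain r' where r': "r' \<in> ?D" "r < r'" "r' < f t" using btw[of r "f t"] f01 st by auto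
    have "s < q r" using up[OF r(1), of s] r(2) by force
    moreover have "q r' \<le> t"
    proof (rule ccontr)
      assume "\<not> q r' \<le> t"
      then have "f t \<le> f (q r')" using st by (intro mono) auto
      then show False using fq[OF r'(1)] r'(3) by simp
    qed
    ultimately have "K \<inter> {q r<..<q r'} \<subseteq> K \<inter> {s<..<t}" by auto
    then have "K \<inter> {q r<..<q r'} = {}" using st(3) by blast
    then show False using q(3)[OF r(1) r'(1) r'(2)] by (simp add: R_def)
  qed
  ultimately show ?thesis using cont by blast
qed

section \<open>Interval maps with a prescribed fixed set\<close>

text \<open>
  The conjugate of the third Chebyshev polynomial under \<open>cos (pi * t)\<close>: piecewise linear with slopes
  \<open>3\<close>, \<open>- 3\<close>, \<open>3\<close>. This formula gives all iterates in closed form without case distinctions; three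
  branches rather than two make both end points fixed, so that copies can be glued.
\<close>

definition zigzag :: "real \<Rightarrow> real" where
  "zigzag t = arccos (cos (3 * (pi * t))) / pi"

lemma zigzag_range: "zigzag t \<in> {0..1}"
  unfolding zigzag_def using arccos_lbound[of "cos (3 * (pi * t))"] arccos_ubound[of "cos (3 * (pi * t))"]
  by (simp add: divide_le_eq)

lemma zigzag_0 [simp]: "zigzag 0 = 0"
  by (simp add: zigzag_def)

lemma zigzag_1 [simp]: "zigzag 1 = 1"
proof -
  have "cos (3 * pi) = -1" using cos_npi[of 3] by simp
  then show ?thesis by (simp add: zigzag_def)
qed

lemma continuous_on_zigzag: "continuous_on S zigzag"
  unfolding zigzag_def by (intro continuous_intros) auto

lemma zigzag_funpow:
  assumes "t \<in> {0..1}"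
  shows "(zigzag ^^ n) t = arccos (cos (3 ^ n * (pi * t))) / pi"
proof (induction n)
  case 0
  have "0 \<le> pi * t" "pi * t \<le> pi" using assms by auto
  then show ?case by (simp add: arccos_cos)
next
  case (Suc n)
  define \<theta> where "\<theta> = 3 ^ n * (pi * t)"
  have "cos (3 * arccos (cos \<theta>)) = cos (3 * \<theta>)"
    by (simp add: cos_treble_cos cos_arccos)
  then show ?case using Suc by (simp add: zigzag_def \<theta>_def mult.assoc)
qed

text \<open>
  The \<open>n\<close>-th iterate takes the value \<open>u\<close> at all points \<open>(u + 2 * k) / 3 ^ n\<close> of the unit interval, and
  these are \<open>2 / 3 ^ n\<close> apart.
\<close>

lemma zigzag_exact:
  assumes r: "r > 0"
  shows "\<exists>N. \<forall>n\<ge>N. \<forall>c\<in>{0..1}. \<forall>u\<in>{0..1}. \<exists>s\<in>{0..1}. \<bar>s - c\<bar> < r \<and> (zigzag ^^ n) s = u"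
proof -
  \<comment> \<open>An interval of length \<open>r'\<close> that starts at \<open>c\<close> stays inside \<open>[0,1]\<close> on at least one side.\<close>
  define r' where "r' = min r (1/2)"
  have r': "r' > 0" "r' \<le> r" "r' \<le> 1/2" using r by (auto simp: r'_def)
  obtain N where N: "(1/3::real) ^ N < r' / 2" using real_arch_pow_inv[of "r'/2" "1/3"] r'(1) by auto
  have "\<exists>s\<in>{0..1}. \<bar>s - c\<bar> < r \<and> (zigzag ^^ n) s = u" if n: "n \<ge> N" and c: "c \<in> {0..1}" and u: "u \<in> {0..1}" for n c u
  proof -
    have "(1/3::real) ^ n \<le> (1/3) ^ N" using n by (intro power_decreasing) auto
    then have "(1/3::real) ^ n < r' / 2" using N by (rule order_le_less_trans)
    then have small: "2 / 3 ^ n < r'" by (simp add: power_divide)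
    have val: "(zigzag ^^ n) s = u" if "s \<in> {0..1}" "s = (u + 2 * of_int k) / 3 ^ n" for s k
    proof -
      have "3 ^ n * (pi * s) = pi * u + (2 * pi) * of_int k" using that(2) by (simp add: field_simps)
      then have "cos (3 ^ n * (pi * s)) = cos (pi * u)" by (simp add: cos_add cos_int_2pin sin_int_2pin)
      moreover have "arccos (cos (pi * u)) = pi * u" using u by (intro arccos_cos) auto
      ultimately show ?thesis by (simp add: zigzag_funpow[OF that(1)])
    qed
    show ?thesis
    proof (cases "c \<le> 1/2")
      case True
      define k where "k = \<lceil>(3 ^ n * c - u) / 2\<rceil>"
      define s where "s = (u + 2 * of_int k) / 3 ^ n"
      have "(3 ^ n * c - u) / 2 \<le> of_int k" "of_int k < (3 ^ n * c - u) / 2 + 1"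
        unfolding k_def by linarith+
      then have "3 ^ n * c \<le> u + 2 * of_int k" "u + 2 * of_int k < 3 ^ n * c + 2" by argo+
      then have "(3 ^ n * c) / 3 ^ n \<le> s" "s < (3 ^ n * c + 2) / 3 ^ n"
        unfolding s_def by (intro divide_right_mono divide_strict_right_mono; simp)+
      then have "c \<le> s" "s < c + 2 / 3 ^ n" by (simp_all add: add_divide_distrib)
      then have "s \<in> {0..1}" "\<bar>s - c\<bar> < r" using small r' c True by auto
      then show ?thesis using val[of s k] s_def by blast
    next
      case False
      define k where "k = \<lfloor>(3 ^ n * c - u) / 2\<rfloor>"
      define s where "s = (u + 2 * of_int k) / 3 ^ n"
      have "of_int k \<le> (3 ^ n * c - u) / 2" "(3 ^ n * c - u) / 2 - 1 < of_int k"
        unfolding k_def by linarith+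
      then have "u + 2 * of_int k \<le> 3 ^ n * c" "3 ^ n * c - 2 < u + 2 * of_int k" by argo+
      then have "s \<le> (3 ^ n * c) / 3 ^ n" "(3 ^ n * c - 2) / 3 ^ n < s"
        unfolding s_def by (intro divide_right_mono divide_strict_right_mono; simp)+
      then have "s \<le> c" "c - 2 / 3 ^ n < s" by (simp_all add: diff_divide_distrib)
      then have "s \<in> {0..1}" "\<bar>s - c\<bar> < r" using small r' c False by auto
      then show ?thesis using val[of s k] s_def by blast
    qed
  qed
  then show ?thesis by blast
qed

text \<open>
  A predicate \<open>D\<close> on binary words marks words as killed. The map acts as a zigzag on each dyadic interval
  whose word is killed while no proper prefix is, and as the identity elsewhere; the first
  argument bounds the length of the words that are inspected.
\<close>

fun glue :: "nat \<Rightarrow> (bool list \<Rightarrow> bool) \<Rightarrow> real \<Rightarrow> real" where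
  "glue 0 D t = t"
| "glue (Suc m) D t =
    (if D [] then zigzag t
     else if t \<le> 1/2 then glue m (\<lambda>w. D (False # w)) (2 * t) / 2
     else (1 + glue m (\<lambda>w. D (True # w)) (2 * t - 1)) / 2)"

lemma glue_range: "t \<in> {0..1} \<Longrightarrow> glue m D t \<in> {0..1}"
proof (induction m arbitrary: D t)
  case (Suc m)
  have "glue m (\<lambda>w. D (False # w)) (2 * t) \<in> {0..1}" if "t \<le> 1/2" using Suc.prems that by (intro Suc.IH) auto
  moreover have "glue m (\<lambda>w. D (True # w)) (2 * t - 1) \<in> {0..1}" if "\<not> t \<le> 1/2" using Suc.prems that by (intro Suc.IH) auto
  ultimately show ?case using zigzag_range[of t] by auto
qed simp

lemma glue_0 [simp]: "glue m D 0 = 0"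
  by (induction m arbitrary: D) auto

lemma glue_1 [simp]: "glue m D 1 = 1"
  by (induction m arbitrary: D) auto

lemma continuous_on_glue: "continuous_on {0..1} (glue m D)"
proof (induction m arbitrary: D)
  case (Suc m)
  show ?case
  proof (cases "D []")
    case True
    then have "glue (Suc m) D = zigzag" by (intro ext) simp
    then show ?thesis using continuous_on_zigzag by simp
  next
    case False
    have L: "continuous_on {0..1/2} (\<lambda>t. glue m (\<lambda>w. D (False # w)) (2 * t) / 2)"
      by (intro continuous_intros continuous_on_compose2[OF Suc.IH]) auto
    have R: "continuous_on {1/2..1} (\<lambda>t. (1 + glue m (\<lambda>w. D (True # w)) (2 * t - 1)) / 2)"
      by (intro continuous_intros continuous_on_compose2[OF Suc.IH]) auto
    have "continuous_on ({0..1/2} \<union> {1/2..1}) (\<lambda>t. if t \<le> 1/2 then glue m (\<lambda>w. D (False # w)) (2 * t) / 2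
        else (1 + glue m (\<lambda>w. D (True # w)) (2 * t - 1)) / 2)"
    proof (rule continuous_on_cases[OF _ _ L R])
      show "\<forall>x. x \<in> {0..1/2} \<and> \<not> x \<le> 1/2 \<or> x \<in> {1/2..1} \<and> x \<le> 1/2 \<longrightarrow>
        glue m (\<lambda>w. D (False # w)) (2 * x) / 2 = (1 + glue m (\<lambda>w. D (True # w)) (2 * x - 1)) / 2"
      proof (intro allI impI)
        fix x :: real assume "x \<in> {0..1/2} \<and> \<not> x \<le> 1/2 \<or> x \<in> {1/2..1} \<and> x \<le> 1/2"
        then have "2 * x = 1" "2 * x - 1 = 0" by auto
        then show "glue m (\<lambda>w. D (False # w)) (2 * x) / 2 = (1 + glue m (\<lambda>w. D (True # w)) (2 * x - 1)) / 2"
          by (simp only: glue_0 glue_1 add_0_right)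
      qed
    qed auto
    moreover have "{0..1/2} \<union> {1/2..1} = {0..1::real}" by auto
    moreover have "glue (Suc m) D = (\<lambda>t. if t \<le> 1/2 then glue m (\<lambda>w. D (False # w)) (2 * t) / 2
        else (1 + glue m (\<lambda>w. D (True # w)) (2 * t - 1)) / 2)"
      using False by (intro ext) simp
    ultimately show ?thesis by (simp only:)
  qed
qed simp

text \<open>
  At depth \<open>m\<close> the two maps differ only inside dyadic intervals of length \<open>2 ^ (- m)\<close>, and both leave these
  invariant.
\<close>

lemma glue_Cauchy:
  "t \<in> {0..1} \<Longrightarrow> m \<le> n \<Longrightarrow> \<bar>glue m D t - glue n D t\<bar> \<le> (1/2) ^ m"
proof (induction m arbitrary: n D t)
  case 0
  then show ?case using glue_range[OF 0(1), of n D] by auto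
next
  case (Suc m)
  obtain n' where n': "n = Suc n'" "m \<le> n'" using Suc.prems(2) by (cases n) auto
  define e :: real where "e = (1/2) ^ m"
  have e: "(1/2::real) ^ Suc m = e / 2" "0 \<le> e" by (simp_all add: e_def)
  have "\<bar>glue m (\<lambda>w. D (False # w)) (2 * t) - glue n' (\<lambda>w. D (False # w)) (2 * t)\<bar> \<le> e" if "t \<le> 1/2"
    using Suc.prems that n' unfolding e_def by (intro Suc.IH) auto
  moreover have "\<bar>glue m (\<lambda>w. D (True # w)) (2 * t - 1) - glue n' (\<lambda>w. D (True # w)) (2 * t - 1)\<bar> \<le> e" if "\<not> t \<le> 1/2"
    using Suc.prems that n' unfolding e_def by (intro Suc.IH) auto
  moreover have "\<bar>(x + a) / 2 - (x + b) / 2\<bar> \<le> e / 2" if "\<bar>a - b\<bar> \<le> e" for x a b :: real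
  proof -
    have eq: "(x + a) / 2 - (x + b) / 2 = (a - b) / 2" by (simp add: field_simps)
    show ?thesis unfolding eq using that by (simp add: abs_divide)
  qed
  note this[of _ _ 0, simplified add_0_left] this[of _ _ 1]
  ultimately show ?case unfolding n'(1) e(1) glue.simps using e(2) by (cases "D []"; cases "t \<le> 1/2") (simp_all only: if_True if_False simp_thms, simp_all)
qed

lemma glue_cong:
  "(\<And>w. length w < m \<Longrightarrow> D w = D' w) \<Longrightarrow> glue m D t = glue m D' t"
proof (induction m arbitrary: D D' t)
  case (Suc m)
  have "glue m (\<lambda>w. D (c # w)) s = glue m (\<lambda>w. D' (c # w)) s" for c s
    by (rule Suc.IH) (simp add: Suc.prems)
  then show ?case using Suc.prems[of "[]"] by simp
qed simp

definition glue_lim :: "(bool list \<Rightarrow> bool) \<Rightarrow> real \<Rightarrow> real" where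
  "glue_lim D t = lim (\<lambda>m. glue m D t)"

lemma glue_tendsto:
  assumes t: "t \<in> {0..1}"
  shows "(\<lambda>m. glue m D t) \<longlonglongrightarrow> glue_lim D t"
proof -
  have "Cauchy (\<lambda>m. glue m D t)"
  proof (rule metric_CauchyI)
    fix e :: real assume "e > 0"
    then obtain k where k: "(1/2::real) ^ k < e / 2" using real_arch_pow_inv[of "e/2" "1/2"] by auto
    have "dist (glue m D t) (glue n D t) < e" if "m \<ge> k" "n \<ge> k" for m n
      using glue_Cauchy[OF t that(1), of D] glue_Cauchy[OF t that(2), of D] k unfolding dist_real_def by linarith
    then show "\<exists>M. \<forall>m\<ge>M. \<forall>n\<ge>M. dist (glue m D t) (glue n D t) < e" by blast
  qed
  then show ?thesis unfolding glue_lim_def using Cauchy_convergent convergent_LIMSEQ_iff by blast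
qed

lemma glue_lim_close:
  assumes t: "t \<in> {0..1}"
  shows "\<bar>glue m D t - glue_lim D t\<bar> \<le> (1/2) ^ m"
proof (rule tendsto_upperbound)
  show "(\<lambda>n. \<bar>glue m D t - glue n D t\<bar>) \<longlonglongrightarrow> \<bar>glue m D t - glue_lim D t\<bar>"
    by (intro tendsto_intros glue_tendsto t)
  show "\<forall>\<^sub>F n in sequentially. \<bar>glue m D t - glue n D t\<bar> \<le> (1/2) ^ m"
    using eventually_ge_at_top[of m] by (rule eventually_mono) (rule glue_Cauchy[OF t])
qed simp

lemma glue_lim_range:
  assumes "t \<in> {0..1}"
  shows "glue_lim D t \<in> {0..1}"
  using closed_sequentially[OF closed_atLeastAtMost _ glue_tendsto[OF assms]] glue_range[OF assms] by blast

lemma continuous_on_glue_lim: "continuous_on {0..1} (glue_lim D)"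
proof (rule uniform_limit_theorem)
  show "\<forall>\<^sub>F m in sequentially. continuous_on {0..1} (glue m D)"
    by (simp add: continuous_on_glue)
  show "uniform_limit {0..1} (\<lambda>m. glue m D) (glue_lim D) sequentially"
  proof (rule uniform_limitI)
    fix e :: real assume "e > 0"
    then obtain k where k: "(1/2::real) ^ k < e" using real_arch_pow_inv[of e "1/2"] by auto
    have "dist (glue m D t) (glue_lim D t) < e" if "m \<ge> k" "t \<in> {0..1}" for m t
    proof -
      have "(1/2::real) ^ m \<le> (1/2) ^ k" using that(1) by (intro power_decreasing) auto
      then show ?thesis using glue_lim_close[OF that(2), of m D] k unfolding dist_real_def by linarith
    qed
    then show "\<forall>\<^sub>F m in sequentially. \<forall>t\<in>{0..1}. dist (glue m D t) (glue_lim D t) < e"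
      unfolding eventually_sequentially by blast
  qed
qed simp

lemma glue_lim_killed:
  assumes "D []" "t \<in> {0..1}"
  shows "glue_lim D t = zigzag t"
proof -
  have "(\<lambda>m. glue (Suc m) D t) \<longlonglongrightarrow> glue_lim D t" using glue_tendsto[OF assms(2)] by (rule LIMSEQ_Suc)
  moreover have "(\<lambda>m. glue (Suc m) D t) \<longlonglongrightarrow> zigzag t" using assms(1) by simp
  ultimately show ?thesis by (rule LIMSEQ_unique)
qed

lemma glue_lim_half:
  assumes "\<not> D []" "t \<in> {0..1}"
  shows "glue_lim D ((of_bool c + t) / 2) = (of_bool c + glue_lim (\<lambda>w. D (c # w)) t) / 2"
proof -
  have mem: "(of_bool c + t) / 2 \<in> {0..1}" using assms(2) by (cases c) auto
  have eq: "glue (Suc m) D ((of_bool c + t) / 2) = (of_bool c + glue m (\<lambda>w. D (c # w)) t) / 2" for m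
    using assms by (cases c) (auto simp: field_simps)
  have "(\<lambda>m. glue (Suc m) D ((of_bool c + t) / 2)) \<longlonglongrightarrow> glue_lim D ((of_bool c + t) / 2)"
    using glue_tendsto[OF mem] by (rule LIMSEQ_Suc)
  moreover have "(\<lambda>m. glue (Suc m) D ((of_bool c + t) / 2)) \<longlonglongrightarrow> (of_bool c + glue_lim (\<lambda>w. D (c # w)) t) / 2"
    unfolding eq by (intro tendsto_intros glue_tendsto assms(2)) simp
  ultimately show ?thesis by (rule LIMSEQ_unique)
qed

text \<open>
  The affine bijection from the unit interval onto the dyadic interval named by the word.
\<close>

fun at_word :: "bool list \<Rightarrow> real \<Rightarrow> real" where
  "at_word [] t = t"
| "at_word (c # w) t = (of_bool c + at_word w t) / 2"

lemma at_word_range: "t \<in> {0..1} \<Longrightarrow> at_word w t \<in> {0..1}"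
  by (induction w) auto

lemma at_word_diff: "at_word w s - at_word w t = (s - t) / 2 ^ length w"
proof (induction w)
  case (Cons c w)
  have "at_word (c # w) s - at_word (c # w) t = (at_word w s - at_word w t) / 2" by (simp add: field_simps)
  then show ?case using Cons by simp
qed simp

lemma at_word_le_iff [simp]: "at_word w s \<le> at_word w t \<longleftrightarrow> s \<le> t"
  by (induction w) (simp_all add: divide_le_cancel)

lemma at_word_append: "at_word (v @ w) t = at_word v (at_word w t)"
  by (induction v) auto

text \<open>
  As long as no proper prefix of \<open>w\<close> is killed, the dyadic interval of \<open>w\<close> is invariant, and the map inside it is
  a rescaled copy of the map for the shifted predicate.
\<close>

lemma glue_lim_at_word:
  "(\<And>k. k < length w \<Longrightarrow> \<not> D (take k w)) \<Longrightarrow> t \<in> {0..1} \<Longrightarrow>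
    glue_lim D (at_word w t) = at_word w (glue_lim (\<lambda>v. D (w @ v)) t)"
proof (induction w arbitrary: D)
  case (Cons c w)
  have "\<not> D []" using Cons.prems(1)[of 0] by simp
  then have "glue_lim D (at_word (c # w) t) = (of_bool c + glue_lim (\<lambda>w. D (c # w)) (at_word w t)) / 2"
    using glue_lim_half at_word_range[OF Cons.prems(2)] by simp
  also have "glue_lim (\<lambda>w. D (c # w)) (at_word w t) = at_word w (glue_lim (\<lambda>v. D (c # (w @ v))) t)"
  proof (rule Cons.IH)
    show "\<not> D (c # take k w)" if "k < length w" for k using Cons.prems(1)[of "Suc k"] that by simp
  qed (rule Cons.prems(2))
  finally show ?case by simp
qed simp

definition minimal_killed :: "(bool list \<Rightarrow> bool) \<Rightarrow> bool list \<Rightarrow> bool" where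
  "minimal_killed D w \<longleftrightarrow> D w \<and> (\<forall>k<length w. \<not> D (take k w))"

lemma glue_lim_minimal_killed:
  assumes "minimal_killed D w" "t \<in> {0..1}"
  shows "glue_lim D (at_word w t) = at_word w (zigzag t)"
  using assms glue_lim_at_word[of w D t] glue_lim_killed[of "\<lambda>v. D (w @ v)" t]
  by (simp add: minimal_killed_def)

definition bin_point :: "(nat \<Rightarrow> bool) \<Rightarrow> real" where
  "bin_point b = (\<Sum>n. of_bool (b n) / 2 ^ Suc n)"

lemma summable_bin: "summable (\<lambda>n. of_bool (b n) / 2 ^ Suc n :: real)"
  by (rule summable_comparison_test'[OF sums_summable[OF power_half_series], of 0]) (auto simp: power_divide)

lemma bin_point_Suc: "bin_point b = (of_bool (b 0) + bin_point (\<lambda>i. b (Suc i))) / 2"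
proof -
  have "bin_point b = (\<Sum>n. of_bool (b (Suc n)) / 2 ^ Suc (Suc n)) + of_bool (b 0) / 2"
    unfolding bin_point_def using suminf_split_head[OF summable_bin[of b]] by simp
  also have "(\<Sum>n. of_bool (b (Suc n)) / 2 ^ Suc (Suc n) :: real) = (\<Sum>n. (of_bool (b (Suc n)) / 2 ^ Suc n) / 2)"
    by (intro suminf_cong) simp
  also have "\<dots> = bin_point (\<lambda>i. b (Suc i)) / 2"
    unfolding bin_point_def using suminf_divide[OF summable_bin[of "\<lambda>i. b (Suc i)"], of 2] by simp
  finally show ?thesis by (simp add: field_simps)
qed

lemma bin_point_range: "bin_point b \<in> {0..1}"
proof -
  have "bin_point b \<ge> 0" unfolding bin_point_def by (intro suminf_nonneg summable_bin) simp
  moreover have "bin_point b \<le> (\<Sum>n. (1/2) ^ Suc n)"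
    unfolding bin_point_def
    by (intro suminf_le summable_bin sums_summable[OF power_half_series]) (auto simp: power_divide)
  ultimately show ?thesis using sums_unique[OF power_half_series] by simp
qed

lemma bin_point_pos:
  assumes "infinite {i. b i}"
  shows "bin_point b > 0"
proof -
  obtain i where "b i" using assms by (metis Collect_empty_eq finite.emptyI)
  then show ?thesis unfolding bin_point_def by (intro suminf_pos2[OF summable_bin, of b i]) auto
qed

lemma bin_point_at_word: "bin_point b = at_word (map b [0..<n]) (bin_point (\<lambda>i. b (i + n)))"
proof (induction n)
  case (Suc n)
  have "bin_point (\<lambda>i. b (i + n)) = (of_bool (b n) + bin_point (\<lambda>i. b (i + Suc n))) / 2"
    using bin_point_Suc[of "\<lambda>i. b (i + n)"] by simp
  from Suc[unfolded this] show ?case by (simp add: at_word_append)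
qed simp

lemma bin_point_interior_prefix:
  "at_word w s < bin_point b \<Longrightarrow> bin_point b < at_word w s' \<Longrightarrow> s \<in> {0..1} \<Longrightarrow> s' \<in> {0..1} \<Longrightarrow>
    map b [0..<length w] = w"
proof (induction w arbitrary: b)
  case (Cons c w)
  have r: "at_word w s \<in> {0..1}" "at_word w s' \<in> {0..1}" using Cons.prems at_word_range by blast+
  note p = bin_point_range[of "\<lambda>i. b (Suc i)"] bin_point_Suc[of b]
  have c: "b 0 = c" using Cons.prems(1,2) r p by (cases c; cases "b 0") auto
  then have "map (\<lambda>i. b (Suc i)) [0..<length w] = w" using Cons.prems p by (intro Cons.IH) auto
  then show ?case using c by (simp add: map_upt_Suc del: upt_Suc)
qed simp

text \<open>
  Infinitely many digits \<open>1\<close> select one of the two expansions of a dyadic rational, so membership in the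
  half-open dyadic interval determines the digits.
\<close>

lemma bin_point_infinite_prefix:
  "at_word w 0 < bin_point b \<Longrightarrow> bin_point b \<le> at_word w 1 \<Longrightarrow> infinite {i. b i} \<Longrightarrow>
    map b [0..<length w] = w"
proof (induction w arbitrary: b)
  case (Cons c w)
  have r: "at_word w 0 \<in> {0..1}" "at_word w 1 \<in> {0..1}" using at_word_range by auto
  have inf: "infinite {i. b (Suc i)}"
  proof
    assume "finite {i. b (Suc i)}"
    then have "finite (insert 0 (Suc ` {i. b (Suc i)}))" by simp
    moreover have "{i. b i} \<subseteq> insert 0 (Suc ` {i. b (Suc i)})"
    proof
      fix i assume "i \<in> {i. b i}"
      then show "i \<in> insert 0 (Suc ` {i. b (Suc i)})" by (cases i) auto
    qed
    ultimately show False using Cons.prems(3) finite_subset by blast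
  qed
  note p = bin_point_range[of "\<lambda>i. b (Suc i)"] bin_point_Suc[of b] bin_point_pos[OF inf]
  have c: "b 0 = c" using Cons.prems(1,2) r p by (cases c; cases "b 0") auto
  then have "map (\<lambda>i. b (Suc i)) [0..<length w] = w" using Cons.prems p inf by (intro Cons.IH) auto
  then show ?case using c by (simp add: map_upt_Suc del: upt_Suc)
qed simp

lemma bin_point_inj:
  assumes "infinite {i. b i}" "infinite {i. b' i}" "bin_point b = bin_point b'"
  shows "b = b'"
proof
  fix n
  define w where "w = map b' [0..<Suc n]"
  have inf: "infinite {i. b' (i + Suc n)}"
  proof
    assume "finite {i. b' (i + Suc n)}"
    then have "finite ({..<Suc n} \<union> (\<lambda>i. i + Suc n) ` {i. b' (i + Suc n)})" by simp
    moreover have "{i. b' i} \<subseteq> {..<Suc n} \<union> (\<lambda>i. i + Suc n) ` {i. b' (i + Suc n)}"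
    proof
      fix i assume "i \<in> {i. b' i}"
      then show "i \<in> {..<Suc n} \<union> (\<lambda>i. i + Suc n) ` {i. b' (i + Suc n)}"
        by (cases "i < Suc n") (auto intro!: image_eqI[of _ _ "i - Suc n"])
    qed
    ultimately show False using assms(2) finite_subset by blast
  qed
  have e: "bin_point b' = at_word w (bin_point (\<lambda>i. b' (i + Suc n)))" unfolding w_def by (rule bin_point_at_word)
  have "at_word w 0 < bin_point b'" using bin_point_pos[OF inf] unfolding e by (simp add: not_le[symmetric])
  moreover have "bin_point b' \<le> at_word w 1" using bin_point_range unfolding e by simp
  ultimately have "map b [0..<length w] = w" using assms(1,3) by (intro bin_point_infinite_prefix) simp_all
  then have "map b [0..<Suc n] = map b' [0..<Suc n]" by (simp add: w_def del: upt_Suc)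
  then show "b n = b' n" by (simp only: map_eq_conv) simp
qed

text \<open>
  The points with a binary expansion all of whose prefixes avoid \<open>D\<close>.
\<close>

definition surviving :: "(bool list \<Rightarrow> bool) \<Rightarrow> real set" where
  "surviving D = bin_point ` {b. \<forall>n. \<not> D (map b [0..<n])}"

lemma surviving_subset: "surviving D \<subseteq> {0..1}"
  unfolding surviving_def using bin_point_range by blast

lemma at_word_dist:
  assumes "s \<in> {0..1}" "t \<in> {0..1}"
  shows "\<bar>at_word w s - at_word w t\<bar> \<le> (1/2) ^ length w"
  unfolding at_word_diff using assms by (auto simp: power_divide abs_le_iff divide_right_mono)

lemma eq_of_close_all:
  fixes x y :: real
  assumes "\<And>n. \<bar>x - y\<bar> \<le> (1/2) ^ n"
  shows "x = y"
proof (rule ccontr)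
  assume "x \<noteq> y"
  then obtain n where "(1/2::real) ^ n < \<bar>x - y\<bar>" using real_arch_pow_inv[of "\<bar>x - y\<bar>" "1/2"] by auto
  then show False using assms[of n] by simp
qed

text \<open>
  Such a point lies in invariant intervals of arbitrarily small length.
\<close>

lemma glue_lim_surviving:
  assumes "t \<in> surviving D"
  shows "glue_lim D t = t"
proof (rule eq_of_close_all)
  fix n
  obtain b where b: "t = bin_point b" "\<And>n. \<not> D (map b [0..<n])" using assms by (auto simp: surviving_def)
  define w s where "w = map b [0..<n]" and "s = bin_point (\<lambda>i. b (i + n))"
  have t: "t = at_word w s" unfolding b(1) w_def s_def by (rule bin_point_at_word)
  have s: "s \<in> {0..1}" unfolding s_def by (rule bin_point_range)
  have "\<not> D (take k w)" if "k < length w" for k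
    using b(2)[of k] that by (simp add: w_def take_map)
  then have "glue_lim D t = at_word w (glue_lim (\<lambda>v. D (w @ v)) s)" unfolding t by (intro glue_lim_at_word s)
  then have "\<bar>glue_lim D t - t\<bar> \<le> (1/2) ^ length w"
    unfolding t using at_word_dist[OF glue_lim_range[OF s] s] by simp
  then show "\<bar>glue_lim D t - t\<bar> \<le> (1/2) ^ n" by (simp add: w_def)
qed

text \<open>
  The digits of \<open>t\<close> are produced by the doubling map; either some prefix is killed, and the shortest one is
  minimal, or \<open>t\<close> survives.
\<close>

lemma surviving_or_killed:
  assumes t: "t \<in> {0..1}"
  shows "t \<in> surviving D \<or> (\<exists>w. minimal_killed D w \<and> t \<in> at_word w ` {0..1})"
proof -
  define T where "T = rec_nat t (\<lambda>_ x. 2 * x - of_bool (1/2 \<le> x))"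
  have T: "T 0 = t" "T (Suc n) = 2 * T n - of_bool (1/2 \<le> T n)" for n by (simp_all add: T_def)
  define b where "b n = (1/2 \<le> T n)" for n
  have T01: "T n \<in> {0..1}" for n by (induction n) (use t T in auto)
  have tw: "t = at_word (map b [0..<n]) (T n)" for n
  proof (induction n)
    case (Suc n)
    have "T n = (of_bool (b n) + T (Suc n)) / 2" by (simp add: T b_def)
    from Suc[unfolded this] show ?case by (simp add: at_word_append)
  qed (simp add: T)
  show ?thesis
  proof (cases "\<exists>n. D (map b [0..<n])")
    case True
    define n where "n = (LEAST n. D (map b [0..<n]))"
    have n: "D (map b [0..<n])" unfolding n_def using True by (rule LeastI_ex)
    have "\<not> D (take k (map b [0..<n]))" if "k < n" for k
      using not_less_Least[of k "\<lambda>n. D (map b [0..<n])"] that by (simp add: n_def[symmetric] take_map)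
    then have "minimal_killed D (map b [0..<n])" using n by (simp add: minimal_killed_def)
    then show ?thesis using tw[of n] T01[of n] by blast
  next
    case False
    have "t = bin_point b"
    proof (rule eq_of_close_all)
      fix n
      have "\<bar>t - bin_point b\<bar> \<le> (1/2) ^ length (map b [0..<n])"
        by (subst tw[of n], subst bin_point_at_word[of b n]) (rule at_word_dist[OF T01 bin_point_range])
      then show "\<bar>t - bin_point b\<bar> \<le> (1/2) ^ n" by simp
    qed
    then show ?thesis using False by (auto simp: surviving_def)
  qed
qed

lemma surviving_avoids_killed:
  assumes w: "minimal_killed D w" and s: "s \<in> {0..1}" "s' \<in> {0..1}"
  shows "surviving D \<inter> {at_word w s<..<at_word w s'} = {}"
proof (rule equals0I)
  fix t assume "t \<in> surviving D \<inter> {at_word w s<..<at_word w s'}"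
  then obtain b where b: "t = bin_point b" "\<And>n. \<not> D (map b [0..<n])" "at_word w s < t" "t < at_word w s'"
    by (auto simp: surviving_def)
  have "map b [0..<length w] = w" using b s by (intro bin_point_interior_prefix[of w s b s']) auto
  then show False using b(2)[of "length w"] w by (simp add: minimal_killed_def)
qed

text \<open>
  The Cantor function of the surviving set is constant on each invariant interval of a minimal
  killed word, and all other points are fixed.
\<close>

lemma glue_lim_identity_factor:
  assumes "uncountable (surviving D)"
  shows "\<exists>f :: real \<Rightarrow> real. continuous_on {0..1} f \<and> f ` {0..1} = {0..1} \<and> (\<forall>t\<in>{0..1}. f (glue_lim D t) = f t)"
proof -
  obtain f :: "real \<Rightarrow> real" where f: "continuous_on {0..1} f" "f ` {0..1} = {0..1}"
    "\<And>s t. s \<in> {0..1} \<Longrightarrow> t \<in> {0..1} \<Longrightarrow> surviving D \<inter> {s<..<t} = {} \<Longrightarrow> s \<le> t \<Longrightarrow> f s = f t"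
    using cantor_function[OF surviving_subset assms] by blast
  have "f (glue_lim D t) = f t" if t: "t \<in> {0..1}" for t
  proof (cases "t \<in> surviving D")
    case True
    then show ?thesis by (simp add: glue_lim_surviving)
  next
    case False
    then obtain w s where w: "minimal_killed D w" "s \<in> {0..1}" "t = at_word w s"
      using surviving_or_killed[OF t, of D] by blast
    have eq: "f (at_word w u) = f (at_word w v)" if "u \<in> {0..1}" "v \<in> {0..1}" "u \<le> v" for u v
      using that by (intro f(3) at_word_range surviving_avoids_killed[OF w(1)]) auto
    have "f (at_word w (zigzag s)) = f (at_word w s)"
      using eq[OF zigzag_range[of s] w(2)] eq[OF w(2) zigzag_range[of s]] by linarith
    then show ?thesis using glue_lim_minimal_killed[OF w(1,2)] w(3) by simp
  qed
  then show ?thesis using f(1,2) by blast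
qed

text \<open>
  A word is read as the finite set of positions of its digits \<open>1\<close>.
\<close>

definition non_clique :: "(nat \<Rightarrow> nat \<Rightarrow> bool) \<Rightarrow> bool list \<Rightarrow> bool" where
  "non_clique R w \<longleftrightarrow> \<not> (\<forall>i<length w. \<forall>j<length w. w ! i \<and> w ! j \<longrightarrow> R i j)"

lemma prefixes_clique:
  "(\<forall>n. \<not> non_clique R (map b [0..<n])) \<longleftrightarrow> (\<forall>i j. b i \<and> b j \<longrightarrow> R i j)"
proof
  assume H: "\<forall>n. \<not> non_clique R (map b [0..<n])"
  show "\<forall>i j. b i \<and> b j \<longrightarrow> R i j"
  proof (intro allI)
    fix i j
    show "b i \<and> b j \<longrightarrow> R i j" using H[rule_format, of "Suc (max i j)"] by (auto simp: non_clique_def simp del: upt_Suc)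
  qed
qed (auto simp: non_clique_def)

text \<open>
  All subsets of a clique are cliques. Only infinite subsets are used because their binary expansions are
  unique.
\<close>

lemma countable_surviving_iff:
  "countable (surviving (non_clique R)) \<longleftrightarrow> \<not> (\<exists>N. infinite N \<and> (\<forall>i\<in>N. \<forall>j\<in>N. R i j))"
proof
  assume cnt: "countable (surviving (non_clique R))"
  show "\<not> (\<exists>N. infinite N \<and> (\<forall>i\<in>N. \<forall>j\<in>N. R i j))"
  proof
    assume "\<exists>N. infinite N \<and> (\<forall>i\<in>N. \<forall>j\<in>N. R i j)"
    then obtain N where N: "infinite N" "\<And>i j. i \<in> N \<Longrightarrow> j \<in> N \<Longrightarrow> R i j" by blast
    define p where "p S = bin_point (\<lambda>i. i \<in> S)" for S
    have "inj_on p {S. S \<subseteq> N \<and> infinite S}"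
    proof (rule inj_onI)
      fix S S' assume S: "S \<in> {S. S \<subseteq> N \<and> infinite S}" "S' \<in> {S. S \<subseteq> N \<and> infinite S}" "p S = p S'"
      then have "(\<lambda>i. i \<in> S) = (\<lambda>i. i \<in> S')" by (intro bin_point_inj) (auto simp: p_def)
      then show "S = S'" by (auto dest: fun_cong)
    qed
    moreover have "p ` {S. S \<subseteq> N \<and> infinite S} \<subseteq> surviving (non_clique R)"
    proof
      fix t assume "t \<in> p ` {S. S \<subseteq> N \<and> infinite S}"
      then obtain S where S: "S \<subseteq> N" "t = bin_point (\<lambda>i. i \<in> S)" by (auto simp: p_def)
      then show "t \<in> surviving (non_clique R)" using N(2) unfolding surviving_def prefixes_clique by blast
    qed
    ultimately have "countable {S. S \<subseteq> N \<and> infinite S}"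
      using cnt countable_image_inj_on countable_subset by blast
    moreover have "countable {S::nat set. finite S}" by (rule countable_Collect_finite)
    moreover have "Pow N \<subseteq> {S. S \<subseteq> N \<and> infinite S} \<union> {S. finite S}" by auto
    ultimately have cP: "countable (Pow N)" by (metis countable_Un countable_subset)
    have "(\<lambda>M. enumerate N ` M) ` UNIV \<subseteq> Pow N" using enumerate_in_set[OF N(1)] by auto
    then have "countable ((\<lambda>M. enumerate N ` M) ` UNIV)" using cP countable_subset by blast
    moreover have "inj (\<lambda>M. enumerate N ` M)"
    proof -
      have "inj (enumerate N)" using strict_mono_enumerate[OF N(1)] by (rule strict_mono_imp_inj_on)
      then show ?thesis by (simp add: inj_on_def inj_image_eq_iff)
    qed
    ultimately have "countable (UNIV :: nat set set)" using countable_image_inj_on by blast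
    moreover have "(UNIV :: nat set set) \<approx> (UNIV :: real set)" by (rule nat_sets_eqpoll_reals)
    ultimately have "countable (UNIV :: real set)" using countable_eqpoll eqpoll_sym by blast
    then show False using uncountable_UNIV_real by blast
  qed
next
  assume H: "\<not> (\<exists>N. infinite N \<and> (\<forall>i\<in>N. \<forall>j\<in>N. R i j))"
  have "surviving (non_clique R) \<subseteq> (\<lambda>S. bin_point (\<lambda>i. i \<in> S)) ` {S. finite S}"
  proof
    fix t assume "t \<in> surviving (non_clique R)"
    then obtain b where b: "t = bin_point b" "\<forall>i j. b i \<and> b j \<longrightarrow> R i j" unfolding surviving_def prefixes_clique by blast
    then have "finite {i. b i}" using H by blast
    then show "t \<in> (\<lambda>S. bin_point (\<lambda>i. i \<in> S)) ` {S. finite S}" using b(1) by (intro image_eqI[of _ _ "{i. b i}"]) auto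
  qed
  then show "countable (surviving (non_clique R))"
    by (rule countable_subset) (intro countable_image countable_Collect_finite)
qed

section \<open>Maps of the cube\<close>

definition cube :: "(real ^ 'n) set" where
  "cube = {x. \<forall>i. 0 \<le> x $ i \<and> x $ i \<le> 1}"

lemma mspace_unit_cube: "mspace unit_cube = cube"
  by (simp add: unit_cube_def cube_def)

lemma mdist_unit_cube: "mdist unit_cube = dist"
  by (simp add: unit_cube_def)

lemma mtopology_unit_cube: "mtopology_of unit_cube = top_of_set cube"
  by (simp add: unit_cube_def cube_def mtopology_of_submetric)

lemma cube_cbox: "cube = (cbox 0 1 :: (real ^ 'n) set)"
  by (auto simp: cube_def mem_box_cart)

lemma compact_space_unit_cube: "compact_space (mtopology_of (unit_cube :: (real ^ 'n) metric))"
  by (simp add: mtopology_unit_cube cube_cbox compact_space_subtopology)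

lemma metrizable_unit_cube: "metrizable_space (mtopology_of (unit_cube :: (real ^ 'n) metric))"
  unfolding mtopology_of_def by (rule Metric_space.metrizable_space_mtopology) simp

lemma cubeD: "v \<in> cube \<Longrightarrow> v $ i \<in> {0..1}"
  by (simp add: cube_def)

text \<open>
  The zigzag on the remaining coordinates makes the fibre over each fixed point of \<open>g\<close> exact, so that
  these coordinates leave no trace in a factor of entropy zero.
\<close>

definition cube_map :: "'n \<Rightarrow> (real \<Rightarrow> real) \<Rightarrow> real ^ 'n \<Rightarrow> real ^ 'n::finite" where
  "cube_map k g = restrict (\<lambda>v. \<chi> i. if i = k then g (v $ k) else zigzag (v $ i)) cube"

definition interval_map :: "(real \<Rightarrow> real) \<Rightarrow> bool" where
  "interval_map g \<longleftrightarrow> continuous_on {0..1} g \<and> g ` {0..1} \<subseteq> {0..1}"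

lemma interval_map_range: "interval_map g \<Longrightarrow> t \<in> {0..1} \<Longrightarrow> g t \<in> {0..1}"
  unfolding interval_map_def by blast

lemma interval_map_funpow: "interval_map g \<Longrightarrow> t \<in> {0..1} \<Longrightarrow> (g ^^ n) t \<in> {0..1}"
  by (induction n) (simp_all only: funpow.simps id_apply comp_apply interval_map_range)

lemma interval_map_zigzag: "interval_map zigzag"
  using continuous_on_zigzag zigzag_range by (auto simp: interval_map_def)

lemma interval_map_glue: "interval_map (glue m D)"
  unfolding interval_map_def using continuous_on_glue glue_range by blast

lemma interval_map_glue_lim: "interval_map (glue_lim D)"
  unfolding interval_map_def using continuous_on_glue_lim glue_lim_range by blast

lemma cube_map_nth: "v \<in> cube \<Longrightarrow> cube_map k g v $ i = (if i = k then g (v $ k) else zigzag (v $ i))"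
  by (simp add: cube_map_def)

lemma cube_map_cube:
  assumes "interval_map g" "v \<in> cube"
  shows "cube_map k g v \<in> cube"
proof -
  have "cube_map k g v $ i \<in> {0..1}" for i
    unfolding cube_map_nth[OF assms(2)]
    using interval_map_range[OF assms(1) cubeD[OF assms(2), of k]] zigzag_range[of "v $ i"] by simp
  then show ?thesis by (simp add: cube_def)
qed

lemma cube_map_funpow:
  assumes "interval_map g" "v \<in> cube"
  shows "(cube_map k g ^^ n) v \<in> cube"
    and "(cube_map k g ^^ n) v $ i = (if i = k then (g ^^ n) (v $ k) else (zigzag ^^ n) (v $ i))"
proof -
  show *: "(cube_map k g ^^ n) v \<in> cube" for n
    by (induction n) (simp_all add: assms cube_map_cube)
  show "(cube_map k g ^^ n) v $ i = (if i = k then (g ^^ n) (v $ k) else (zigzag ^^ n) (v $ i))"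
    by (induction n arbitrary: i) (simp_all add: cube_map_nth[OF *])
qed

lemma continuous_on_cube_map:
  fixes k :: "'n::finite"
  assumes "interval_map g"
  shows "continuous_on cube (cube_map k g)"
proof -
  have 1: "continuous_on cube (\<lambda>v. g (v $ k))"
  proof (rule continuous_on_compose2[of "{0..1}" g])
    show "continuous_on {0..1} g" using assms by (simp add: interval_map_def)
    show "continuous_on cube (\<lambda>v::real^'n. v $ k)" by (intro continuous_intros)
  qed (auto simp: cube_def)
  have 2: "continuous_on cube (\<lambda>v::real^'n. zigzag (v $ i))" for i
  proof (rule continuous_on_compose2[of UNIV zigzag])
    show "continuous_on UNIV zigzag" by (rule continuous_on_zigzag)
    show "continuous_on cube (\<lambda>v::real^'n. v $ i)" by (intro continuous_intros)
  qed auto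
  have "continuous_on cube (\<lambda>v. if i = k then g (v $ k) else zigzag (v $ i))" for i
    using 1 2[of i] by (cases "i = k") simp_all
  then have "continuous_on cube (\<lambda>v. \<chi> i. if i = k then g (v $ k) else zigzag (v $ i))"
    by (intro continuous_on_vec_lambda)
  then show ?thesis
    by (rule continuous_on_eq) (simp add: cube_map_def)
qed

lemma topspace_TDS_unit_cube:
  "T \<in> topspace (TDS unit_cube) \<longleftrightarrow> T \<in> extensional cube \<and> continuous_on cube T \<and> T ` cube \<subseteq> cube"
  unfolding TDS_def topspace_mtopology_of mem_cfunspace_compact[OF compact_space_unit_cube]
  by (auto simp: mtopology_unit_cube mspace_unit_cube continuous_map_in_subtopology)

lemma cube_map_TDS:
  assumes "interval_map g"
  shows "cube_map k g \<in> topspace (TDS unit_cube)"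
  unfolding topspace_TDS_unit_cube
proof (intro conjI image_subsetI)
  show "cube_map k g \<in> extensional cube" unfolding cube_map_def by simp
qed (simp_all add: continuous_on_cube_map cube_map_cube assms)

lemma cube_map_is_tds: 
  assumes "interval_map g"
  shows "is_tds (mtopology_of unit_cube) (cube_map k g)"
  using cube_map_TDS[OF assms, of k] compact_space_unit_cube metrizable_unit_cube
  unfolding is_tds_def topspace_TDS_unit_cube
  by (auto simp: mtopology_unit_cube continuous_map_in_subtopology)

lemma mdist_cube_map:
  fixes k :: "'n::finite"
  assumes "0 \<le> e" "\<And>t. t \<in> {0..1} \<Longrightarrow> \<bar>g t - h t\<bar> \<le> e"
  shows "mdist (cfunspace (mtopology_of unit_cube) unit_cube) (cube_map k g) (cube_map k h) \<le> e"
proof (rule mdist_cfunspace_le)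
  fix v :: "real ^ 'n" assume "v \<in> topspace (mtopology_of unit_cube)"
  then have v: "v \<in> cube" by (simp add: mspace_unit_cube)
  have "cube_map k g v - cube_map k h v = axis k (g (v $ k) - h (v $ k))"
    by (simp add: vec_eq_iff cube_map_nth[OF v] axis_def)
  then have "dist (cube_map k g v) (cube_map k h v) = \<bar>g (v $ k) - h (v $ k)\<bar>"
    by (simp add: dist_norm norm_eq_sqrt_inner inner_axis_axis)
  then show "mdist unit_cube (cube_map k g v) (cube_map k h v) \<le> e"
    using assms(2)[OF cubeD[OF v, of k]] by (simp add: mdist_unit_cube)
qed (rule assms(1))

text \<open>
  A uniform form of topological exactness: points with a prescribed image are found near every point
  of \<open>J\<close>, simultaneously for all \<open>n \<ge> N\<close>. The uniformity allows exactness to be combined over coordinates.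
\<close>

definition exact_on :: "(real \<Rightarrow> real) \<Rightarrow> real set \<Rightarrow> bool" where
  "exact_on g J \<longleftrightarrow> J \<subseteq> {0..1} \<and>
    (\<forall>r>0. \<exists>N. \<forall>n\<ge>N. \<forall>c\<in>J. \<forall>u\<in>J. \<exists>s\<in>J. \<bar>s - c\<bar> < r \<and> (g ^^ n) s = u)"

lemma exact_on_fixed_point:
  assumes "t \<in> {0..1}" "g t = t"
  shows "exact_on g {t}"
proof -
  have "(g ^^ n) t = t" for n by (induction n) (simp_all add: assms)
  then show ?thesis using assms(1) by (simp add: exact_on_def)
qed

lemma exact_on_minimal_killed:
  assumes w: "minimal_killed D w"
  shows "exact_on (glue_lim D) (at_word w ` {0..1})"
  unfolding exact_on_def
proof (intro conjI allI impI)
  show "at_word w ` {0..1} \<subseteq> {0..1}" using at_word_range by blast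
  fix r :: real assume "r > 0"
  then obtain N where N: "\<forall>n\<ge>N. \<forall>c\<in>{0..1}. \<forall>u\<in>{0..1}. \<exists>s\<in>{0..1}. \<bar>s - c\<bar> < r \<and> (zigzag ^^ n) s = u"
    using zigzag_exact by blast
  have it: "(glue_lim D ^^ n) (at_word w s) = at_word w ((zigzag ^^ n) s)" if "s \<in> {0..1}" for n s
    by (induction n) (simp_all add: glue_lim_minimal_killed[OF w interval_map_funpow[OF interval_map_zigzag that]])
  show "\<exists>N. \<forall>n\<ge>N. \<forall>c\<in>at_word w ` {0..1}. \<forall>u\<in>at_word w ` {0..1}. \<exists>s\<in>at_word w ` {0..1}. \<bar>s - c\<bar> < r \<and> (glue_lim D ^^ n) s = u"
  proof (intro exI[of _ N] allI impI ballI)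
    fix n c u assume n: "N \<le> n" and "c \<in> at_word w ` {0..1}" "u \<in> at_word w ` {0..1}"
    then obtain c' u' where cu: "c' \<in> {0..1}" "c = at_word w c'" "u' \<in> {0..1}" "u = at_word w u'" by blast
    from N[rule_format, OF n cu(1,3)] obtain s where s: "s \<in> {0..1}" "\<bar>s - c'\<bar> < r" "(zigzag ^^ n) s = u'" by blast
    have "\<bar>at_word w s - c\<bar> = \<bar>s - c'\<bar> / 2 ^ length w"
      unfolding cu(2) at_word_diff by (simp add: abs_divide)
    also have "\<dots> \<le> \<bar>s - c'\<bar> / 1" by (intro divide_left_mono) auto
    finally have "\<bar>at_word w s - c\<bar> < r" using s(2) by simp
    moreover have "(glue_lim D ^^ n) (at_word w s) = u" using it[OF s(1)] s(3) cu(4) by simp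
    ultimately show "\<exists>s\<in>at_word w ` {0..1}. \<bar>s - c\<bar> < r \<and> (glue_lim D ^^ n) s = u" using s(1) by blast
  qed
qed

lemma cube_map_exact:
  fixes U :: "(real ^ 'n) set"
  assumes g: "interval_map g" and J: "exact_on g J"
    and U: "openin (top_of_set cube) U" "U \<inter> {v \<in> cube. v $ k \<in> J} \<noteq> {}"
  shows "\<exists>N. \<forall>n\<ge>N. {v \<in> cube. v $ k \<in> J} \<subseteq> (cube_map k g ^^ n) ` (U \<inter> {v \<in> cube. v $ k \<in> J})"
proof -
  obtain v where v: "v \<in> U" "v \<in> cube" "v $ k \<in> J" using U(2) by blast
  obtain e where e: "e > 0" "\<And>x. x \<in> cube \<Longrightarrow> dist x v < e \<Longrightarrow> x \<in> U"
    using U(1) v(1) unfolding openin_euclidean_subtopology_iff by blast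
  \<comment> \<open>Coordinatewise distances below \<open>r\<close> add up to a Euclidean distance below \<open>e\<close>.\<close>
  define r where "r = e / real CARD('n)"
  have r: "r > 0" using e(1) by (simp add: r_def)
  obtain N1 where N1: "\<forall>n\<ge>N1. \<forall>c\<in>J. \<forall>u\<in>J. \<exists>s\<in>J. \<bar>s - c\<bar> < r \<and> (g ^^ n) s = u"
    using J r unfolding exact_on_def by blast
  obtain N2 where N2: "\<forall>n\<ge>N2. \<forall>c\<in>{0..1}. \<forall>u\<in>{0..1}. \<exists>s\<in>{0..1}. \<bar>s - c\<bar> < r \<and> (zigzag ^^ n) s = u"
    using zigzag_exact[OF r] by blast
  have "u \<in> (cube_map k g ^^ n) ` (U \<inter> {v \<in> cube. v $ k \<in> J})"
    if n: "n \<ge> max N1 N2" and u: "u \<in> cube" "u $ k \<in> J" for n u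
  proof -
    obtain a where a: "a \<in> J" "\<bar>a - v $ k\<bar> < r" "(g ^^ n) a = u $ k"
      using N1[rule_format, of n "v $ k" "u $ k"] n v(3) u(2) by auto
    have "\<exists>s\<in>{0..1}. \<bar>s - v $ i\<bar> < r \<and> (zigzag ^^ n) s = u $ i" for i
      using n by (intro N2[rule_format] cubeD v(2) u(1)) auto
    then obtain s where s: "\<And>i. s i \<in> {0..1}" "\<And>i. \<bar>s i - v $ i\<bar> < r" "\<And>i. (zigzag ^^ n) (s i) = u $ i" by metis
    define x where "x = (\<chi> i. if i = k then a else s i)"
    have aI: "a \<in> {0..1}" using a(1) J by (auto simp: exact_on_def)
    have x: "x \<in> cube" using aI s(1) by (simp add: x_def cube_def)
    have "norm (x - v) \<le> (\<Sum>i\<in>UNIV. \<bar>(x - v) $ i\<bar>)" by (rule norm_le_l1_cart)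
    also have "\<dots> < of_nat (card (UNIV :: 'n set)) * r"
      by (rule sum_bounded_above_strict) (use a(2) s(2) in \<open>auto simp: x_def\<close>)
    also have "\<dots> = e" by (simp add: r_def)
    finally have "x \<in> U" using e(2) x by (simp add: dist_norm)
    moreover have "x $ k \<in> J" using a(1) by (simp add: x_def)
    moreover have "(cube_map k g ^^ n) x = u"
      by (simp add: vec_eq_iff cube_map_funpow(2)[OF g x]) (simp add: x_def a(3) s(3))
    ultimately show ?thesis using x by blast
  qed
  then show ?thesis by (intro exI[of _ "max N1 N2"]) blast
qed

text \<open>
  In a factor of entropy zero every exact piece becomes a point. The pieces are the fibres over
  surviving points, together with countably many slabs over killed intervals, so the factor is countable; it
  is connected as an image of the cube, and an uncountable cardinality is the only alternative to being a point.
\<close>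

lemma cube_map_cpe_if_countable:
  assumes "countable (surviving D)"
  shows "has_cpe (mtopology_of (unit_cube :: (real ^ 'n) metric)) (cube_map k (glue_lim D))"
  unfolding has_cpe_def
proof (intro conjI allI impI)
  let ?X = "mtopology_of (unit_cube :: (real ^ 'n) metric)"
  let ?T = "cube_map k (glue_lim D)"
  have tX: "topspace ?X = cube" by (simp add: mspace_unit_cube)
  show tds: "is_tds ?X ?T" by (rule cube_map_is_tds[OF interval_map_glue_lim])
  fix Y :: "real topology" and S assume fac: "is_factor ?X ?T Y S \<and> \<not> (\<exists>y. topspace Y = {y})"
  show "topological_entropy Y S > 0"
  proof (rule ccontr)
    assume ent: "\<not> topological_entropy Y S > 0"
    obtain \<phi> where \<phi>: "continuous_map ?X Y \<phi>" "\<phi> ` cube = topspace Y"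
      "\<And>x. x \<in> topspace ?X \<Longrightarrow> \<phi> (?T x) = S (\<phi> x)" and Y: "is_tds Y S"
      using fac unfolding is_factor_def tX by blast
    have collapse: "\<phi> a = \<phi> b" if J: "exact_on (glue_lim D) J" and ab: "a \<in> cube" "a $ k \<in> J" "b \<in> cube" "b $ k \<in> J" for J a b
    proof (rule ccontr)
      assume "\<phi> a \<noteq> \<phi> b"
      then have "topological_entropy Y S > 0"
      proof (intro horseshoe_positive_entropy[OF tds conjunct1[OF fac] \<phi>(1,3), of "{v \<in> cube. v $ k \<in> J}" a b])
        show "{v \<in> cube. v $ k \<in> J} \<subseteq> topspace ?X" using tX by blast
        show "\<exists>N. \<forall>n\<ge>N. {v \<in> cube. v $ k \<in> J} \<subseteq> (?T ^^ n) ` (U \<inter> {v \<in> cube. v $ k \<in> J})"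
          if "openin ?X U" "U \<inter> {v \<in> cube. v $ k \<in> J} \<noteq> {}" for U
          using that(1) unfolding mtopology_unit_cube by (intro cube_map_exact interval_map_glue_lim J that(2))
      qed (use ab in auto)
      then show False using ent by blast
    qed
    define p :: "real \<Rightarrow> real ^ 'n" where "p t = (\<chi> i. if i = k then t else 0)" for t
    have p: "p t \<in> cube" "p t $ k = t" if "t \<in> {0..1}" for t using that by (auto simp: p_def cube_def)
    have "topspace Y \<subseteq> (\<lambda>t. \<phi> (p t)) ` (surviving D \<union> range (\<lambda>w. at_word w 0))"
    proof
      fix y assume "y \<in> topspace Y"
      then obtain v where v: "v \<in> cube" "y = \<phi> v" using \<phi>(2) by blast
      have vk: "v $ k \<in> {0..1}" using v(1) by (rule cubeD)
      show "y \<in> (\<lambda>t. \<phi> (p t)) ` (surviving D \<union> range (\<lambda>w. at_word w 0))"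
      proof (cases "v $ k \<in> surviving D")
        case True
        have "\<phi> v = \<phi> (p (v $ k))"
          by (rule collapse[OF exact_on_fixed_point[of _ "glue_lim D", OF vk glue_lim_surviving[OF True]] v(1) _ p(1)[OF vk]])
            (simp_all add: p(2)[OF vk])
        then show ?thesis using True v(2) by blast
      next
        case False
        then obtain w where w: "minimal_killed D w" "v $ k \<in> at_word w ` {0..1}"
          using surviving_or_killed[OF vk, of D] by blast
        have z: "at_word w 0 \<in> {0..1}" by (rule at_word_range) simp
        have z': "at_word w 0 \<in> at_word w ` {0..1}" by simp
        have "\<phi> v = \<phi> (p (at_word w 0))"
          by (rule collapse[OF exact_on_minimal_killed[OF w(1)] v(1) w(2) p(1)[OF z]])
            (simp only: p(2)[OF z] z')
        then show ?thesis using v(2) by blast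
      qed
    qed
    moreover have "countable (surviving D \<union> range (\<lambda>w. at_word w 0))" using assms by simp
    ultimately have cY: "countable (topspace Y)" by (meson countable_image countable_subset)
    have "connected_space Y"
    proof -
      have "connectedin ?X (topspace ?X)"
        unfolding connectedin_topspace mtopology_unit_cube by (simp add: connected_space_subtopology cube_cbox convex_connected)
      then have "connectedin Y (\<phi> ` topspace ?X)" by (rule connectedin_continuous_map_image[OF \<phi>(1)])
      then show ?thesis by (simp only: tX \<phi>(2) connectedin_topspace)
    qed
    moreover have mY: "metrizable_space Y" using Y by (simp add: is_tds_def)
    moreover have "\<not> (\<exists>a. topspace Y \<subseteq> {a})"
    proof
      assume "\<exists>a. topspace Y \<subseteq> {a}"
      then obtain a where a: "topspace Y \<subseteq> {a}" by blast
      have "\<phi> (p 0) \<in> topspace Y" using \<phi>(2) p(1)[of 0] by auto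
      then have "topspace Y = {a}" using a by blast
      then show False using fac by blast
    qed
    ultimately have "(UNIV :: real set) \<lesssim> topspace Y"
      by (intro connected_space_imp_card_ge metrizable_imp_normal_space) (auto intro: metrizable_imp_t1_space)
    then have "countable (UNIV :: real set)" using cY countable_lepoll by blast
    then show False using uncountable_UNIV_real by blast
  qed
qed

lemma cube_map_not_cpe_if_uncountable:
  assumes "uncountable (surviving D)"
  shows "\<not> has_cpe (mtopology_of (unit_cube :: (real ^ 'n) metric)) (cube_map k (glue_lim D))"
proof
  let ?X = "mtopology_of (unit_cube :: (real ^ 'n) metric)"
  let ?T = "cube_map k (glue_lim D)"
  let ?Y = "top_of_set {0..1::real}"
  assume cpe: "has_cpe ?X ?T"
  obtain f :: "real \<Rightarrow> real" where f: "continuous_on {0..1} f" "f ` {0..1} = {0..1}"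
    "\<And>t. t \<in> {0..1} \<Longrightarrow> f (glue_lim D t) = f t"
    using glue_lim_identity_factor[OF assms] by blast
  define \<phi> where "\<phi> v = f (v $ k)" for v :: "real ^ 'n"
  have tX: "topspace ?X = cube" by (simp add: mspace_unit_cube)
  have cY: "compact_space ?Y" by (simp add: compact_space_subtopology)
  have nth: "(\<lambda>v::real^'n. v $ k) ` cube = {0..1}"
  proof
    show "{0..1} \<subseteq> (\<lambda>v::real^'n. v $ k) ` cube"
    proof
      fix t :: real assume "t \<in> {0..1}"
      then show "t \<in> (\<lambda>v::real^'n. v $ k) ` cube" by (intro image_eqI[of _ _ "\<chi> i. t"]) (auto simp: cube_def)
    qed
  qed (auto simp: cube_def)
  have "is_factor ?X ?T ?Y id"
    unfolding is_factor_def
  proof (intro conjI exI[of _ \<phi>] ballI)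
    show "is_tds ?Y id"
      using cY by (simp add: is_tds_def metrizable_space_subtopology metrizable_space_euclidean id_def)
    have "continuous_on cube (\<lambda>v::real^'n. v $ k)" by (intro continuous_intros)
    then have "continuous_on cube \<phi>" unfolding \<phi>_def
      by (rule continuous_on_compose2[OF f(1)]) (simp add: nth)
    moreover show im: "\<phi> ` topspace ?X = topspace ?Y"
      unfolding tX \<phi>_def using nth f(2) by (metis image_image topspace_euclidean_subtopology)
    ultimately show "continuous_map ?X ?Y \<phi>"
      unfolding mtopology_unit_cube by (auto simp: continuous_map_in_subtopology tX)
    fix v assume "v \<in> topspace ?X"
    then have v: "v \<in> cube" using tX by blast
    show "\<phi> (?T v) = id (\<phi> v)" using f(3)[OF cubeD[OF v]] by (simp add: \<phi>_def cube_map_nth[OF v])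
  qed
  moreover have "\<not> (\<exists>y. topspace ?Y = {y})"
  proof
    assume "\<exists>y. topspace ?Y = {y}"
    then obtain y where "{0..1} = {y::real}" by auto
    then have "(0::real) = y" "(1::real) = y" by (metis atLeastAtMost_iff order_refl singletonD zero_le_one)+
    then show False by simp
  qed
  ultimately have "topological_entropy ?Y id > 0" by (rule has_cpe_factorD[OF cpe])
  moreover have "topological_entropy ?Y id \<le> 0" by (rule topological_entropy_identity[OF cY]) simp
  ultimately show False by simp
qed

text \<open>
  Only finitely many patterns of membership in the sets \<open>R i j\<close> with \<open>i, j < m\<close> are possible.
\<close>

lemma borel_of_finite_depend:
  fixes R :: "nat \<Rightarrow> nat \<Rightarrow> 'y set"
  assumes R: "\<And>i j. R i j \<in> sets (borel_of Y)"
  shows "{y \<in> topspace Y. P {(i, j). i < m \<and> j < m \<and> y \<in> R i j}} \<in> sets (borel_of Y)"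
proof -
  define G where "G = {..<m} \<times> {..<m::nat}"
  define E where "E y = {(i, j). i < m \<and> j < m \<and> y \<in> R i j}" for y
  define B where "B A = {y \<in> space (borel_of Y). \<forall>p\<in>G. (y \<in> R (fst p) (snd p)) = (p \<in> A)}" for A
  have fG: "finite G" by (simp add: G_def)
  have EB: "y \<in> B A \<longleftrightarrow> E y = A" if "y \<in> topspace Y" "A \<subseteq> G" for y A
  proof
    assume "y \<in> B A"
    then show "E y = A" using that(2) by (fastforce simp: B_def E_def G_def)
  next
    assume "E y = A"
    then show "y \<in> B A" using that(1) by (auto simp: B_def E_def G_def)
  qed
  have EG: "E y \<subseteq> G" for y by (auto simp: E_def G_def)
  have "{y \<in> topspace Y. P (E y)} = (\<Union>A\<in>{A. A \<subseteq> G \<and> P A}. B A)"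
  proof (intro equalityI subsetI)
    fix y assume "y \<in> {y \<in> topspace Y. P (E y)}"
    then have y: "y \<in> topspace Y" "P (E y)" by auto
    have "y \<in> B (E y)" using EB[OF y(1) EG] by simp
    then show "y \<in> (\<Union>A\<in>{A. A \<subseteq> G \<and> P A}. B A)" using y(2) EG by blast
  next
    fix y assume "y \<in> (\<Union>A\<in>{A. A \<subseteq> G \<and> P A}. B A)"
    then obtain A where A: "A \<subseteq> G" "P A" "y \<in> B A" by blast
    have "y \<in> topspace Y" using A(3) by (simp add: B_def)
    then show "y \<in> {y \<in> topspace Y. P (E y)}" using EB[OF _ A(1)] A by simp
  qed
  moreover have "finite {A. A \<subseteq> G \<and> P A}" by (rule finite_subset[OF _ finite_Pow_iff[THEN iffD2, OF fG]]) auto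
  moreover have "B A \<in> sets (borel_of Y)" for A
    unfolding B_def
  proof (intro sets.sets_Collect_finite_All fG)
    fix p
    have 1: "{y \<in> space (borel_of Y). y \<in> R (fst p) (snd p)} = R (fst p) (snd p)"
      using sets.sets_into_space[OF R] by blast
    have 2: "{y \<in> space (borel_of Y). \<not> y \<in> R (fst p) (snd p)} = space (borel_of Y) - R (fst p) (snd p)" by blast
    show "{y \<in> space (borel_of Y). (y \<in> R (fst p) (snd p)) = (p \<in> A)} \<in> sets (borel_of Y)"
    proof (cases "p \<in> A")
      case True
      then show ?thesis using 1 R by simp
    next
      case False
      then show ?thesis using 2 sets.compl_sets[OF R[of "fst p" "snd p"]] by simp
    qed
  qed
  ultimately have "{y \<in> topspace Y. P (E y)} \<in> sets (borel_of Y)" by (simp only: sets.finite_UN)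
  then show ?thesis by (simp add: E_def)
qed

text \<open>
  Up to an error of \<open>2 ^ (- m)\<close> the map is determined by words of length below \<open>m\<close>, hence by the restriction of
  the graph to the vertices below \<open>m\<close>. An open set contains the map exactly when, for some \<open>m\<close>, it
  contains the whole ball of this radius about the approximation.
\<close>

lemma measurable_cube_map_clique:
  fixes R :: "nat \<Rightarrow> nat \<Rightarrow> 'y set" and k :: "'n::finite"
  assumes R: "\<And>i j. R i j \<in> sets (borel_of Y)"
  shows "(\<lambda>y. cube_map k (glue_lim (non_clique (\<lambda>i j. y \<in> R i j)))) \<in> measurable (borel_of Y) (borel_of (TDS unit_cube))"
    (is "?F \<in> _")
proof (rule measurable_sigma_sets[OF sets_borel_of])
  let ?C = "cfunspace (mtopology_of unit_cube) (unit_cube :: (real ^ 'n) metric)"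
  show "{U. openin (TDS (unit_cube :: (real ^ 'n) metric)) U} \<subseteq> Pow (topspace (TDS unit_cube))" by (auto dest: openin_subset)
  have FT: "?F y \<in> topspace (TDS unit_cube)" for y by (rule cube_map_TDS[OF interval_map_glue_lim])
  then show "?F \<in> space (borel_of Y) \<rightarrow> topspace (TDS unit_cube)" by blast
  define F where "F m y = cube_map k (glue m (non_clique (\<lambda>i j. y \<in> R i j)))" for m y
  have Fm: "F m y \<in> topspace (TDS unit_cube)" for m y unfolding F_def by (rule cube_map_TDS[OF interval_map_glue])
  have tT: "topspace (TDS unit_cube) = mspace ?C" by (simp only: TDS_def topspace_mtopology_of)
  have close: "mdist ?C (F m y) (?F y) \<le> (1/2) ^ m" for m y
    unfolding F_def by (intro mdist_cube_map glue_lim_close) auto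
  fix U assume "U \<in> {U. openin (TDS (unit_cube :: (real ^ 'n) metric)) U}"
  then have U: "openin (TDS (unit_cube :: (real ^ 'n) metric)) U" by simp
  define V where "V m T \<longleftrightarrow> (\<forall>T'\<in>mspace ?C. mdist ?C T T' \<le> (1/2) ^ m \<longrightarrow> T' \<in> U)" for m T
  have "V m (F m y) = V m (cube_map k (glue m (non_clique (\<lambda>i j. (i, j) \<in> {(i, j). i < m \<and> j < m \<and> y \<in> R i j}))))" for m y
  proof -
    have "non_clique (\<lambda>i j. y \<in> R i j) w = non_clique (\<lambda>i j. (i, j) \<in> {(i, j). i < m \<and> j < m \<and> y \<in> R i j}) w" if "length w < m" for w
      using that by (auto simp: non_clique_def)
    then have "glue m (non_clique (\<lambda>i j. y \<in> R i j)) = glue m (non_clique (\<lambda>i j. (i, j) \<in> {(i, j). i < m \<and> j < m \<and> y \<in> R i j}))"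
      by (intro ext glue_cong)
    then show ?thesis by (simp only: F_def)
  qed
  then have Vm: "{y \<in> topspace Y. V m (F m y)} \<in> sets (borel_of Y)" for m
    using borel_of_finite_depend[OF R, where m = m and P = "\<lambda>E. V m (cube_map k (glue m (non_clique (\<lambda>i j. (i, j) \<in> E))))"]
    by (simp only:)
  have "?F -` U \<inter> space (borel_of Y) = (\<Union>m. {y \<in> topspace Y. V m (F m y)})"
  proof (intro equalityI subsetI)
    fix y assume "y \<in> ?F -` U \<inter> space (borel_of Y)"
    then have y: "y \<in> topspace Y" "?F y \<in> U" by auto
    interpret C: Metric_space "mspace ?C" "mdist ?C" by (rule Metric_space_mspace_mdist)
    have "openin C.mtopology U" using U by (simp only: TDS_def mtopology_of_def)
    then obtain r where r: "r > 0" "C.mball (?F y) r \<subseteq> U" using y(2) unfolding C.openin_mtopology by blast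
    obtain m where m: "(1/2::real) ^ m < r / 2" using real_arch_pow_inv[of "r/2" "1/2"] r(1) by auto
    have "T \<in> U" if T: "T \<in> mspace ?C" "mdist ?C (F m y) T \<le> (1/2) ^ m" for T
    proof -
      have FF: "?F y \<in> mspace ?C" "F m y \<in> mspace ?C" using FT[of y] Fm[of m y] by (simp_all only: tT)
      have "mdist ?C (?F y) T \<le> mdist ?C (?F y) (F m y) + mdist ?C (F m y) T" by (rule C.triangle[OF FF T(1)])
      also have "mdist ?C (?F y) (F m y) = mdist ?C (F m y) (?F y)" by (rule C.commute)
      finally have "mdist ?C (?F y) T < r" using close[of m y] T(2) m by linarith
      then have "T \<in> C.mball (?F y) r" unfolding C.in_mball using FF(1) T(1) by blast
      then show ?thesis using r(2) by blast
    qed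
    then have "V m (F m y)" unfolding V_def by blast
    then show "y \<in> (\<Union>m. {y \<in> topspace Y. V m (F m y)})" using y(1) by blast
  next
    fix y assume "y \<in> (\<Union>m. {y \<in> topspace Y. V m (F m y)})"
    then obtain m where y: "y \<in> topspace Y" "V m (F m y)" by blast
    have "?F y \<in> U" using y(2) FT[of y] close[of m y] unfolding V_def tT by blast
    then show "y \<in> ?F -` U \<inter> space (borel_of Y)" using y(1) by simp
  qed
  moreover have "(\<Union>m. {y \<in> topspace Y. V m (F m y)}) \<in> sets (borel_of Y)" using Vm by (intro sets.countable_UN) blast
  ultimately show "?F -` U \<inter> space (borel_of Y) \<in> sets (borel_of Y)" by (simp only:)
qed

theorem theorem4p1:
  shows "complete_coanalytic_in (TDS (unit_cube :: (real ^ 'n) metric)) (CPE (unit_cube :: (real ^ 'n) metric))"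
  unfolding complete_coanalytic_in_def
proof (intro conjI allI impI)
  let ?m = "unit_cube :: (real ^ 'n) metric"
  have sep: "separable_space (mtopology_of ?m)"
    by (rule compact_metrizable_imp_separable[OF compact_space_unit_cube metrizable_unit_cube])
  show "polish_space_in (TDS ?m)"
    unfolding TDS_def
    by (intro polish_cfunspace compact_space_unit_cube metrizable_unit_cube compact_imp_mcomplete_of sep)
  have "mspace ?m \<noteq> {}" unfolding mspace_unit_cube by (auto simp: cube_def intro!: exI[of _ 0])
  then show "coanalytic_in (TDS ?m) (CPE ?m)"
    by (intro coanalytic_CPE compact_space_unit_cube)
  fix Y :: "real topology" and B
  assume "polish_space_in Y \<and> coanalytic_in Y B"
  then have Y: "polish_space_in Y" and B: "B \<subseteq> topspace Y" "analytic_in Y (topspace Y - B)"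
    by (auto simp: coanalytic_in_def)
  have "Hausdorff_space Y"
    using Y unfolding polish_space_in_def by (meson completely_metrizable_imp_metrizable_space metrizable_imp_Hausdorff_space)
  from analytic_clique[OF B(2) this] obtain R :: "nat \<Rightarrow> nat \<Rightarrow> real set" where
    R: "\<And>i j. closedin Y (R i j)" and
    cl: "\<And>y. y \<in> topspace Y \<Longrightarrow> y \<in> topspace Y - B \<longleftrightarrow> (\<exists>N. infinite N \<and> (\<forall>i\<in>N. \<forall>j\<in>N. y \<in> R i j))"
    by blast
  \<comment> \<open>An arbitrary coordinate; there is at least one.\<close>
  define k where "k = (undefined :: 'n)"
  let ?F = "\<lambda>y. cube_map k (glue_lim (non_clique (\<lambda>i j. y \<in> R i j)))"
  show "\<exists>f\<in>measurable (borel_of Y) (borel_of (TDS ?m)). {y \<in> topspace Y. f y \<in> CPE ?m} = B"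
  proof (intro bexI[of _ ?F])
    show "?F \<in> measurable (borel_of Y) (borel_of (TDS ?m))"
      by (intro measurable_cube_map_clique borel_of_closedin R)
    have "?F y \<in> CPE ?m \<longleftrightarrow> y \<in> B" if y: "y \<in> topspace Y" for y
    proof -
      have "?F y \<in> CPE ?m \<longleftrightarrow> has_cpe (mtopology_of ?m) (?F y)"
        unfolding CPE_def using cube_map_TDS[OF interval_map_glue_lim] by blast
      also have "\<dots> \<longleftrightarrow> countable (surviving (non_clique (\<lambda>i j. y \<in> R i j)))"
        using cube_map_cpe_if_countable cube_map_not_cpe_if_uncountable by blast
      also have "\<dots> \<longleftrightarrow> y \<in> B" using countable_surviving_iff[of "\<lambda>i j. y \<in> R i j"] cl[OF y] y by blast
      finally show ?thesis .
    qed
    then show "{y \<in> topspace Y. ?F y \<in> CPE ?m} = B" using B(1) by blast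
  qed
qed

end
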